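(* Let $\phi:(M^m,g)\to(N^n,h)$, $m>n$, be a Riemannian submersion such that the mean curvature vector field $\mu$ of the fibers is basic. Then $\phi$ is biharmonic if and only if $$\mathrm d\phi\Big(\sum_{i=1}^n\big\{\nabla^M_{e_i}(\nabla^M_{e_i}\mu)^{\mathcal H}-\nabla^M_{(\nabla^M_{e_i}e_i)^{\mathcal H}}\mu\big\}-(m-n)\nabla^M_\mu\mu\Big)+\mathrm{Ricci}^N(\mathrm d\phi(\mu))=0,$$ where $\{e_1,\dots,e_n,e_{n+1},\dots,e_m\}$ is a local orthonormal frame on $M$ with $e_i$ horizontal for $1\le i\le n$ and $e_s$ vertical for $n+1\le s\le m$ (the equation being required near every point of $M$), and $\mu=\frac{1}{m-n}\sum_{s=n+1}^{m}(\nabla^M_{e_s}e_s)^{\mathcal H}$.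
   Context: For a map $\phi:(M,g)\to(N,h)$ between Riemannian manifolds, the tension field is $\tau(\phi)=\mathrm{Trace}_g\nabla \mathrm d\phi$, a section of $\phi^{-1}TN$. The map $\phi$ is biharmonic if its bitension field $\tau_2(\phi)=-\Delta^\phi(\tau(\phi))-\mathrm{Trace}_g R^N(\mathrm d\phi,\tau(\phi))\mathrm d\phi$ vanishes, where $\Delta^\phi=-\mathrm{Trace}_g(\nabla^\phi\nabla^\phi-\nabla^\phi_{\nabla^M})$ is the Laplacian on sections of $\phi^{-1}TN$, $\nabla^\phi$ is the pull-back connection, and $R^N(X,Y)Z=[\nabla^N_X,\nabla^N_Y]Z-\nabla^N_{[X,Y]}Z$. $\nabla^M,\nabla^N$ are the Levi-Civita connections. For a Riemannian submersion, $(\cdot)^{\mathcal H}$ denotes the projection of $TM$ onto the horizontal distribution $(\ker \mathrm d\phi)^\perp$; vertical vectors are those in $\ker \mathrm d\phi$. A vector field on $M$ is basic if it is horizontal and $\phi$-related to a vector field on $N$. $\mathrm{Ricci}^N$ is the Ricci operator, $\mathrm{Ricci}^N(X)=\sum_i R^N(X,\varepsilon_i)\varepsilon_i$ for an orthonormal frame $\{\varepsilon_i\}$ on $N$, applied pointwise along $\phi$. *)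

theory Defs
  imports "HOL-Analysis.Analysis"
begin

text \<open>
  A manifold is a Hausdorff, second countable type together with a smooth atlas; its
  dimension is the dimension of the model space. Tensorial objects are represented by their
  components in charts, with the transformation law under changes of charts imposed
  explicitly: a vector field is a function \<open>X\<close> such that \<open>X p c\<close> is the component vector of
  \<open>X\<close> at \<open>p\<close> in the chart \<open>c\<close>, a metric is a function \<open>g\<close> such that \<open>g p c\<close> is the bilinear form
  representing it at \<open>p\<close> in \<open>c\<close>, and for a section \<open>V\<close> of \<open>\<phi>\<^sup>-\<^sup>1 TN\<close>, \<open>V p c d\<close> is the component
  vector of \<open>V\<close> at \<open>p\<close> in the chart \<open>d\<close> of \<open>N\<close>, where \<open>c\<close> is the chart of \<open>M\<close> used in the
  computation. Differential operators are given by their coordinate expressions in each chart.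
  Components have no meaning for \<open>c\<close> outside the atlas or \<open>p\<close> outside the domain of \<open>c\<close>.
\<close>

section \<open>Smooth maps between open sets of Euclidean spaces\<close>

text \<open>Only used for open \<open>S\<close>.\<close>

primrec Ck_on :: "nat \<Rightarrow> 'e::euclidean_space set \<Rightarrow> ('e \<Rightarrow> 'f::real_normed_vector) \<Rightarrow> bool" where
  "Ck_on 0 S f \<longleftrightarrow> continuous_on S f"
| "Ck_on (Suc k) S f \<longleftrightarrow>
     (\<forall>y\<in>S. f differentiable (at y)) \<and> (\<forall>v. Ck_on k S (\<lambda>y. frechet_derivative f (at y) v))"

definition smooth_on :: "'e::euclidean_space set \<Rightarrow> ('e \<Rightarrow> 'f::real_normed_vector) \<Rightarrow> bool" where
  "smooth_on S f \<longleftrightarrow> (\<forall>k. Ck_on k S f)"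


section \<open>Manifolds, vector fields, metrics\<close>

datatype ('a, 'e) chart = Chart (cdom: "'a set") (coord: "'a \<Rightarrow> 'e")

definition cinv :: "('a, 'e) chart \<Rightarrow> 'e \<Rightarrow> 'a" where
  "cinv c = inv_into (cdom c) (coord c)"

definition is_chart :: "('a::topological_space, 'e::euclidean_space) chart \<Rightarrow> bool" where
  "is_chart c \<longleftrightarrow> open (cdom c) \<and> open (coord c ` cdom c) \<and>
     homeomorphism (cdom c) (coord c ` cdom c) (coord c) (cinv c)"

definition smooth_atlas ::
    "('a::{t2_space, second_countable_topology}, 'e::euclidean_space) chart set \<Rightarrow> bool" where
  "smooth_atlas A \<longleftrightarrow> (\<forall>c\<in>A. is_chart c) \<and> (\<Union>c\<in>A. cdom c) = UNIV \<and>
     (\<forall>c\<in>A. \<forall>c'\<in>A. smooth_on (coord c ` (cdom c \<inter> cdom c')) (coord c' \<circ> cinv c))"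

text \<open>The differential of the change of charts from \<open>c\<close> to \<open>c'\<close> at \<open>p\<close>.\<close>

definition chart_change :: "('a, 'e::euclidean_space) chart \<Rightarrow> ('a, 'e) chart \<Rightarrow> 'a \<Rightarrow> 'e \<Rightarrow> 'e" where
  "chart_change c c' p = frechet_derivative (coord c' \<circ> cinv c) (at (coord c p))"

type_synonym ('a, 'e) field = "'a \<Rightarrow> ('a, 'e) chart \<Rightarrow> 'e"
type_synonym ('a, 'e) metric = "'a \<Rightarrow> ('a, 'e) chart \<Rightarrow> 'e \<Rightarrow> 'e \<Rightarrow> real"

definition vector_field_on ::
    "('a::topological_space, 'e::euclidean_space) chart set \<Rightarrow> 'a set \<Rightarrow> ('a, 'e) field \<Rightarrow> bool" where
  "vector_field_on A W X \<longleftrightarrow>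
     (\<forall>c\<in>A. \<forall>c'\<in>A. \<forall>p \<in> W \<inter> cdom c \<inter> cdom c'. X p c' = chart_change c c' p (X p c)) \<and>
     (\<forall>c\<in>A. smooth_on (coord c ` (W \<inter> cdom c)) (\<lambda>y. X (cinv c y) c))"

definition riemannian_metric ::
    "('a::topological_space, 'e::euclidean_space) chart set \<Rightarrow> ('a, 'e) metric \<Rightarrow> bool" where
  "riemannian_metric A g \<longleftrightarrow>
     (\<forall>c\<in>A. \<forall>p\<in>cdom c. bilinear (g p c) \<and> (\<forall>u v. g p c u v = g p c v u) \<and>
        (\<forall>u. u \<noteq> 0 \<longrightarrow> g p c u u > 0)) \<and>
     (\<forall>c\<in>A. \<forall>c'\<in>A. \<forall>p \<in> cdom c \<inter> cdom c'. \<forall>u v.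
        g p c u v = g p c' (chart_change c c' p u) (chart_change c c' p v)) \<and>
     (\<forall>c\<in>A. \<forall>u v. smooth_on (coord c ` cdom c) (\<lambda>y. g (cinv c y) c u v))"

definition riemannian_manifold ::
    "('a::{t2_space, second_countable_topology}, 'e::euclidean_space) chart set
     \<Rightarrow> ('a, 'e) metric \<Rightarrow> bool" where
  "riemannian_manifold A g \<longleftrightarrow> smooth_atlas A \<and> riemannian_metric A g"

definition orthonormal :: "('e::euclidean_space \<Rightarrow> 'e \<Rightarrow> real) \<Rightarrow> (nat \<Rightarrow> 'e) \<Rightarrow> bool" where
  "orthonormal G b \<longleftrightarrow>
     (\<forall>i\<in>{1..DIM('e)}. \<forall>j\<in>{1..DIM('e)}. G (b i) (b j) = (if i = j then 1 else 0))"

text \<open>The trace of a bilinear map \<open>T\<close> with respect to an inner product \<open>G\<close>.\<close>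

definition metric_trace ::
    "('e::euclidean_space \<Rightarrow> 'e \<Rightarrow> real) \<Rightarrow> ('e \<Rightarrow> 'e \<Rightarrow> 'f::real_vector) \<Rightarrow> 'f" where
  "metric_trace G T = (THE t. \<forall>b. orthonormal G b \<longrightarrow> t = (\<Sum>i=1..DIM('e). T (b i) (b i)))"


section \<open>Levi-Civita connection and curvature\<close>

text \<open>The derivative at \<open>p\<close>, in the direction \<open>u\<close> (components in \<open>c\<close>), of a function on the
  manifold.\<close>

definition dir_deriv :: "('a, 'e::euclidean_space) chart \<Rightarrow> ('a \<Rightarrow> 'f::real_normed_vector)
    \<Rightarrow> 'a \<Rightarrow> 'e \<Rightarrow> 'f" where
  "dir_deriv c f p u = frechet_derivative (\<lambda>y. f (cinv c y)) (at (coord c p)) u"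

text \<open>
  The vector field whose components in the chart under consideration are constant. It serves to
  extend a tangent vector at a point when evaluating expressions which are tensorial in it.
\<close>

abbreviation const_field :: "'e \<Rightarrow> ('a, 'e) field" where
  "const_field u \<equiv> (\<lambda>p c. u)"

text \<open>\<open>christoffel g p c u v\<close> is \<open>\<Sum>\<^sub>i\<^sub>j\<^sub>k \<Gamma>\<^sup>k\<^sub>i\<^sub>j u\<^sup>i v\<^sup>j \<partial>\<^sub>k\<close>, obtained from the Koszul formula for the
  (commuting) coordinate vector fields of \<open>c\<close>.\<close>

definition christoffel :: "('a, 'e::euclidean_space) metric \<Rightarrow> 'a \<Rightarrow> ('a, 'e) chart
    \<Rightarrow> 'e \<Rightarrow> 'e \<Rightarrow> 'e" where
  "christoffel g p c u v = (THE w. \<forall>z. 2 * g p c w z =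
       dir_deriv c (\<lambda>q. g q c v z) p u
     + dir_deriv c (\<lambda>q. g q c u z) p v
     - dir_deriv c (\<lambda>q. g q c u v) p z)"

definition nabla :: "('a, 'e::euclidean_space) metric \<Rightarrow> ('a, 'e) field \<Rightarrow> ('a, 'e) field
    \<Rightarrow> ('a, 'e) field" where
  "nabla g X Y = (\<lambda>p c. dir_deriv c (\<lambda>q. Y q c) p (X p c) + christoffel g p c (X p c) (Y p c))"

definition lie_bracket :: "('a, 'e::euclidean_space) field \<Rightarrow> ('a, 'e) field \<Rightarrow> ('a, 'e) field" where
  "lie_bracket X Y =
     (\<lambda>p c. dir_deriv c (\<lambda>q. Y q c) p (X p c) - dir_deriv c (\<lambda>q. X q c) p (Y p c))"

definition curvature :: "('a, 'e::euclidean_space) metric \<Rightarrow> ('a, 'e) field \<Rightarrow> ('a, 'e) field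
    \<Rightarrow> ('a, 'e) field \<Rightarrow> ('a, 'e) field" where
  "curvature g X Y Z = (\<lambda>p c. nabla g X (nabla g Y Z) p c - nabla g Y (nabla g X Z) p c
     - nabla g (lie_bracket X Y) Z p c)"

definition curvature_at :: "('a, 'e::euclidean_space) metric \<Rightarrow> 'a \<Rightarrow> ('a, 'e) chart
    \<Rightarrow> 'e \<Rightarrow> 'e \<Rightarrow> 'e \<Rightarrow> 'e" where
  "curvature_at g p c u v w = curvature g (const_field u) (const_field v) (const_field w) p c"

definition ricci :: "('a, 'e::euclidean_space) metric \<Rightarrow> 'a \<Rightarrow> ('a, 'e) chart \<Rightarrow> 'e \<Rightarrow> 'e" where
  "ricci g p c u = metric_trace (g p c) (\<lambda>v w. curvature_at g p c u v w)"


section \<open>Biharmonic maps\<close>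

definition smooth_map ::
    "('a::topological_space, 'e::euclidean_space) chart set
     \<Rightarrow> ('b::topological_space, 'f::euclidean_space) chart set \<Rightarrow> ('a \<Rightarrow> 'b) \<Rightarrow> bool" where
  "smooth_map A B \<phi> \<longleftrightarrow> continuous_on UNIV \<phi> \<and>
     (\<forall>c\<in>A. \<forall>d\<in>B. smooth_on (coord c ` (cdom c \<inter> \<phi> -` cdom d)) (coord d \<circ> \<phi> \<circ> cinv c))"

text \<open>The differential of \<open>\<phi>\<close> at \<open>p\<close> in the charts \<open>c\<close> and \<open>d\<close>.\<close>

definition dmap :: "('a \<Rightarrow> 'b) \<Rightarrow> 'a \<Rightarrow> ('a, 'e::euclidean_space) chart
    \<Rightarrow> ('b, 'f::euclidean_space) chart \<Rightarrow> 'e \<Rightarrow> 'f" where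
  "dmap \<phi> p c d = frechet_derivative (coord d \<circ> \<phi> \<circ> cinv c) (at (coord c p))"

type_synonym ('a, 'e, 'b, 'f) pb_section = "'a \<Rightarrow> ('a, 'e) chart \<Rightarrow> ('b, 'f) chart \<Rightarrow> 'f"

definition pb_nabla :: "('b, 'f::euclidean_space) metric \<Rightarrow> ('a \<Rightarrow> 'b)
    \<Rightarrow> ('a, 'e::euclidean_space) field \<Rightarrow> ('a, 'e, 'b, 'f) pb_section
    \<Rightarrow> ('a, 'e, 'b, 'f) pb_section" where
  "pb_nabla h \<phi> X V = (\<lambda>p c d. dir_deriv c (\<lambda>q. V q c d) p (X p c)
     + christoffel h (\<phi> p) d (dmap \<phi> p c d (X p c)) (V p c d))"

definition second_fundamental_form :: "('a, 'e::euclidean_space) metric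
    \<Rightarrow> ('b, 'f::euclidean_space) metric \<Rightarrow> ('a \<Rightarrow> 'b)
    \<Rightarrow> 'a \<Rightarrow> ('a, 'e) chart \<Rightarrow> ('b, 'f) chart \<Rightarrow> 'e \<Rightarrow> 'e \<Rightarrow> 'f" where
  "second_fundamental_form g h \<phi> p c d u v =
     pb_nabla h \<phi> (const_field u) (\<lambda>q c d. dmap \<phi> q c d v) p c d
     - dmap \<phi> p c d (nabla g (const_field u) (const_field v) p c)"

definition tension :: "('a, 'e::euclidean_space) metric \<Rightarrow> ('b, 'f::euclidean_space) metric
    \<Rightarrow> ('a \<Rightarrow> 'b) \<Rightarrow> ('a, 'e, 'b, 'f) pb_section" where
  "tension g h \<phi> = (\<lambda>p c d. metric_trace (g p c) (second_fundamental_form g h \<phi> p c d))"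

definition pb_laplacian :: "('a, 'e::euclidean_space) metric \<Rightarrow> ('b, 'f::euclidean_space) metric
    \<Rightarrow> ('a \<Rightarrow> 'b) \<Rightarrow> ('a, 'e, 'b, 'f) pb_section \<Rightarrow> ('a, 'e, 'b, 'f) pb_section" where
  "pb_laplacian g h \<phi> V = (\<lambda>p c d. - metric_trace (g p c) (\<lambda>u v.
       pb_nabla h \<phi> (const_field u) (pb_nabla h \<phi> (const_field v) V) p c d
     - pb_nabla h \<phi> (nabla g (const_field u) (const_field v)) V p c d))"

definition bitension :: "('a, 'e::euclidean_space) metric \<Rightarrow> ('b, 'f::euclidean_space) metric
    \<Rightarrow> ('a \<Rightarrow> 'b) \<Rightarrow> ('a, 'e, 'b, 'f) pb_section" where
  "bitension g h \<phi> = (\<lambda>p c d. - pb_laplacian g h \<phi> (tension g h \<phi>) p c d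
     - metric_trace (g p c) (\<lambda>u v.
         curvature_at h (\<phi> p) d (dmap \<phi> p c d u) (tension g h \<phi> p c d) (dmap \<phi> p c d v)))"

definition biharmonic :: "('a, 'e::euclidean_space) chart set \<Rightarrow> ('a, 'e) metric
    \<Rightarrow> ('b, 'f::euclidean_space) chart set \<Rightarrow> ('b, 'f) metric \<Rightarrow> ('a \<Rightarrow> 'b) \<Rightarrow> bool" where
  "biharmonic A g B h \<phi> \<longleftrightarrow> (\<forall>c\<in>A. \<forall>d\<in>B. \<forall>p \<in> cdom c \<inter> \<phi> -` cdom d. bitension g h \<phi> p c d = 0)"


section \<open>Riemannian submersions\<close>

definition vertical :: "('b, 'f::euclidean_space) chart set \<Rightarrow> ('a \<Rightarrow> 'b) \<Rightarrow> 'a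
    \<Rightarrow> ('a, 'e::euclidean_space) chart \<Rightarrow> 'e \<Rightarrow> bool" where
  "vertical B \<phi> p c u \<longleftrightarrow> (\<forall>d\<in>B. \<phi> p \<in> cdom d \<longrightarrow> dmap \<phi> p c d u = 0)"

definition horizontal :: "('a, 'e::euclidean_space) metric \<Rightarrow> ('b, 'f::euclidean_space) chart set
    \<Rightarrow> ('a \<Rightarrow> 'b) \<Rightarrow> 'a \<Rightarrow> ('a, 'e) chart \<Rightarrow> 'e \<Rightarrow> bool" where
  "horizontal g B \<phi> p c u \<longleftrightarrow> (\<forall>w. vertical B \<phi> p c w \<longrightarrow> g p c u w = 0)"

definition hor :: "('a, 'e::euclidean_space) metric \<Rightarrow> ('b, 'f::euclidean_space) chart set
    \<Rightarrow> ('a \<Rightarrow> 'b) \<Rightarrow> ('a, 'e) field \<Rightarrow> ('a, 'e) field" where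
  "hor g B \<phi> X = (\<lambda>p c. THE w. horizontal g B \<phi> p c w \<and> vertical B \<phi> p c (X p c - w))"

definition riemannian_submersion ::
    "('a::topological_space, 'e::euclidean_space) chart set \<Rightarrow> ('a, 'e) metric
     \<Rightarrow> ('b::topological_space, 'f::euclidean_space) chart set \<Rightarrow> ('b, 'f) metric
     \<Rightarrow> ('a \<Rightarrow> 'b) \<Rightarrow> bool" where
  "riemannian_submersion A g B h \<phi> \<longleftrightarrow> smooth_map A B \<phi> \<and>
     (\<forall>c\<in>A. \<forall>d\<in>B. \<forall>p \<in> cdom c \<inter> \<phi> -` cdom d. surj (dmap \<phi> p c d) \<and>
        (\<forall>u v. horizontal g B \<phi> p c u \<and> horizontal g B \<phi> p c v \<longrightarrow>
           h (\<phi> p) d (dmap \<phi> p c d u) (dmap \<phi> p c d v) = g p c u v))"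

definition basic :: "('a::topological_space, 'e::euclidean_space) chart set \<Rightarrow> ('a, 'e) metric
    \<Rightarrow> ('b::topological_space, 'f::euclidean_space) chart set \<Rightarrow> ('a \<Rightarrow> 'b)
    \<Rightarrow> ('a, 'e) field \<Rightarrow> bool" where
  "basic A g B \<phi> X \<longleftrightarrow> vector_field_on A UNIV X \<and>
     (\<forall>c\<in>A. \<forall>p\<in>cdom c. horizontal g B \<phi> p c (X p c)) \<and>
     (\<exists>Y. vector_field_on B UNIV Y \<and>
        (\<forall>c\<in>A. \<forall>d\<in>B. \<forall>p \<in> cdom c \<inter> \<phi> -` cdom d. dmap \<phi> p c d (X p c) = Y (\<phi> p) d))"

definition adapted_frame :: "('a::topological_space, 'e::euclidean_space) chart set
    \<Rightarrow> ('a, 'e) metric \<Rightarrow> ('b, 'f::euclidean_space) chart set \<Rightarrow> ('a \<Rightarrow> 'b)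
    \<Rightarrow> 'a set \<Rightarrow> (nat \<Rightarrow> ('a, 'e) field) \<Rightarrow> bool" where
  "adapted_frame A g B \<phi> W e \<longleftrightarrow> open W \<and>
     (\<forall>i\<in>{1..DIM('e)}. vector_field_on A W (e i)) \<and>
     (\<forall>c\<in>A. \<forall>p \<in> W \<inter> cdom c. orthonormal (g p c) (\<lambda>i. e i p c) \<and>
        (\<forall>i\<in>{1..DIM('f)}. horizontal g B \<phi> p c (e i p c)) \<and>
        (\<forall>s\<in>{DIM('f)+1..DIM('e)}. vertical B \<phi> p c (e s p c)))"

text \<open>The mean curvature vector field of the fibers; the value does not depend on the frame.\<close>

definition mean_curvature :: "('a::topological_space, 'e::euclidean_space) chart set
    \<Rightarrow> ('a, 'e) metric \<Rightarrow> ('b, 'f::euclidean_space) chart set \<Rightarrow> ('a \<Rightarrow> 'b)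
    \<Rightarrow> ('a, 'e) field" where
  "mean_curvature A g B \<phi> = (\<lambda>p c. THE w. \<forall>W e. adapted_frame A g B \<phi> W e \<and> p \<in> W \<longrightarrow>
     w = (1 / (real DIM('e) - real DIM('f))) *\<^sub>R
           (\<Sum>s=DIM('f)+1..DIM('e). hor g B \<phi> (nabla g (e s) (e s)) p c))"


section \<open>The connection \<open>nabla\<close> is metric and torsion-free\<close>

lemma inner_product_representation:
  fixes G :: "'e::euclidean_space \<Rightarrow> 'e \<Rightarrow> real"
  assumes "bilinear G" "\<And>u. u \<noteq> 0 \<Longrightarrow> G u u > 0" "linear L"
  shows "\<exists>!w. \<forall>z. G w z = L z"
proof -
  have lr: "linear (\<lambda>w. G w z)" "linear (G z)" for z
    using assms(1) by (auto simp: bilinear_def)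
  define T where "T = (\<lambda>w. \<Sum>b\<in>Basis. G w b *\<^sub>R b)"
  have Tb: "T w \<bullet> b = G w b" if "b \<in> Basis" for w b
    using that by (simp add: T_def inner_sum_left_Basis)
  have lT: "linear T"
    using assms(1) by (auto simp: linear_iff T_def bilinear_ladd bilinear_lmul
        scaleR_left_distrib sum.distrib scaleR_sum_right)
  have eq: "L1 = L2" if "linear L1" "linear L2" "\<And>b. b \<in> Basis \<Longrightarrow> L1 b = L2 b"
    for L1 L2 :: "'e \<Rightarrow> real"
    using linear_eq_stdbasis that by blast
  have "inj T"
  proof (subst linear_injective_0[OF lT], intro allI impI)
    fix w assume "T w = 0"
    then have "G w b = 0" if "b \<in> Basis" for b
      using Tb[OF that, of w] by simp
    then have "G w = (\<lambda>z. 0)"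
      by (intro eq lr(2)) (auto simp: linear_iff)
    then have "G w w = 0" by metis
    then show "w = 0" using assms(2) by force
  qed
  then have "surj T" using lT linear_injective_imp_surjective by blast
  then obtain w where w: "T w = (\<Sum>b\<in>Basis. L b *\<^sub>R b)" by (metis surjD)
  have "G w b = L b" if "b \<in> Basis" for b
    using Tb[OF that, of w] that by (simp add: w inner_sum_left_Basis)
  then have "G w = L" by (intro eq lr(2) assms(3))
  moreover have "w' = w" if "\<forall>z. G w' z = L z" for w'
  proof -
    have "G w' = G w" using that \<open>G w = L\<close> by auto
    then have "T w' = T w" by (simp add: T_def)
    then show ?thesis using \<open>inj T\<close> by (simp add: inj_eq)
  qed
  ultimately show ?thesis by metis
qed

lemma coord_nhds:
  assumes "smooth_atlas A" "c \<in> A" "p \<in> cdom c"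
  shows "open (coord c ` cdom c)" "coord c p \<in> coord c ` cdom c" "cinv c (coord c p) = p"
    "y \<in> coord c ` cdom c \<Longrightarrow> cinv c y \<in> cdom c"
  using assms unfolding smooth_atlas_def is_chart_def homeomorphism_def by auto

lemma metric_differentiable:
  assumes "riemannian_manifold A g" "c \<in> A" "p \<in> cdom c"
  shows "(\<lambda>y. g (cinv c y) c u v) differentiable (at (coord c p))"
proof -
  have "Ck_on (Suc 0) (coord c ` cdom c) (\<lambda>y. g (cinv c y) c u v)"
    using assms unfolding riemannian_manifold_def riemannian_metric_def smooth_on_def by blast
  then show ?thesis using assms(3) by auto
qed

lemma metricD:
  assumes "riemannian_manifold A g" "c \<in> A" "p \<in> cdom c"
  shows "bilinear (g p c)" "g p c u v = g p c v u" "u \<noteq> 0 \<Longrightarrow> g p c u u > 0"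
  using assms unfolding riemannian_manifold_def riemannian_metric_def by blast+

lemma dir_deriv_metric_linear:
  assumes "riemannian_manifold A g" "c \<in> A" "p \<in> cdom c"
  shows "linear (\<lambda>z. dir_deriv c (\<lambda>q. g q c v z) p u)"
proof -
  note A = assms(1)[unfolded riemannian_manifold_def, THEN conjunct1]
  note nh = coord_nhds[OF A assms(2,3)]
  have tr: "frechet_derivative f (at (coord c p)) = frechet_derivative f' (at (coord c p))"
    if "f' differentiable at (coord c p)" "\<And>y. y \<in> coord c ` cdom c \<Longrightarrow> f y = f' y"
    for f f' :: "_ \<Rightarrow> real"
  proof -
    have "(f' has_derivative frechet_derivative f' (at (coord c p))) (at (coord c p))"
      using that(1) frechet_derivative_works by blast
    then have "(f has_derivative frechet_derivative f' (at (coord c p))) (at (coord c p))"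
      by (rule has_derivative_transform_within_open[OF _ nh(1,2)]) (use that in auto)
    then show ?thesis by (metis frechet_derivative_at)
  qed
  show ?thesis
  proof (rule linearI)
    fix x y
    have "frechet_derivative (\<lambda>q. g (cinv c q) c v (x + y)) (at (coord c p)) =
       frechet_derivative (\<lambda>q. g (cinv c q) c v x + g (cinv c q) c v y) (at (coord c p))"
      by (rule tr) (auto intro!: derivative_intros metric_differentiable[OF assms]
          bilinear_radd metricD(1)[OF assms(1,2)] nh(4))
    also have "\<dots> = (\<lambda>u. frechet_derivative (\<lambda>q. g (cinv c q) c v x) (at (coord c p)) u
          + frechet_derivative (\<lambda>q. g (cinv c q) c v y) (at (coord c p)) u)"
      by (rule frechet_derivative_at[symmetric], intro has_derivative_add)
        (use metric_differentiable[OF assms] frechet_derivative_works in blast)+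
    finally show "dir_deriv c (\<lambda>q. g q c v (x + y)) p u =
        dir_deriv c (\<lambda>q. g q c v x) p u + dir_deriv c (\<lambda>q. g q c v y) p u"
      by (simp add: dir_deriv_def)
  next
    fix r x
    have "frechet_derivative (\<lambda>q. g (cinv c q) c v (r *\<^sub>R x)) (at (coord c p)) =
       frechet_derivative (\<lambda>q. r *\<^sub>R g (cinv c q) c v x) (at (coord c p))"
      by (rule tr) (auto intro!: derivative_intros metric_differentiable[OF assms]
          bilinear_rmul[where 'c=real, simplified] metricD(1)[OF assms(1,2)] nh(4))
    also have "\<dots> = (\<lambda>u. r *\<^sub>R frechet_derivative (\<lambda>q. g (cinv c q) c v x) (at (coord c p)) u)"
      using has_derivative_scaleR_right[OF frechet_derivative_works[THEN iffD1,
          OF metric_differentiable[OF assms, of v x]], of r] frechet_derivative_at by metis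
    finally show "dir_deriv c (\<lambda>q. g q c v (r *\<^sub>R x)) p u = r *\<^sub>R dir_deriv c (\<lambda>q. g q c v x) p u"
      by (simp add: dir_deriv_def)
  qed
qed

lemma koszul:
  assumes "riemannian_manifold A g" "c \<in> A" "p \<in> cdom c"
  shows "2 * g p c (christoffel g p c u v) z =
       dir_deriv c (\<lambda>q. g q c v z) p u
     + dir_deriv c (\<lambda>q. g q c u z) p v
     - dir_deriv c (\<lambda>q. g q c u v) p z"
proof -
  let ?R = "\<lambda>z. dir_deriv c (\<lambda>q. g q c v z) p u
     + dir_deriv c (\<lambda>q. g q c u z) p v
     - dir_deriv c (\<lambda>q. g q c u v) p z"
  have "linear (\<lambda>z. dir_deriv c (\<lambda>q. g q c u v) p z)"
    unfolding dir_deriv_def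
    by (rule linear_frechet_derivative[OF metric_differentiable[OF assms]])
  then have "linear (\<lambda>z. (1/2) *\<^sub>R ?R z)"
    by (intro linear_compose_scale_right linear_compose_sub linear_compose_add
        dir_deriv_metric_linear[OF assms])
  from inner_product_representation[OF metricD(1)[OF assms] metricD(3)[OF assms] this]
  have "\<exists>!w. \<forall>z. 2 * g p c w z = ?R z" by (simp add: mult.commute)
  from theI'[OF this] show ?thesis unfolding christoffel_def by blast
qed

lemma christoffel_sym:
  assumes "riemannian_manifold A g" "c \<in> A" "p \<in> cdom c"
  shows "christoffel g p c u v = christoffel g p c v u"
proof -
  note A = assms(1)[unfolded riemannian_manifold_def, THEN conjunct1]
  note nh = coord_nhds[OF A assms(2,3)]
  have s: "dir_deriv c (\<lambda>q. g q c u v) p z = dir_deriv c (\<lambda>q. g q c v u) p z" for z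
  proof -
    have "((\<lambda>y. g (cinv c y) c u v) has_derivative
        frechet_derivative (\<lambda>y. g (cinv c y) c u v) (at (coord c p))) (at (coord c p))"
      using metric_differentiable[OF assms] frechet_derivative_works by blast
    then have "((\<lambda>y. g (cinv c y) c v u) has_derivative
        frechet_derivative (\<lambda>y. g (cinv c y) c u v) (at (coord c p))) (at (coord c p))"
      by (rule has_derivative_transform_within_open[OF _ nh(1,2)])
        (use metricD(2)[OF assms(1,2)] nh(4) in auto)
    then show ?thesis unfolding dir_deriv_def by (metis frechet_derivative_at)
  qed
  show ?thesis unfolding christoffel_def by (rule arg_cong[where f=The]) (auto simp: s)
qed

lemma nabla_torsion_free:
  assumes "riemannian_manifold A g" "c \<in> A" "p \<in> cdom c"
  shows "nabla g X Y p c - nabla g Y X p c = lie_bracket X Y p c"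
  using christoffel_sym[OF assms] by (simp add: nabla_def lie_bracket_def)

lemma nabla_metric:
  assumes "riemannian_manifold A g" "c \<in> A" "p \<in> cdom c"
    and Y: "(\<lambda>y. Y (cinv c y) c) differentiable (at (coord c p))"
    and Z: "(\<lambda>y. Z (cinv c y) c) differentiable (at (coord c p))"
  shows "dir_deriv c (\<lambda>q. g q c (Y q c) (Z q c)) p (X p c) =
    g p c (nabla g X Y p c) (Z p c) + g p c (Y p c) (nabla g X Z p c)"
proof -
  note A = assms(1)[unfolded riemannian_manifold_def, THEN conjunct1]
  note nh = coord_nhds[OF A assms(2,3)]
  note bl = metricD(1)[OF assms(1,2)]
  have ex: "g q c u v = (\<Sum>a\<in>Basis. \<Sum>b\<in>Basis. (u \<bullet> a) * (v \<bullet> b) * g q c a b)" if "q \<in> cdom c" for q u v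
  proof -
    have "g q c u v = g q c (\<Sum>a\<in>Basis. (u \<bullet> a) *\<^sub>R a) (\<Sum>b\<in>Basis. (v \<bullet> b) *\<^sub>R b)"
      by (simp add: euclidean_representation)
    also have "\<dots> = (\<Sum>a\<in>Basis. \<Sum>b\<in>Basis. (u \<bullet> a) * (v \<bullet> b) * g q c a b)"
      using bl[OF that]
      by (simp add: bilinear_sum sum.cartesian_product bilinear_lmul bilinear_rmul algebra_simps)
    finally show ?thesis .
  qed
  let ?y = "coord c p"
  let ?Y = "\<lambda>y. Y (cinv c y) c" and ?Z = "\<lambda>y. Z (cinv c y) c"
  let ?Y' = "frechet_derivative ?Y (at ?y)" and ?Z' = "frechet_derivative ?Z (at ?y)"
  let ?g = "\<lambda>a b y. g (cinv c y) c a b" 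
  let ?g' = "\<lambda>a b. frechet_derivative (?g a b) (at ?y)" 
  have dY: "(?Y has_derivative ?Y') (at ?y)" and dZ: "(?Z has_derivative ?Z') (at ?y)"
    using Y Z frechet_derivative_works by blast+
  have dg: "(?g a b has_derivative ?g' a b) (at ?y)" for a b
    using metric_differentiable[OF assms(1-3)] frechet_derivative_works by blast
  have D: "((\<lambda>y. \<Sum>a\<in>Basis. \<Sum>b\<in>Basis. (U y \<bullet> a) * (V y \<bullet> b) * ?g a b y) has_derivative
     (\<lambda>x. \<Sum>a\<in>Basis. \<Sum>b\<in>Basis. (U ?y \<bullet> a) * (V ?y \<bullet> b) * ?g' a b x
       + ((U ?y \<bullet> a) * (V' x \<bullet> b) + (U' x \<bullet> a) * (V ?y \<bullet> b)) * ?g a b ?y)) (at ?y)"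
    if "(U has_derivative U') (at ?y)" "(V has_derivative V') (at ?y)" for U U' V V'
    using that by (auto intro!: derivative_eq_intros dg)
  have D': "((\<lambda>y. g (cinv c y) c (U y) (V y)) has_derivative
     (\<lambda>x. \<Sum>a\<in>Basis. \<Sum>b\<in>Basis. (U ?y \<bullet> a) * (V ?y \<bullet> b) * ?g' a b x
       + ((U ?y \<bullet> a) * (V' x \<bullet> b) + (U' x \<bullet> a) * (V ?y \<bullet> b)) * ?g a b ?y)) (at ?y)"
    if "(U has_derivative U') (at ?y)" "(V has_derivative V') (at ?y)" for U U' V V'
    by (rule has_derivative_transform_within_open[OF D[OF that] nh(1,2)])
       (use ex nh(4) in auto)
  let ?u = "X p c"
  have c0: "dir_deriv c (\<lambda>q. g q c u v) p x = (\<Sum>a\<in>Basis. \<Sum>b\<in>Basis. (u \<bullet> a) * (v \<bullet> b) * ?g' a b x)" for u v x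
    unfolding dir_deriv_def
    using fun_cong[OF frechet_derivative_at[OF D'[of "\<lambda>_. u" "\<lambda>_. 0" "\<lambda>_. v" "\<lambda>_. 0"]], symmetric] by simp
  have "dir_deriv c (\<lambda>q. g q c (Y q c) (Z q c)) p ?u = 
     (\<Sum>a\<in>Basis. \<Sum>b\<in>Basis. (?Y ?y \<bullet> a) * (?Z ?y \<bullet> b) * ?g' a b ?u
       + ((?Y ?y \<bullet> a) * (?Z' ?u \<bullet> b) + (?Y' ?u \<bullet> a) * (?Z ?y \<bullet> b)) * ?g a b ?y)"
    unfolding dir_deriv_def
    using fun_cong[OF frechet_derivative_at[OF D'[OF dY dZ]], symmetric] by simp
  also have "\<dots> = dir_deriv c (\<lambda>q. g q c (Y p c) (Z p c)) p ?u + g p c (Y p c) (?Z' ?u) + g p c (?Y' ?u) (Z p c)"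
    unfolding c0 ex[OF assms(3), of "Y p c" "?Z' ?u"] ex[OF assms(3), of "?Y' ?u" "Z p c"]
    by (simp add: nh(3) sum.distrib algebra_simps)
  finally have 1: "dir_deriv c (\<lambda>q. g q c (Y q c) (Z q c)) p ?u = \<dots>" .
  have "2 * g p c (christoffel g p c ?u (Y p c)) (Z p c) + 2 * g p c (christoffel g p c ?u (Z p c)) (Y p c)
     = 2 * dir_deriv c (\<lambda>q. g q c (Y p c) (Z p c)) p ?u"
  proof -
    have s: "dir_deriv c (\<lambda>q. g q c u v) p x = dir_deriv c (\<lambda>q. g q c v u) p x" for u v x
    proof -
      have "g (cinv c y) c a b = g (cinv c y) c b a" if "y \<in> coord c ` cdom c" for y a b
        using metricD(2)[OF assms(1,2)] nh(4)[OF that] by blast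
      then have "((\<lambda>y. g (cinv c y) c v u) has_derivative ?g' u v) (at ?y)"
        by (intro has_derivative_transform_within_open[OF dg[of u v] nh(1,2)]) auto
      then show ?thesis unfolding dir_deriv_def by (metis frechet_derivative_at)
    qed
    show ?thesis unfolding koszul[OF assms(1-3)]
      using s[of "Y p c" "Z p c" ?u] by simp
  qed
  then have 2: "g p c (christoffel g p c ?u (Y p c)) (Z p c) + g p c (Y p c) (christoffel g p c ?u (Z p c))
     = dir_deriv c (\<lambda>q. g q c (Y p c) (Z p c)) p ?u"
    using metricD(2)[OF assms(1-3)] by (smt (verit))
  have "nabla g X Y p c = ?Y' ?u + christoffel g p c ?u (Y p c)"
    and "nabla g X Z p c = ?Z' ?u + christoffel g p c ?u (Z p c)"
    by (simp_all add: nabla_def dir_deriv_def)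
  with 1 2 show ?thesis
    using bl[OF assms(3)] by (simp add: bilinear_ladd bilinear_radd)
qed

end

theory Submission
  imports Defs
begin

text \<open>
  Along a Riemannian submersion the second fundamental form vanishes on pairs of horizontal vectors,
  so only the vertical part of the trace contributes to the tension field:
  \<open>\<tau>(\<phi>) = -(m - n) d\<phi>(\<mu>)\<close>. Since \<open>\<mu>\<close> is basic, \<open>d\<phi>(\<mu>)\<close> is a vector field of \<open>N\<close> along \<open>\<phi>\<close>, hence
  parallel in vertical directions, and in a horizontal direction \<open>X\<close> its derivative is
  \<open>d\<phi>(\<nabla>\<^sub>X \<mu>)\<close>. Evaluating the rough Laplacian of \<open>d\<phi>(\<mu>)\<close> in an adapted frame then produces the
  bracketed sum, where the vertical frame vectors only contribute through \<open>\<nabla>\<^sub>\<mu> \<mu>\<close>, and the curvature term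
  is the Ricci operator because \<open>d\<phi>\<close> maps the horizontal frame to an orthonormal frame of \<open>N\<close>. Hence
  the bitension field is \<open>-(m - n)\<close> times the left-hand side of the equation.
\<close>

section \<open>Calculus of smooth maps\<close>

text \<open>Components are arbitrary off their chart domain, so computations are confined to an open
  set \<open>U\<close> inside one chart of M that \<phi> maps into one chart of N, and functions are
  compared only on \<open>U\<close>. \<open>metric_trace\<close>, \<open>christoffel\<close>,
  \<open>hor\<close> and \<open>mean_curvature\<close> are definite descriptions, which say
  something only once existence and uniqueness of the value are known. For
  \<open>metric_trace\<close> this takes bilinearity of the traced map and an orthonormal basis;
  smooth adapted frames come from Gram-Schmidt. That the mean curvature does not depend on the frame
  is read off from the tension field, a trace that refers to no frame. The definitions extend
  vectors by constant coordinate fields, whereas the frame and \<mu> vary; tensoriality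
  (\<open>pbD_d\<phi>\<close>, \<open>hess_fields\<close>) links the two. The vanishing on
  horizontal pairs is the argument behind uniqueness of the metric torsion-free connection. The
  horizontal projection inside the first sum keeps the second differentiation on horizontal pairs,
  where that vanishing is available.\<close>

lemma Ck_on_cong:
  assumes "open S" "\<And>y. y \<in> S \<Longrightarrow> f y = f' y" "Ck_on k S f"
  shows "Ck_on k S f'"
  using assms
proof (induction k arbitrary: f f')
  case 0
  then show ?case by (auto cong: continuous_on_cong)
next
  case (Suc k)
  have hd: "(f' has_derivative frechet_derivative f (at y)) (at y)" if "y \<in> S" for y
  proof -
    have "(f has_derivative frechet_derivative f (at y)) (at y)"
      using Suc.prems(3) that frechet_derivative_works by auto
    then show ?thesis
      by (rule has_derivative_transform_within_open[OF _ Suc.prems(1) that]) (rule Suc.prems(2))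
  qed
  have "frechet_derivative f (at y) = frechet_derivative f' (at y)" if "y \<in> S" for y
    using frechet_derivative_at[OF hd[OF that]] .
  then have "Ck_on k S (\<lambda>y. frechet_derivative f' (at y) v)" for v
    using Suc.IH[OF Suc.prems(1), of "\<lambda>y. frechet_derivative f (at y) v"] Suc.prems(3) by simp
  with hd show ?case by (auto simp: differentiable_def)
qed

lemma Ck_on_subset: "Ck_on k S f \<Longrightarrow> T \<subseteq> S \<Longrightarrow> Ck_on k T f"
  by (induction k arbitrary: f) (auto intro: continuous_on_subset)

lemma Ck_on_Suc_D: "Ck_on (Suc k) S f \<Longrightarrow> Ck_on k S f"
  by (induction k arbitrary: f)
    (auto intro!: continuous_at_imp_continuous_on differentiable_imp_continuous_within)

text \<open>Derivatives in \<open>Ck_on\<close> are taken in the whole space, so the property is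
  local around each point. Used where a field has a good formula only in a local frame.\<close>

lemma Ck_on_local:
  assumes "\<And>y. y \<in> S \<Longrightarrow> \<exists>T. open T \<and> y \<in> T \<and> Ck_on k T f"
  shows "Ck_on k S f"
  using assms
proof (induction k arbitrary: f)
  case 0
  have "isCont f y" if "y \<in> S" for y
    using 0[OF that] continuous_on_eq_continuous_at by auto
  then show ?case by (auto intro: continuous_at_imp_continuous_on)
next
  case (Suc k)
  have "Ck_on k S (\<lambda>y. frechet_derivative f (at y) v)" for v
    by (rule Suc.IH) (use Suc.prems in force)
  moreover have "f differentiable at y" if "y \<in> S" for y
    using Suc.prems[OF that] by auto
  ultimately show ?case by simp
qed

text \<open>Lets an explicit derivative stand in for the chosen \<open>frechet_derivative\<close>;
  on an open set the two agree by uniqueness.\<close>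

lemma Ck_onI:
  assumes "open S" "\<And>y. y \<in> S \<Longrightarrow> (f has_derivative f' y) (at y)" "\<And>v. Ck_on k S (\<lambda>y. f' y v)"
  shows "Ck_on (Suc k) S f"
proof -
  have "f' y v = frechet_derivative f (at y) v" if "y \<in> S" for y v
    using frechet_derivative_at[OF assms(2)[OF that]] by simp
  then have "Ck_on k S (\<lambda>y. frechet_derivative f (at y) v)" for v
    by (rule Ck_on_cong[OF assms(1) _ assms(3)])
  with assms(2) show ?thesis by (auto simp: differentiable_def)
qed

lemma Ck_onD: "Ck_on (Suc k) S f \<Longrightarrow> y \<in> S \<Longrightarrow> (f has_derivative frechet_derivative f (at y)) (at y)"
  by (simp add: frechet_derivative_works)

lemma Ck_on_const [simp]: "Ck_on k S (\<lambda>y. a)"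
  by (induction k arbitrary: a) auto

lemma Ck_on_bounded_linear:
  assumes "open S" "bounded_linear L" "Ck_on k S f"
  shows "Ck_on k S (\<lambda>y. L (f y))"
  using assms
proof (induction k arbitrary: f)
  case 0
  then show ?case by (auto intro: bounded_linear.continuous_on)
next
  case (Suc k)
  show ?case
    by (rule Ck_onI[OF Suc.prems(1) bounded_linear.has_derivative[OF Suc.prems(2) Ck_onD[OF Suc.prems(3)]]])
      (use Suc in auto)
qed

lemma Ck_on_add:
  assumes "open S" "Ck_on k S f" "Ck_on k S f'"
  shows "Ck_on k S (\<lambda>y. f y + f' y)"
  using assms
proof (induction k arbitrary: f f')
  case 0
  then show ?case by (auto intro: continuous_intros)
next
  case (Suc k)
  show ?case
    by (rule Ck_onI[OF Suc.prems(1) has_derivative_add[OF Ck_onD[OF Suc.prems(2)] Ck_onD[OF Suc.prems(3)]]])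
      (use Suc in auto)
qed

lemma Ck_on_sum:
  assumes "open S" "\<And>i. i \<in> I \<Longrightarrow> Ck_on k S (f i)"
  shows "Ck_on k S (\<lambda>y. \<Sum>i\<in>I. f i y)"
  using assms(2)
  by (induction I rule: infinite_finite_induct) (auto intro: Ck_on_add[OF assms(1)])

lemma Ck_on_bilinear:
  assumes "open S" "bounded_bilinear P" "Ck_on k S f" "Ck_on k S f'"
  shows "Ck_on k S (\<lambda>y. P (f y) (f' y))"
  using assms
proof (induction k arbitrary: f f')
  case 0
  then show ?case by (auto intro: bounded_bilinear.continuous_on)
next
  case (Suc k)
  have k: "Ck_on k S f" "Ck_on k S f'"
    using Suc.prems(3,4) Ck_on_Suc_D by blast+
  have k': "Ck_on k S (\<lambda>y. frechet_derivative f (at y) v)"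
    "Ck_on k S (\<lambda>y. frechet_derivative f' (at y) v)" for v
    using Suc.prems(3,4) by simp_all
  show ?case
    by (rule Ck_onI[OF Suc.prems(1) bounded_bilinear.FDERIV[OF Suc.prems(2) Ck_onD[OF Suc.prems(3)] Ck_onD[OF Suc.prems(4)]]])
      (assumption, assumption, intro Ck_on_add Suc.IH Suc.prems(1,2) k k')
qed

lemma frechet_derivative_Basis_expansion:
  fixes f :: "'e::euclidean_space \<Rightarrow> 'f::real_normed_vector"
  assumes "f differentiable (at y)"
  shows "frechet_derivative f (at y) v = (\<Sum>b\<in>Basis. (v \<bullet> b) *\<^sub>R frechet_derivative f (at y) b)"
proof -
  have l: "linear (frechet_derivative f (at y))"
    by (rule linear_frechet_derivative[OF assms])
  have "frechet_derivative f (at y) v = frechet_derivative f (at y) (\<Sum>b\<in>Basis. (v \<bullet> b) *\<^sub>R b)"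
    by (simp add: euclidean_representation)
  also have "\<dots> = (\<Sum>b\<in>Basis. (v \<bullet> b) *\<^sub>R frechet_derivative f (at y) b)"
    by (simp add: linear_sum[OF l] linear_scale[OF l])
  finally show ?thesis .
qed

text \<open>\<open>Ck_on\<close> controls derivatives in fixed directions only; a varying direction
  is expanded in \<open>Basis\<close> with coefficients \<open>v y \<bullet> b\<close>.\<close>

lemma Ck_on_frechet_derivative:
  assumes "open S" "Ck_on (Suc k) S f" "Ck_on k S v"
  shows "Ck_on k S (\<lambda>y. frechet_derivative f (at y) (v y))"
proof (rule Ck_on_cong[OF assms(1)])
  show "Ck_on k S (\<lambda>y. \<Sum>b\<in>Basis. (v y \<bullet> b) *\<^sub>R frechet_derivative f (at y) b)"
    by (intro Ck_on_sum Ck_on_bilinear[OF _ bounded_bilinear_scaleR]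
        Ck_on_bounded_linear[OF _ bounded_linear_inner_left]) (use assms in auto)
  show "(\<Sum>b\<in>Basis. (v y \<bullet> b) *\<^sub>R frechet_derivative f (at y) b) = frechet_derivative f (at y) (v y)"
    if "y \<in> S" for y
    using frechet_derivative_Basis_expansion[of f y "v y"] assms(2) that by simp
qed

lemma Ck_on_compose:
  assumes "open S" "open T" "f ` S \<subseteq> T" "Ck_on k S f" "Ck_on k T f'"
  shows "Ck_on k S (\<lambda>y. f' (f y))"
  using assms(4,5)
proof (induction k arbitrary: f')
  case 0
  then show ?case using assms(3) by (auto intro: continuous_on_compose2)
next
  case (Suc k)
  have ft: "f y \<in> T" if "y \<in> S" for y using assms(3) that by auto
  have hd: "((\<lambda>y. f' (f y)) has_derivative
      (\<lambda>v. frechet_derivative f' (at (f y)) (frechet_derivative f (at y) v))) (at y)" if "y \<in> S" for y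
    using diff_chain_at[OF Ck_onD[OF Suc.prems(1) that] Ck_onD[OF Suc.prems(2) ft[OF that]]]
    by (simp add: o_def)
  show ?case
  proof (rule Ck_onI[OF assms(1) hd])
    fix v
    \<comment> \<open>The direction in the chain rule moves with \<open>y\<close>. Expanded in
      \<open>Basis\<close>, it leaves the derivative of \<open>f'\<close> in each fixed direction
      \<open>b\<close>, to which the induction hypothesis applies.\<close>
    let ?g = "\<lambda>y. \<Sum>b\<in>Basis. (frechet_derivative f (at y) v \<bullet> b) *\<^sub>R frechet_derivative f' (at (f y)) b"
    have "Ck_on k S ?g"
      using Suc.prems Ck_on_Suc_D[OF Suc.prems(1)]
      by (intro Ck_on_sum Ck_on_bilinear[OF _ bounded_bilinear_scaleR]
          Ck_on_bounded_linear[OF _ bounded_linear_inner_left] Suc.IH assms(1)) auto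
    then show "Ck_on k S (\<lambda>y. frechet_derivative f' (at (f y)) (frechet_derivative f (at y) v))"
      by (rule Ck_on_cong[OF assms(1), rotated])
        (use ft Suc.prems(2) frechet_derivative_Basis_expansion[of f'] in auto)
  qed auto
qed

text \<open>The induction generalizes the exponent because differentiation lowers it to
  \<open>a - 1\<close>. The case \<open>a = -1/2\<close> normalizes vectors in Gram-Schmidt.\<close>

lemma Ck_on_powr:
  fixes f :: "'e::euclidean_space \<Rightarrow> real"
  assumes "open S" "\<And>y. y \<in> S \<Longrightarrow> f y > 0" "Ck_on k S f"
  shows "Ck_on k S (\<lambda>y. f y powr a)"
  using assms(3)
proof (induction k arbitrary: a)
  case 0
  then have "continuous_on S f" by simp
  moreover have "\<forall>y\<in>S. f y \<noteq> 0" using assms(2) less_irrefl by metis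
  ultimately show ?case by (simp add: continuous_on_powr continuous_on_const)
next
  case (Suc k)
  have hd: "((\<lambda>y. f y powr a) has_derivative
      (\<lambda>v. frechet_derivative f (at y) v * (a * f y powr (a - 1)))) (at y)" if "y \<in> S" for y
  proof -
    have "((\<lambda>x. x powr a) has_derivative (\<lambda>h. h * (a * f y powr (a - 1)))) (at (f y))"
      using has_real_derivative_powr[OF assms(2)[OF that], of a]
      by (simp add: has_field_derivative_def mult.commute mult_commute_abs)
    from diff_chain_at[OF Ck_onD[OF Suc.prems that] this] show ?thesis by (simp add: o_def)
  qed
  have "Ck_on k S (\<lambda>y. frechet_derivative f (at y) v)" for v
    using Suc.prems by simp
  then show ?case
    by (intro Ck_onI[OF assms(1) hd] Ck_on_bilinear[OF _ bounded_bilinear_mult] assms(1)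
        Ck_on_const Suc.IH Ck_on_Suc_D[OF Suc.prems])
qed

text \<open>The mean value theorem along \<open>u\<close> and then along \<open>v\<close> turns the
  second difference over a parallelogram into the mixed derivative at an intermediate point. The
  difference itself is unchanged when \<open>u\<close> and \<open>v\<close> are exchanged, which the
  symmetry proof exploits.\<close>

lemma second_difference_mvt:
  fixes f :: "'e::euclidean_space \<Rightarrow> real"
  assumes t: "t > 0"
    and f: "\<And>a b. 0 \<le> a \<Longrightarrow> a \<le> t \<Longrightarrow> 0 \<le> b \<Longrightarrow> b \<le> t \<Longrightarrow> y + a *\<^sub>R u + b *\<^sub>R v \<in> S"
    and C: "Ck_on 2 S f"
  shows "\<exists>a b. 0 \<le> a \<and> a \<le> t \<and> 0 \<le> b \<and> b \<le> t \<and>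
     f (y + t *\<^sub>R u + t *\<^sub>R v) - f (y + t *\<^sub>R u) - f (y + t *\<^sub>R v) + f y
      = t * t * frechet_derivative (\<lambda>y. frechet_derivative f (at y) u) (at (y + a *\<^sub>R u + b *\<^sub>R v)) v"
proof -
  have C': "Ck_on (Suc (Suc 0)) S f" using C by (simp only: numeral_2_eq_2)
  have C1: "Ck_on (Suc 0) S f" by (rule Ck_on_Suc_D[OF C'])
  have C2: "Ck_on (Suc 0) S (\<lambda>y. frechet_derivative f (at y) u)"
    using C' unfolding Ck_on.simps(2)[of "Suc 0"] by blast
  let ?D = "\<lambda>y. frechet_derivative f (at y) u"
  let ?p = "\<lambda>a b. y + a *\<^sub>R u + b *\<^sub>R v"
  have du: "((\<lambda>a. f (?p a b)) has_real_derivative ?D (?p a b)) (at a)" if "?p a b \<in> S" for a b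
  proof -
    have "((\<lambda>a. ?p a b) has_derivative (\<lambda>h. h *\<^sub>R u)) (at a)"
      by (auto intro!: derivative_eq_intros)
    from diff_chain_at[OF this Ck_onD[OF C1 that]] 
    have "((\<lambda>a. f (?p a b)) has_derivative (\<lambda>h. frechet_derivative f (at (?p a b)) (h *\<^sub>R u))) (at a)"
      by (simp add: o_def)
    moreover have "linear (frechet_derivative f (at (?p a b)))"
      using C1 that by (auto intro: linear_frechet_derivative)
    ultimately show ?thesis
      by (simp add: has_field_derivative_def linear_scale mult_commute_abs)
  qed
  have dv: "((\<lambda>b. ?D (?p a b)) has_real_derivative frechet_derivative ?D (at (?p a b)) v) (at b)"
    if "?p a b \<in> S" for a b
  proof -
    have "((\<lambda>b. ?p a b) has_derivative (\<lambda>h. h *\<^sub>R v)) (at b)"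
      by (auto intro!: derivative_eq_intros)
    from diff_chain_at[OF this Ck_onD[OF C2 that]] 
    have "((\<lambda>b. ?D (?p a b)) has_derivative (\<lambda>h. frechet_derivative ?D (at (?p a b)) (h *\<^sub>R v))) (at b)"
      by (simp add: o_def)
    moreover have "linear (frechet_derivative ?D (at (?p a b)))"
      using C2 that by (auto intro: linear_frechet_derivative)
    ultimately show ?thesis
      by (simp add: has_field_derivative_def linear_scale mult_commute_abs)
  qed
  have "\<exists>z>0. z < t \<and> (f (?p t t) - f (?p t 0)) - (f (?p 0 t) - f (?p 0 0))
      = (t - 0) * (?D (?p z t) - ?D (?p z 0))"
    by (rule MVT2[OF t, of "\<lambda>a. f (?p a t) - f (?p a 0)"])
      (use t in \<open>auto intro!: DERIV_diff du f simp del: scaleR_zero_left add_0_right\<close>)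
  then obtain a where a: "0 < a" "a < t"
    "(f (?p t t) - f (?p t 0)) - (f (?p 0 t) - f (?p 0 0)) = t * (?D (?p a t) - ?D (?p a 0))"
    by auto
  have "\<exists>z>0. z < t \<and> ?D (?p a t) - ?D (?p a 0) = (t - 0) * frechet_derivative ?D (at (?p a z)) v"
    by (rule MVT2[OF t, of "\<lambda>b. ?D (?p a b)"]) (use t a in \<open>auto intro!: dv f\<close>)
  then obtain b where "0 < b" "b < t"
    "?D (?p a t) - ?D (?p a 0) = t * frechet_derivative ?D (at (?p a b)) v"
    by auto
  with a show ?thesis
    by (intro exI[of _ a] exI[of _ b]) auto
qed

text \<open>Both mixed derivatives equal the same second difference divided by \<open>t * t\<close>,
  each at some point arbitrarily close to \<open>y\<close>; continuity of both then forces equality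
  at \<open>y\<close>.\<close>

lemma second_derivative_symmetric_real:
  fixes f :: "'e::euclidean_space \<Rightarrow> real"
  assumes S: "open S" "y \<in> S" and C: "Ck_on 2 S f"
  shows "frechet_derivative (\<lambda>y. frechet_derivative f (at y) u) (at y) v
       = frechet_derivative (\<lambda>y. frechet_derivative f (at y) v) (at y) u"
proof -
  let ?D = "\<lambda>u v y. frechet_derivative (\<lambda>y. frechet_derivative f (at y) u) (at y) v"
  have cont: "isCont (?D u v) y" for u v
  proof -
    have "continuous_on S (?D u v)"
      using C by (simp add: numeral_2_eq_2)
    then show ?thesis using S continuous_on_eq_continuous_at by blast
  qed
  have "\<bar>?D u v y - ?D v u y\<bar> < 2 * e" if e: "e > 0" for e
  proof -
    obtain d1 where d1: "d1 > 0" "\<And>z. dist z y < d1 \<Longrightarrow> dist (?D u v z) (?D u v y) < e"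
      using cont[of u v] e unfolding continuous_at_eps_delta by (metis dist_commute)
    obtain d2 where d2: "d2 > 0" "\<And>z. dist z y < d2 \<Longrightarrow> dist (?D v u z) (?D v u y) < e"
      using cont[of v u] e unfolding continuous_at_eps_delta by (metis dist_commute)
    obtain d3 where d3: "d3 > 0" "ball y d3 \<subseteq> S" using S open_contains_ball by metis
    define d where "d = min d1 (min d2 d3)"
    have d: "d > 0" using d1 d2 d3 by (simp add: d_def)
    \<comment> \<open>The summand 1 keeps \<open>K\<close> positive when both directions vanish;
      \<open>t = d / (2 * K)\<close> puts the whole parallelogram inside the ball of radius
      \<open>d\<close>.\<close>
    define K where "K = norm u + norm v + 1"
    have K: "K > 0" by (simp add: K_def add_nonneg_pos)
    define t where "t = d / (2 * K)"
    have t: "t > 0" using d K by (simp add: t_def)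
    have tn: "t * (norm u + norm v) < d"
    proof -
      have "t * K = d / 2" using K by (simp add: t_def)
      then show ?thesis using t d by (simp add: K_def algebra_simps)
    qed
    have near: "dist (y + a *\<^sub>R u + b *\<^sub>R v) y < d" if "0 \<le> a" "a \<le> t" "0 \<le> b" "b \<le> t" for a b
    proof -
      have "dist (y + a *\<^sub>R u + b *\<^sub>R v) y = norm (a *\<^sub>R u + b *\<^sub>R v)"
        by (simp add: dist_norm algebra_simps)
      also have "\<dots> \<le> a * norm u + b * norm v"
        using norm_triangle_ineq[of "a *\<^sub>R u" "b *\<^sub>R v"] that by simp
      also have "\<dots> \<le> t * norm u + t * norm v"
        by (intro add_mono mult_right_mono) (use that in auto)
      finally show ?thesis using tn by (simp add: algebra_simps)
    qed
    have inS: "y + a *\<^sub>R u + b *\<^sub>R v \<in> S" if "0 \<le> a" "a \<le> t" "0 \<le> b" "b \<le> t" for a b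
      using near[OF that] d3 by (auto simp: d_def dist_commute)
    have inS': "y + a *\<^sub>R v + b *\<^sub>R u \<in> S" if "0 \<le> a" "a \<le> t" "0 \<le> b" "b \<le> t" for a b
      using inS[of b a] that by (simp add: algebra_simps)
    obtain a b where ab: "0 \<le> a" "a \<le> t" "0 \<le> b" "b \<le> t"
      "f (y + t *\<^sub>R u + t *\<^sub>R v) - f (y + t *\<^sub>R u) - f (y + t *\<^sub>R v) + f y = t * t * ?D u v (y + a *\<^sub>R u + b *\<^sub>R v)"
      using second_difference_mvt[OF t inS C] by blast
    obtain a' b' where ab': "0 \<le> a'" "a' \<le> t" "0 \<le> b'" "b' \<le> t"
      "f (y + t *\<^sub>R v + t *\<^sub>R u) - f (y + t *\<^sub>R v) - f (y + t *\<^sub>R u) + f y = t * t * ?D v u (y + a' *\<^sub>R v + b' *\<^sub>R u)"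
      using second_difference_mvt[OF t inS' C] by blast
    have "t * t * ?D u v (y + a *\<^sub>R u + b *\<^sub>R v) = t * t * ?D v u (y + a' *\<^sub>R v + b' *\<^sub>R u)"
      using ab(5) ab'(5) by (simp add: algebra_simps)
    then have eq: "?D u v (y + a *\<^sub>R u + b *\<^sub>R v) = ?D v u (y + a' *\<^sub>R v + b' *\<^sub>R u)"
      using t by simp
    have "dist (?D u v (y + a *\<^sub>R u + b *\<^sub>R v)) (?D u v y) < e"
      by (rule d1(2)) (use near[OF ab(1-4)] in \<open>simp add: d_def\<close>)
    moreover have "dist (?D v u (y + a' *\<^sub>R v + b' *\<^sub>R u)) (?D v u y) < e"
      by (rule d2(2)) (use near[OF ab'(3,4,1,2)] in \<open>simp add: d_def algebra_simps\<close>)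
    ultimately show ?thesis using eq by (simp add: dist_real_def)
  qed
  \<comment> \<open>Taking half the gap as tolerance would make a nonzero gap smaller than
    itself.\<close>
  from this[of "\<bar>?D u v y - ?D v u y\<bar> / 2"] show ?thesis by (cases "?D u v y = ?D v u y") auto
qed

text \<open>The mean value theorem is real-valued, hence the passage to one component at a
  time.\<close>

lemma second_derivative_symmetric:
  fixes f :: "'e::euclidean_space \<Rightarrow> 'f::euclidean_space"
  assumes S: "open S" "y \<in> S" and C: "Ck_on 2 S f"
  shows "frechet_derivative (\<lambda>y. frechet_derivative f (at y) u) (at y) v
       = frechet_derivative (\<lambda>y. frechet_derivative f (at y) v) (at y) u"
proof (rule euclidean_eqI)
  fix b :: 'f assume b: "b \<in> Basis"
  have C': "Ck_on (Suc (Suc 0)) S f" using C by (simp only: numeral_2_eq_2)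
  have C1: "Ck_on (Suc 0) S f" by (rule Ck_on_Suc_D[OF C'])
  have C2: "Ck_on (Suc 0) S (\<lambda>y. frechet_derivative f (at y) u)" for u
    using C' unfolding Ck_on.simps(2)[of "Suc 0"] by blast
  have Cb: "Ck_on 2 S (\<lambda>y. f y \<bullet> b)"
    by (rule Ck_on_bounded_linear[OF S(1) bounded_linear_inner_left C])
  have 1: "frechet_derivative f (at z) u \<bullet> b = frechet_derivative (\<lambda>y. f y \<bullet> b) (at z) u" if "z \<in> S" for z u
    using fun_cong[OF frechet_derivative_at[OF has_derivative_inner_left[OF Ck_onD[OF C1 that], of b]]] .
  have 2: "frechet_derivative (\<lambda>y. frechet_derivative f (at y) u) (at y) v \<bullet> b
      = frechet_derivative (\<lambda>y. frechet_derivative (\<lambda>y. f y \<bullet> b) (at y) u) (at y) v" for u v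
  proof -
    have "((\<lambda>y. frechet_derivative (\<lambda>y. f y \<bullet> b) (at y) u) has_derivative
       (\<lambda>v. frechet_derivative (\<lambda>y. frechet_derivative f (at y) u) (at y) v \<bullet> b)) (at y)"
      by (rule has_derivative_transform_within_open[OF
          has_derivative_inner_left[OF Ck_onD[OF C2 S(2)]] S]) (use 1 in auto)
    from fun_cong[OF frechet_derivative_at[OF this]] show ?thesis .
  qed
  show "frechet_derivative (\<lambda>y. frechet_derivative f (at y) u) (at y) v \<bullet> b
       = frechet_derivative (\<lambda>y. frechet_derivative f (at y) v) (at y) u \<bullet> b"
    using second_derivative_symmetric_real[OF S Cb] 2 by simp
qed

section \<open>Calculus in a chart\<close>

lemma smooth_on_compose:
  assumes "open S" "open T" "f ` S \<subseteq> T" "smooth_on S f" "smooth_on T f'"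
  shows "smooth_on S (\<lambda>y. f' (f y))"
  using assms Ck_on_compose unfolding smooth_on_def by blast

text \<open>Only values on \<open>U\<close> and a single chart enter, so the notion fits components
  \<open>X q c\<close> with \<open>c\<close> fixed as well as functions on the manifold.\<close>

definition csmooth :: "('a, 'e::euclidean_space) chart \<Rightarrow> 'a set \<Rightarrow> ('a \<Rightarrow> 'f::real_normed_vector) \<Rightarrow> bool"
  where "csmooth c U f \<longleftrightarrow> smooth_on (coord c ` U) (\<lambda>y. f (cinv c y))"

lemma csmooth_subset: "csmooth c U f \<Longrightarrow> V \<subseteq> U \<Longrightarrow> csmooth c V f"
  unfolding csmooth_def smooth_on_def by (meson Ck_on_subset image_mono)

lemma csmooth_const [simp]: "csmooth c U (\<lambda>q. a)"
  by (simp add: csmooth_def smooth_on_def)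

lemma dmap_eq_dir_deriv: "dmap \<phi> p c d = dir_deriv c (\<lambda>q. coord d (\<phi> q)) p"
  by (auto simp: dmap_def dir_deriv_def o_def)

lemma dir_deriv_eqI:
  "((\<lambda>y. f (cinv c y)) has_derivative F) (at (coord c p)) \<Longrightarrow> dir_deriv c f p = F"
  unfolding dir_deriv_def using frechet_derivative_at by (metis (no_types, lifting) ext)

section \<open>Differentiation of functions on an open subset of one chart\<close>

locale chart_open =
  fixes c :: "('a::topological_space, 'e::euclidean_space) chart" and U :: "'a set"
  assumes chart: "is_chart c" and open_U: "open U" and U_subset: "U \<subseteq> cdom c"
begin

lemma cinv_coord: "p \<in> U \<Longrightarrow> cinv c (coord c p) = p"
  using chart U_subset unfolding is_chart_def homeomorphism_def by auto

lemma cinv_mem: "y \<in> coord c ` U \<Longrightarrow> cinv c y \<in> U"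
  using cinv_coord by auto

lemma coord_cinv: "y \<in> coord c ` U \<Longrightarrow> coord c (cinv c y) = y"
  using cinv_coord by auto

lemma open_coord: "open (coord c ` U)"
proof -
  have h: "homeomorphism (cdom c) (coord c ` cdom c) (coord c) (cinv c)"
    and o: "open (coord c ` cdom c)"
    using chart unfolding is_chart_def by auto
  have "openin (top_of_set (cdom c)) U"
    using open_U U_subset open_subset by blast
  then have "openin (top_of_set (coord c ` cdom c)) (coord c ` U)"
    using homeomorphism_imp_open_map[OF h] by blast
  then show ?thesis using o openin_open_trans by blast
qed

lemma chart_open_subset: "open V \<Longrightarrow> V \<subseteq> U \<Longrightarrow> chart_open c V"
  using chart U_subset by unfold_locales auto

lemma csmooth_cong:
  assumes "\<And>q. q \<in> U \<Longrightarrow> f q = f' q" "csmooth c U f"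
  shows "csmooth c U f'"
  using assms(2) Ck_on_cong[OF open_coord] assms(1) cinv_mem
  unfolding csmooth_def smooth_on_def by (metis (no_types, lifting))

lemma csmooth_local:
  assumes "\<And>p. p \<in> U \<Longrightarrow> \<exists>V. open V \<and> p \<in> V \<and> V \<subseteq> U \<and> csmooth c V f"
  shows "csmooth c U f"
  unfolding csmooth_def smooth_on_def
proof (intro allI Ck_on_local)
  fix k y assume "y \<in> coord c ` U"
  then obtain p where p: "p \<in> U" "y = coord c p" by auto
  obtain V where V: "open V" "p \<in> V" "V \<subseteq> U" "csmooth c V f" using assms[OF p(1)] by auto
  have "open (coord c ` V)"
    using chart_open.open_coord[OF chart_open_subset[OF V(1,3)]] .
  then show "\<exists>T. open T \<and> y \<in> T \<and> Ck_on k T (\<lambda>y. f (cinv c y))"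
    using V p unfolding csmooth_def smooth_on_def by blast
qed

lemma csmooth_bounded_linear: "bounded_linear L \<Longrightarrow> csmooth c U f \<Longrightarrow> csmooth c U (\<lambda>q. L (f q))"
  unfolding csmooth_def smooth_on_def using Ck_on_bounded_linear[OF open_coord] by blast

lemma csmooth_bilinear:
  "bounded_bilinear P \<Longrightarrow> csmooth c U f \<Longrightarrow> csmooth c U f' \<Longrightarrow> csmooth c U (\<lambda>q. P (f q) (f' q))"
  unfolding csmooth_def smooth_on_def
  using Ck_on_bilinear[OF open_coord, where f = "\<lambda>y. f (cinv c y)" and f' = "\<lambda>y. f' (cinv c y)"] by blast

lemma csmooth_add: "csmooth c U f \<Longrightarrow> csmooth c U f' \<Longrightarrow> csmooth c U (\<lambda>q. f q + f' q)"
  unfolding csmooth_def smooth_on_def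
  using Ck_on_add[OF open_coord, where f = "\<lambda>y. f (cinv c y)" and f' = "\<lambda>y. f' (cinv c y)"] by blast

lemmas csmooth_scaleR = csmooth_bilinear[OF bounded_bilinear_scaleR]

lemma csmooth_minus: "csmooth c U f \<Longrightarrow> csmooth c U (\<lambda>q. - f q)"
  by (rule csmooth_bounded_linear[OF bounded_linear_minus[OF bounded_linear_ident]])

lemma csmooth_diff: "csmooth c U f \<Longrightarrow> csmooth c U f' \<Longrightarrow> csmooth c U (\<lambda>q. f q - f' q)"
  using csmooth_add[OF _ csmooth_minus, of f f'] by simp

lemma csmooth_sum: "(\<And>i. i \<in> I \<Longrightarrow> csmooth c U (f i)) \<Longrightarrow> csmooth c U (\<lambda>q. \<Sum>i\<in>I. f i q)"
  unfolding csmooth_def smooth_on_def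
  using Ck_on_sum[OF open_coord, where f = "\<lambda>i y. f i (cinv c y)"] by blast

lemma csmooth_powr:
  fixes f :: "'a \<Rightarrow> real"
  shows "(\<And>q. q \<in> U \<Longrightarrow> f q > 0) \<Longrightarrow> csmooth c U f \<Longrightarrow> csmooth c U (\<lambda>q. f q powr a)"
  unfolding csmooth_def smooth_on_def
  using Ck_on_powr[OF open_coord, where f = "\<lambda>y. f (cinv c y)"] cinv_mem by blast

text \<open>Continuity for the topology of the manifold: it makes the set where a Gram-Schmidt
  remainder has positive square norm open.\<close>

lemma csmooth_continuous:
  assumes "csmooth c U f"
  shows "continuous_on U f"
proof -
  have "continuous_on (coord c ` U) (\<lambda>y. f (cinv c y))"
    using assms unfolding csmooth_def smooth_on_def by (metis Ck_on.simps(1))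
  moreover have "continuous_on U (coord c)"
    using chart U_subset unfolding is_chart_def homeomorphism_def
    by (auto intro: continuous_on_subset)
  ultimately have "continuous_on U (\<lambda>q. f (cinv c (coord c q)))"
    by (rule continuous_on_compose2) auto
  then show ?thesis
    by (rule continuous_on_eq) (simp add: cinv_coord)
qed

lemma has_dir_deriv:
  assumes "csmooth c U f" "p \<in> U"
  shows "((\<lambda>y. f (cinv c y)) has_derivative dir_deriv c f p) (at (coord c p))"
proof -
  have "Ck_on (Suc 0) (coord c ` U) (\<lambda>y. f (cinv c y))"
    using assms(1) unfolding csmooth_def smooth_on_def by blast
  from Ck_onD[OF this] show ?thesis
    using assms(2) by (simp add: dir_deriv_def[abs_def])
qed

text \<open>Functions that agree near \<open>p\<close> admit the same derivatives there, hence have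
  the same chosen one, differentiable or not.\<close>

lemma dir_deriv_cong:
  assumes "p \<in> U" "\<And>q. q \<in> U \<Longrightarrow> f q = f' q"
  shows "dir_deriv c f p = dir_deriv c f' p"
proof -
  have p: "coord c p \<in> coord c ` U" using assms(1) by simp
  have "((\<lambda>y. f (cinv c y)) has_derivative F) (at (coord c p)) \<longleftrightarrow>
        ((\<lambda>y. f' (cinv c y)) has_derivative F) (at (coord c p))" for F
    using has_derivative_transform_within_open[OF _ open_coord p] assms(2) cinv_mem
    by (smt (verit))
  then show ?thesis unfolding dir_deriv_def frechet_derivative_def by simp
qed

lemma linear_dir_deriv: "csmooth c U f \<Longrightarrow> p \<in> U \<Longrightarrow> linear (dir_deriv c f p)"
  using has_dir_deriv has_derivative_linear by blast

lemma dir_deriv_const [simp]: "dir_deriv c (\<lambda>q. a) p u = 0"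
  by (simp add: dir_deriv_def)

lemma dir_deriv_bounded_linear:
  assumes "bounded_linear L" "csmooth c U f" "p \<in> U"
  shows "dir_deriv c (\<lambda>q. L (f q)) p u = L (dir_deriv c f p u)"
  using dir_deriv_eqI[OF bounded_linear.has_derivative[OF assms(1) has_dir_deriv[OF assms(2,3)]]] by simp

lemma dir_deriv_add:
  assumes "csmooth c U f" "csmooth c U f'" "p \<in> U"
  shows "dir_deriv c (\<lambda>q. f q + f' q) p u = dir_deriv c f p u + dir_deriv c f' p u"
  using dir_deriv_eqI[OF has_derivative_add[OF has_dir_deriv[OF assms(1,3)] has_dir_deriv[OF assms(2,3)]]]
  by simp

lemma dir_deriv_bilinear:
  assumes "bounded_bilinear P" "csmooth c U f" "csmooth c U f'" "p \<in> U"
  shows "dir_deriv c (\<lambda>q. P (f q) (f' q)) p u = P (f p) (dir_deriv c f' p u) + P (dir_deriv c f p u) (f' p)"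
  using dir_deriv_eqI[OF bounded_bilinear.FDERIV[OF assms(1) has_dir_deriv[OF assms(2,4)] has_dir_deriv[OF assms(3,4)]]]
  by (simp add: cinv_coord[OF assms(4)])

lemma dir_deriv_scaleR_const:
  assumes "csmooth c U f" "p \<in> U"
  shows "dir_deriv c (\<lambda>q. r *\<^sub>R f q) p u = r *\<^sub>R dir_deriv c f p u"
  by (rule dir_deriv_bounded_linear[OF bounded_linear_scaleR_right assms])

lemma dir_deriv_sum:
  assumes "\<And>i. i \<in> I \<Longrightarrow> csmooth c U (f i)" "p \<in> U"
  shows "dir_deriv c (\<lambda>q. \<Sum>i\<in>I. f i q) p u = (\<Sum>i\<in>I. dir_deriv c (f i) p u)"
  using assms(1)
  by (induction I rule: infinite_finite_induct)
    (auto simp: dir_deriv_add[OF _ csmooth_sum assms(2)])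

lemma csmooth_dir_deriv:
  assumes "csmooth c U f" "csmooth c U X"
  shows "csmooth c U (\<lambda>q. dir_deriv c f q (X q))"
  unfolding csmooth_def smooth_on_def
proof
  fix k
  have "Ck_on k (coord c ` U) (\<lambda>y. frechet_derivative (\<lambda>y. f (cinv c y)) (at y) (X (cinv c y)))"
    using assms unfolding csmooth_def smooth_on_def by (intro Ck_on_frechet_derivative open_coord) auto
  then show "Ck_on k (coord c ` U) (\<lambda>y. dir_deriv c f (cinv c y) (X (cinv c y)))"
    by (rule Ck_on_cong[OF open_coord, rotated]) (simp add: dir_deriv_def coord_cinv)
qed

text \<open>Coordinate vector fields commute; this is the source of the symmetry of the second
  fundamental form.\<close>

lemma dir_deriv_commute:
  fixes f :: "'a \<Rightarrow> 'f::euclidean_space"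
  assumes "csmooth c U f" "p \<in> U"
  shows "dir_deriv c (\<lambda>q. dir_deriv c f q u) p v = dir_deriv c (\<lambda>q. dir_deriv c f q v) p u"
proof -
  let ?f = "\<lambda>y. f (cinv c y)"
  have p: "coord c p \<in> coord c ` U" using assms(2) by simp
  have C: "Ck_on (Suc (Suc 0)) (coord c ` U) ?f"
    using assms(1) unfolding csmooth_def smooth_on_def by blast
  have C2: "Ck_on (Suc 0) (coord c ` U) (\<lambda>y. frechet_derivative ?f (at y) u)" for u
    using C unfolding Ck_on.simps(2)[of "Suc 0"] by blast
  have e: "dir_deriv c (\<lambda>q. dir_deriv c f q u) p
      = frechet_derivative (\<lambda>y. frechet_derivative ?f (at y) u) (at (coord c p))" for u
    by (rule dir_deriv_eqI, rule has_derivative_transform_within_open[OF Ck_onD[OF C2 p] open_coord p])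
      (simp add: dir_deriv_def coord_cinv)
  show ?thesis
    unfolding e using second_derivative_symmetric[OF open_coord p] C by (simp add: numeral_2_eq_2)
qed

section \<open>Product rules for families of linear and bilinear maps\<close>

context
  fixes L :: "'a \<Rightarrow> 'x::euclidean_space \<Rightarrow> 'y::real_normed_vector" and X :: "'a \<Rightarrow> 'x"
  assumes L: "\<And>q. q \<in> U \<Longrightarrow> linear (L q)" and sL: "\<And>v. csmooth c U (\<lambda>q. L q v)"
    and X: "csmooth c U X"
begin

lemma linear_family_expansion:
  assumes "q \<in> U"
  shows "L q v = (\<Sum>b\<in>Basis. (v \<bullet> b) *\<^sub>R L q b)"
proof -
  have "L q v = L q (\<Sum>b\<in>Basis. (v \<bullet> b) *\<^sub>R b)"
    by (simp add: euclidean_representation)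
  then show ?thesis
    by (simp add: linear_sum[OF L[OF assms]] linear_scale[OF L[OF assms]])
qed

lemma csmooth_coordinate: "csmooth c U (\<lambda>q. X q \<bullet> b)"
  by (rule csmooth_bounded_linear[OF bounded_linear_inner_left X])

lemma csmooth_linear_family: "csmooth c U (\<lambda>q. L q (X q))"
  by (rule csmooth_cong[OF linear_family_expansion[symmetric]])
    (auto intro!: csmooth_sum csmooth_scaleR csmooth_coordinate sL)

text \<open>A Leibniz rule with the argument frozen at \<open>p\<close> in the first term. The
  connections are defined through constant arguments, and this rule carries their formulas over to
  varying fields. Expanding \<open>X\<close> in \<open>Basis\<close> reduces it to products of a
  scalar and a vector function.\<close>

lemma dir_deriv_linear_family:
  assumes p: "p \<in> U"
  shows "dir_deriv c (\<lambda>q. L q (X q)) p u = dir_deriv c (\<lambda>q. L q (X p)) p u + L p (dir_deriv c X p u)"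
proof -
  have "dir_deriv c (\<lambda>q. L q (X q)) p u = dir_deriv c (\<lambda>q. \<Sum>b\<in>Basis. (X q \<bullet> b) *\<^sub>R L q b) p u"
    by (intro fun_cong[OF dir_deriv_cong[OF p]] linear_family_expansion)
  also have "\<dots> = (\<Sum>b\<in>Basis. dir_deriv c (\<lambda>q. (X q \<bullet> b) *\<^sub>R L q b) p u)"
    by (intro dir_deriv_sum p csmooth_scaleR csmooth_coordinate sL)
  also have "\<dots> = (\<Sum>b\<in>Basis. (X p \<bullet> b) *\<^sub>R dir_deriv c (\<lambda>q. L q b) p u
      + (dir_deriv c X p u \<bullet> b) *\<^sub>R L p b)"
    by (intro sum.cong refl)
      (simp add: dir_deriv_bilinear[OF bounded_bilinear_scaleR csmooth_coordinate sL p]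
        dir_deriv_bounded_linear[OF bounded_linear_inner_left X p])
  also have "\<dots> = dir_deriv c (\<lambda>q. \<Sum>b\<in>Basis. (X p \<bullet> b) *\<^sub>R L q b) p u + L p (dir_deriv c X p u)"
    unfolding linear_family_expansion[OF p, of "dir_deriv c X p u"]
    by (subst dir_deriv_sum[OF _ p])
      (auto simp: sum.distrib dir_deriv_scaleR_const[OF sL p] intro!: csmooth_scaleR sL)
  also have "dir_deriv c (\<lambda>q. \<Sum>b\<in>Basis. (X p \<bullet> b) *\<^sub>R L q b) p = dir_deriv c (\<lambda>q. L q (X p)) p"
    by (intro dir_deriv_cong[OF p] linear_family_expansion[symmetric])
  finally show ?thesis .
qed

end

lemma
  fixes T :: "'a \<Rightarrow> 'x::euclidean_space \<Rightarrow> 'z::euclidean_space \<Rightarrow> 'y::real_normed_vector"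
  assumes T: "\<And>q. q \<in> U \<Longrightarrow> bilinear (T q)" and sT: "\<And>v w. csmooth c U (\<lambda>q. T q v w)"
    and X: "csmooth c U X" and Y: "csmooth c U Y"
  shows csmooth_bilinear_family: "csmooth c U (\<lambda>q. T q (X q) (Y q))"
    and dir_deriv_bilinear_family: "p \<in> U \<Longrightarrow> dir_deriv c (\<lambda>q. T q (X q) (Y q)) p u =
      dir_deriv c (\<lambda>q. T q (X p) (Y p)) p u + T p (dir_deriv c X p u) (Y p) + T p (X p) (dir_deriv c Y p u)"
proof -
  have l: "linear (\<lambda>v. T q v w)" "linear (T q v)" if "q \<in> U" for q v w
    using T[OF that] by (auto simp: bilinear_def)
  have Y': "csmooth c U (\<lambda>q. T q v (Y q))" for v
    by (rule csmooth_linear_family[where L = "\<lambda>q. T q v"]) (use l sT Y in auto)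
  show "csmooth c U (\<lambda>q. T q (X q) (Y q))"
    by (rule csmooth_linear_family[where L = "\<lambda>q v. T q v (Y q)"]) (use l Y' X in auto)
  assume p: "p \<in> U"
  have "dir_deriv c (\<lambda>q. T q (X q) (Y q)) p u =
      dir_deriv c (\<lambda>q. T q (X p) (Y q)) p u + T p (dir_deriv c X p u) (Y p)"
    by (rule dir_deriv_linear_family[where L = "\<lambda>q v. T q v (Y q)"]) (use l Y' X p in auto)
  moreover have "dir_deriv c (\<lambda>q. T q (X p) (Y q)) p u =
      dir_deriv c (\<lambda>q. T q (X p) (Y p)) p u + T p (X p) (dir_deriv c Y p u)"
    by (rule dir_deriv_linear_family[where L = "\<lambda>q. T q (X p)"]) (use l sT Y p in auto)
  ultimately show "dir_deriv c (\<lambda>q. T q (X q) (Y q)) p u =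
      dir_deriv c (\<lambda>q. T q (X p) (Y p)) p u + T p (dir_deriv c X p u) (Y p) + T p (X p) (dir_deriv c Y p u)"
    by simp
qed

end

text \<open>Written in the coordinates of \<open>d\<close>, this is the Euclidean chain rule. With
  \<phi> the identity it yields the change of charts.\<close>

lemma
  assumes U: "chart_open c U" and V: "chart_open d V" and \<phi>: "\<phi> ` U \<subseteq> V"
    and s: "csmooth c U (\<lambda>q. coord d (\<phi> q))" and F: "csmooth d V F"
  shows csmooth_pullback: "csmooth c U (\<lambda>q. F (\<phi> q))"
    and dir_deriv_pullback:
      "p \<in> U \<Longrightarrow> dir_deriv c (\<lambda>q. F (\<phi> q)) p u = dir_deriv d F (\<phi> p) (dmap \<phi> p c d u)"
proof -
  interpret c: chart_open c U by fact
  interpret d: chart_open d V by fact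
  let ?G = "\<lambda>y. F (cinv d (coord d (\<phi> (cinv c y))))"
  have "(\<lambda>y. coord d (\<phi> (cinv c y))) ` coord c ` U \<subseteq> coord d ` V"
    using \<phi> by (auto simp: c.cinv_coord)
  then have "smooth_on (coord c ` U) ?G"
    by (rule smooth_on_compose[OF c.open_coord d.open_coord])
      (use s F in \<open>auto simp: csmooth_def\<close>)
  then have "csmooth c U (\<lambda>q. F (cinv d (coord d (\<phi> q))))" by (simp add: csmooth_def)
  then show "csmooth c U (\<lambda>q. F (\<phi> q))"
    by (rule c.csmooth_cong[rotated]) (use \<phi> d.cinv_coord in force)
  assume p: "p \<in> U"
  then have \<phi>p: "\<phi> p \<in> V" using \<phi> by auto
  have "((\<lambda>y. F (cinv d (coord d (\<phi> (cinv c y))))) has_derivative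
      (\<lambda>u. dir_deriv d F (\<phi> p) (dmap \<phi> p c d u))) (at (coord c p))"
    using diff_chain_at[OF c.has_dir_deriv[OF s p], of "\<lambda>y. F (cinv d y)" "dir_deriv d F (\<phi> p)"]
      d.has_dir_deriv[OF F \<phi>p] by (simp add: o_def c.cinv_coord[OF p] dmap_eq_dir_deriv)
  then have "dir_deriv c (\<lambda>q. F (cinv d (coord d (\<phi> q)))) p u = dir_deriv d F (\<phi> p) (dmap \<phi> p c d u)"
    by (simp add: dir_deriv_eqI)
  moreover have "dir_deriv c (\<lambda>q. F (cinv d (coord d (\<phi> q)))) p = dir_deriv c (\<lambda>q. F (\<phi> q)) p"
    by (rule c.dir_deriv_cong[OF p]) (use \<phi> d.cinv_coord in force)
  ultimately show "dir_deriv c (\<lambda>q. F (\<phi> q)) p u = dir_deriv d F (\<phi> p) (dmap \<phi> p c d u)" by simp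
qed

section \<open>Orthonormal frames\<close>

locale inner_form =
  fixes G :: "'e::euclidean_space \<Rightarrow> 'e \<Rightarrow> real"
  assumes bilinear: "bilinear G" and sym: "G u v = G v u" and pos: "u \<noteq> 0 \<Longrightarrow> G u u > 0"
begin

lemmas form_simps =
  bilinear_ladd[OF bilinear] bilinear_radd[OF bilinear] bilinear_lsub[OF bilinear]
  bilinear_rsub[OF bilinear] bilinear_lmul[OF bilinear] bilinear_rmul[OF bilinear]
  bilinear_lzero[OF bilinear] bilinear_rzero[OF bilinear]
  bilinear_lneg[OF bilinear] bilinear_rneg[OF bilinear]

lemma linear_left: "linear (\<lambda>u. G u v)"
  using bilinear by (auto simp: bilinear_def)

lemma sum_left: "G (sum f I) v = (\<Sum>i\<in>I. G (f i) v)"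
  using linear_sum[OF linear_left] .

lemma form_eq_0: "G u u = 0 \<longleftrightarrow> u = 0"
  using pos[of u] form_simps by (cases "u = 0") auto

lemma form_eqI: "(\<And>z. G u z = G v z) \<Longrightarrow> u = v"
  using form_eq_0[of "u - v"] by (simp add: form_simps)

text \<open>Gram-Schmidt adds one vector at a time, while \<open>orthonormal\<close> speaks of full
  bases.\<close>

definition orthonormal_upto :: "nat \<Rightarrow> (nat \<Rightarrow> 'e) \<Rightarrow> bool" where
  "orthonormal_upto k b \<longleftrightarrow> (\<forall>i\<in>{1..k}. \<forall>j\<in>{1..k}. G (b i) (b j) = (if i = j then 1 else 0))"

lemma orthonormal_upto_DIM: "orthonormal_upto DIM('e) b \<longleftrightarrow> orthonormal G b"
  by (simp add: orthonormal_upto_def orthonormal_def)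

lemma orthonormal_upto_mono: "orthonormal_upto k b \<Longrightarrow> l \<le> k \<Longrightarrow> orthonormal_upto l b"
  by (auto simp: orthonormal_upto_def)

lemma orthonormal_coeff:
  assumes "orthonormal_upto k b" "j \<in> {1..k}"
  shows "G (\<Sum>i=1..k. a i *\<^sub>R b i) (b j) = a j"
proof -
  have "G (\<Sum>i=1..k. a i *\<^sub>R b i) (b j) = (\<Sum>i=1..k. if i = j then a i else 0)"
    unfolding sum_left by (rule sum.cong) (use assms in \<open>auto simp: orthonormal_upto_def form_simps\<close>)
  then show ?thesis using assms(2) by simp
qed

lemma orthonormal_inj:
  assumes "orthonormal_upto k b" shows "inj_on b {1..k}"
proof (rule inj_onI)
  fix i j assume ij: "i \<in> {1..k}" "j \<in> {1..k}" "b i = b j"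
  then have "G (b i) (b j) = 1"
    using assms unfolding orthonormal_upto_def by metis
  then show "i = j" using assms ij(1,2) unfolding orthonormal_upto_def by (metis zero_neq_one)
qed

lemma orthonormal_independent:
  assumes "orthonormal_upto k b" shows "independent (b ` {1..k})"
proof (rule independent_if_scalars_zero)
  fix f x assume "(\<Sum>x\<in>b ` {1..k}. f x *\<^sub>R x) = 0" and x: "x \<in> b ` {1..k}"
  then have z: "(\<Sum>i=1..k. f (b i) *\<^sub>R b i) = 0"
    by (subst (asm) sum.reindex[OF orthonormal_inj[OF assms]]) (simp add: o_def)
  obtain j where j: "x = b j" "j \<in> {1..k}" using x by auto
  show "f x = 0"
    using orthonormal_coeff[OF assms j(2), of "\<lambda>i. f (b i)"] unfolding z by (simp add: form_simps j)
qed simp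

lemma orthonormal_expansion_span:
  assumes "orthonormal_upto k b" "x \<in> span (b ` {1..k})"
  shows "x = (\<Sum>i=1..k. G x (b i) *\<^sub>R b i)"
proof -
  obtain f where "x = (\<Sum>v\<in>b ` {1..k}. f v *\<^sub>R v)"
    using assms(2) span_finite[of "b ` {1..k}"] by auto
  then have x: "x = (\<Sum>i=1..k. f (b i) *\<^sub>R b i)"
    by (subst (asm) sum.reindex[OF orthonormal_inj[OF assms(1)]]) (simp add: o_def)
  have "G x (b i) = f (b i)" if "i \<in> {1..k}" for i
    unfolding x using orthonormal_coeff[OF assms(1) that] .
  then show ?thesis using x by simp
qed

lemma dim_orthonormal:
  assumes "orthonormal_upto k b" shows "dim (span (b ` {1..k})) = k"
  using orthonormal_independent[OF assms] orthonormal_inj[OF assms]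
  by (simp add: dim_eq_card_independent card_image)

lemma orthonormal_expansion:
  assumes "orthonormal G b"
  shows "x = (\<Sum>i=1..DIM('e). G x (b i) *\<^sub>R b i)"
proof -
  have o: "orthonormal_upto DIM('e) b" using assms by (simp add: orthonormal_upto_DIM)
  have "span (b ` {1..DIM('e)}) = UNIV"
    using dim_orthonormal[OF o] dim_eq_full by (metis dim_span)
  then show ?thesis using orthonormal_expansion_span[OF o] by auto
qed

lemma orthonormal_incomplete:
  assumes "orthonormal_upto k b" "k < DIM('e)"
  shows "\<exists>u. u - (\<Sum>i=1..k. G u (b i) *\<^sub>R b i) \<noteq> 0"
proof (rule ccontr)
  assume "\<not> ?thesis"
  then have e: "u = (\<Sum>i=1..k. G u (b i) *\<^sub>R b i)" for u by auto
  have "u \<in> span (b ` {1..k})" for u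
    by (subst e, intro span_sum span_scale span_base imageI)
  then have "span (b ` {1..k}) = UNIV" by auto
  then show False using dim_orthonormal[OF assms(1)] assms(2) by simp
qed

text \<open>Expand each \<open>b i\<close> in \<open>b'\<close>, exchange the sums, and use symmetry
  of \<open>G\<close> to recombine the \<open>b i\<close> into \<open>b' j\<close>. This is the
  existence half of the description in \<open>metric_trace\<close>; uniqueness comes from having one
  orthonormal basis.\<close>

lemma sum_orthonormal_eq:
  fixes T :: "'e \<Rightarrow> 'e \<Rightarrow> 'f::real_vector"
  assumes T: "bilinear T" and b: "orthonormal G b" and b': "orthonormal G b'"
  shows "(\<Sum>i=1..DIM('e). T (b i) (b i)) = (\<Sum>i=1..DIM('e). T (b' i) (b' i))"
proof -
  have l: "linear (T u)" "linear (\<lambda>u. T u v)" for u v using T by (auto simp: bilinear_def)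
  have "(\<Sum>i=1..DIM('e). T (b i) (b i)) = (\<Sum>i=1..DIM('e). T (\<Sum>j=1..DIM('e). G (b i) (b' j) *\<^sub>R b' j) (b i))"
    using orthonormal_expansion[OF b'] by simp
  also have "\<dots> = (\<Sum>i=1..DIM('e). \<Sum>j=1..DIM('e). G (b i) (b' j) *\<^sub>R T (b' j) (b i))"
    by (simp add: linear_sum[OF l(2)] linear_scale[OF l(2)])
  also have "\<dots> = (\<Sum>j=1..DIM('e). \<Sum>i=1..DIM('e). G (b' j) (b i) *\<^sub>R T (b' j) (b i))"
    by (subst sum.swap) (simp add: sym)
  also have "\<dots> = (\<Sum>j=1..DIM('e). T (b' j) (\<Sum>i=1..DIM('e). G (b' j) (b i) *\<^sub>R b i))"
    by (simp add: linear_sum[OF l(1)] linear_scale[OF l(1)])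
  finally show ?thesis using orthonormal_expansion[OF b] by simp
qed

lemma metric_trace_eq:
  fixes T :: "'e \<Rightarrow> 'e \<Rightarrow> 'f::real_vector"
  assumes "bilinear T" "orthonormal G b"
  shows "metric_trace G T = (\<Sum>i=1..DIM('e). T (b i) (b i))"
  unfolding metric_trace_def
  by (rule the_equality) (use sum_orthonormal_eq[OF assms(1)] assms(2) in blast)+

text \<open>If the first vectors are orthogonal to the kernel, then \<open>F\<close> is injective on
  their span, and onto by dimension count. So \<open>F (b s) = F x\<close> with \<open>x\<close> in
  that span; \<open>b s - x\<close> lies in the kernel, hence \<open>x\<close> is orthogonal to the
  vectors spanning it and vanishes. The remaining vectors of an orthonormal basis are thus
  automatically vertical.\<close>

lemma surj_kernel_frame:
  fixes F :: "'e \<Rightarrow> 'f::euclidean_space"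
  assumes F: "linear F" "surj F" and b: "orthonormal G b"
    and h: "\<And>i w. i \<in> {1..DIM('f)} \<Longrightarrow> F w = 0 \<Longrightarrow> G (b i) w = 0"
    and s: "s \<in> {DIM('f)+1..DIM('e)}"
  shows "F (b s) = 0"
proof -
  let ?n = "DIM('f)" and ?H = "span (b ` {1..DIM('f)})"
  have n: "?n \<le> DIM('e)" using s by auto
  have o: "orthonormal_upto ?n b"
    using b n orthonormal_upto_mono orthonormal_upto_DIM by blast
  have z: "x = 0" if "x \<in> ?H" "\<And>i. i \<in> {1..?n} \<Longrightarrow> G (b i) x = 0" for x
  proof -
    have "(\<Sum>i=1..?n. G x (b i) *\<^sub>R b i) = 0"
      by (rule sum.neutral) (use that(2) sym in force)
    then show ?thesis using orthonormal_expansion_span[OF o that(1)] by simp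
  qed
  have inj: "inj_on F ?H"
    unfolding linear_inj_on_iff_eq_0[OF F(1) subspace_span] using h z by blast
  have "dim (F ` ?H) = ?n"
    using dim_orthonormal[OF o] dim_image_eq[OF F(1), of ?H] inj unfolding span_span by simp
  moreover have "subspace (F ` ?H)" using F(1) by (simp add: linear_subspace_image)
  ultimately have "F ` ?H = UNIV"
    using subspace_dim_equal[of "F ` ?H" UNIV] by simp
  then obtain x where x: "x \<in> ?H" "F x = F (b s)" by (metis UNIV_I imageE)
  have "x = 0"
  proof (rule z[OF x(1)])
    fix i assume i: "i \<in> {1..?n}"
    have "F (b s - x) = 0" using x F(1) by (simp add: linear_diff)
    then have "G (b i) (b s - x) = 0" by (rule h[OF i])
    moreover have "G (b i) (b s) = 0" using b i s n by (auto simp: orthonormal_def)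
    ultimately show "G (b i) x = 0" by (simp add: form_simps)
  qed
  then show ?thesis using x(2) linear_0[OF F(1)] by simp
qed

end

section \<open>Smooth local orthonormal frames by Gram-Schmidt\<close>

locale metric_chart = chart_open c U for c :: "('a::topological_space, 'e::euclidean_space) chart" and U +
  fixes G :: "'a \<Rightarrow> 'e \<Rightarrow> 'e \<Rightarrow> real"
  assumes form: "q \<in> U \<Longrightarrow> inner_form (G q)" and csmooth_form: "csmooth c U (\<lambda>q. G q u v)"
begin

lemma csmooth_form_fields:
  assumes "open V" "V \<subseteq> U" "csmooth c V X" "csmooth c V Y"
  shows "csmooth c V (\<lambda>q. G q (X q) (Y q))"
proof -
  interpret V: chart_open c V using chart_open_subset assms by blast
  show ?thesis
    by (rule V.csmooth_bilinear_family)
      (use assms form csmooth_subset[OF csmooth_form] in \<open>auto simp: inner_form.bilinear\<close>)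
qed

definition frame_upto :: "'a set \<Rightarrow> nat \<Rightarrow> (nat \<Rightarrow> 'a \<Rightarrow> 'e) \<Rightarrow> bool" where
  "frame_upto V k e \<longleftrightarrow> (\<forall>i\<in>{1..k}. csmooth c V (e i)) \<and>
     (\<forall>q\<in>V. inner_form.orthonormal_upto (G q) k (\<lambda>i. e i q))"

text \<open>The remainder is nonzero at \<open>p\<close>; its square norm stays positive on a
  neighbourhood \<open>W\<close>, where it can be normalized smoothly. The last conclusion keeps the
  new vector a multiple of the remainder, so that linear conditions shared by \<open>v\<close> and
  the old vectors pass to it.\<close>

lemma gram_schmidt_step:
  assumes V: "open V" "V \<subseteq> U" "p \<in> V" and e: "frame_upto V k e" and v: "csmooth c V v"
    and nz: "v p - (\<Sum>i=1..k. G p (v p) (e i p) *\<^sub>R e i p) \<noteq> 0"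
  shows "\<exists>W f. open W \<and> W \<subseteq> V \<and> p \<in> W \<and> frame_upto W (Suc k) (e(Suc k := f)) \<and>
    (\<forall>q\<in>W. \<exists>r. f q = r *\<^sub>R (v q - (\<Sum>i=1..k. G q (v q) (e i q) *\<^sub>R e i q)))"
proof -
  interpret V: chart_open c V using chart_open_subset V by blast
  let ?w = "\<lambda>q. v q - (\<Sum>i=1..k. G q (v q) (e i q) *\<^sub>R e i q)"
  let ?n = "\<lambda>q. G q (?w q) (?w q)"
  have se: "csmooth c V (e i)" if "i \<in> {1..k}" for i using e that by (auto simp: frame_upto_def)
  have sw: "csmooth c V ?w"
    using v se by (intro V.csmooth_diff V.csmooth_sum V.csmooth_scaleR csmooth_form_fields V(1,2))
  have sn: "csmooth c V ?n" by (rule csmooth_form_fields[OF V(1,2) sw sw])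
  define W where "W = {q\<in>V. ?n q > 0}"
  have "open (?n -` {0<..} \<inter> V)"
    by (rule continuous_on_open_vimage[OF V(1), THEN iffD1, OF V.csmooth_continuous[OF sn],
          rule_format, OF open_greaterThan])
  moreover have "?n -` {0<..} \<inter> V = W" by (auto simp: W_def)
  ultimately have W: "open W" "W \<subseteq> V" by (auto simp: W_def)
  have pW: "p \<in> W"
    using inner_form.pos[OF form nz] V by (auto simp: W_def)
  interpret W: chart_open c W using V.chart_open_subset W by blast
  define f where "f = (\<lambda>q. (?n q powr (-1/2)) *\<^sub>R ?w q)"
  have sf: "csmooth c W f"
    unfolding f_def
    by (intro W.csmooth_scaleR W.csmooth_powr csmooth_subset[OF sn W(2)] csmooth_subset[OF sw W(2)])
      (simp add: W_def)
  have o: "inner_form.orthonormal_upto (G q) (Suc k) (\<lambda>i. (e(Suc k := f)) i q)" if q: "q \<in> W" for q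
  proof -
    have qU: "q \<in> U" and qV: "q \<in> V" using q W V by auto
    interpret inner_form "G q" by (rule form[OF qU])
    have eo: "orthonormal_upto k (\<lambda>i. e i q)" using e qV by (auto simp: frame_upto_def)
    have we: "G q (?w q) (e j q) = 0" if "j \<in> {1..k}" for j
      using orthonormal_coeff[OF eo that] by (simp add: form_simps)
    have fe: "G q (f q) (e j q) = 0" "G q (e j q) (f q) = 0" if "j \<in> {1..k}" for j
      using we[OF that] sym by (auto simp: f_def form_simps)
    have n: "?n q > 0" using q by (simp add: W_def)
    have "G q (f q) (f q) = (?n q powr (-1/2) * ?n q powr (-1/2)) * ?n q"
      unfolding f_def by (simp only: bilinear_lmul[OF bilinear] bilinear_rmul[OF bilinear]) simp
    also have "?n q powr (-1/2) * ?n q powr (-1/2) = ?n q powr (-1)"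
      by (simp flip: powr_add)
    finally have ff: "G q (f q) (f q) = 1"
      using n by (simp add: powr_minus)
    show ?thesis
      unfolding orthonormal_upto_def
    proof (intro ballI)
      fix i j assume "i \<in> {1..Suc k}" "j \<in> {1..Suc k}"
      then consider "i \<in> {1..k}" "j \<in> {1..k}" | "i \<in> {1..k}" "j = Suc k"
        | "i = Suc k" "j \<in> {1..k}" | "i = Suc k" "j = Suc k" by force
      then show "G q ((e(Suc k := f)) i q) ((e(Suc k := f)) j q) = (if i = j then 1 else 0)"
      proof cases
        case 1
        then have "G q (e i q) (e j q) = (if i = j then 1 else 0)"
          using eo unfolding orthonormal_upto_def by blast
        then show ?thesis using 1 by simp
      qed (simp_all add: fe ff)
    qed
  qed
  have "csmooth c W ((e(Suc k := f)) i)" if "i \<in> {1..Suc k}" for i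
  proof (cases "i = Suc k")
    case False
    then have "csmooth c W (e i)" using csmooth_subset[OF se W(2)] that by simp
    then show ?thesis using False by simp
  qed (simp add: sf)
  with o have "frame_upto W (Suc k) (e(Suc k := f))" by (simp add: frame_upto_def)
  moreover have "\<forall>q\<in>W. \<exists>r. f q = r *\<^sub>R ?w q" by (auto simp only: f_def)
  ultimately show ?thesis using W pW by blast
qed

lemma extend_frame:
  assumes V: "open V" "V \<subseteq> U" "p \<in> V" and e: "frame_upto V k e" and kl: "k \<le> l" "l \<le> DIM('e)"
  shows "\<exists>W e'. open W \<and> W \<subseteq> V \<and> p \<in> W \<and> frame_upto W l e' \<and> (\<forall>i\<in>{1..k}. e' i = e i)"
  using kl
proof (induction l rule: dec_induct)
  case base
  show ?case
    by (rule exI[of _ V], rule exI[of _ e], intro conjI ballI) (rule V subset_refl e refl)+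
next
  case (step l)
  have "l \<le> DIM('e)" using step.prems by simp
  from step.IH[OF this] obtain W e' where W: "open W" "W \<subseteq> V" "p \<in> W" "frame_upto W l e'"
    and e': "\<forall>i\<in>{1..k}. e' i = e i" by (elim exE conjE)
  have pU: "p \<in> U" using W V by auto
  interpret inner_form "G p" by (rule form[OF pU])
  have "orthonormal_upto l (\<lambda>i. e' i p)" using W(3,4) unfolding frame_upto_def by blast
  \<comment> \<open>Some vector leaves the span of the frame at \<open>p\<close>; its constant
    extension in the chart is smooth and feeds the next step.\<close>
  from orthonormal_incomplete[OF this Suc_le_lessD[OF step.prems]]
  obtain u where "u - (\<Sum>i=1..l. G p u (e' i p) *\<^sub>R e' i p) \<noteq> 0" by (elim exE)
  from gram_schmidt_step[OF W(1) order.trans[OF W(2) V(2)] W(3,4) csmooth_const this]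
  obtain W' f where W': "open W'" "W' \<subseteq> W" "p \<in> W'" "frame_upto W' (Suc l) (e'(Suc l := f))"
    by (elim exE conjE)
  have e'': "\<forall>i\<in>{1..k}. (e'(Suc l := f)) i = e i"
  proof
    fix i assume i: "i \<in> {1..k}"
    then have "i \<noteq> Suc l" using step.hyps(1) by simp
    then have "(e'(Suc l := f)) i = e' i" by (rule fun_upd_other)
    then show "(e'(Suc l := f)) i = e i" using bspec[OF e' i] by (rule trans)
  qed
  show ?case
    by (rule exI[of _ W'], rule exI[of _ "e'(Suc l := f)"], intro conjI)
      (rule W' order.trans[OF W'(2) W(2)] e'')+
qed

lemma local_frame:
  assumes "p \<in> U"
  obtains V e where "open V" "V \<subseteq> U" "p \<in> V" "frame_upto V DIM('e) e"
proof -
  have "frame_upto U 0 (\<lambda>_ _. 0)"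
    using form by (auto simp: frame_upto_def inner_form.orthonormal_upto_def)
  from extend_frame[OF open_U order.refl assms this le0 order.refl]
  obtain V e where "open V" "V \<subseteq> U" "p \<in> V" "frame_upto V DIM('e) e" by blast
  then show ?thesis by (rule that)
qed

lemma frame_expansion:
  assumes "frame_upto V DIM('e) e" "V \<subseteq> U" "q \<in> V"
  shows "x = (\<Sum>i=1..DIM('e). G q x (e i q) *\<^sub>R e i q)"
proof -
  have q: "q \<in> U" using assms by auto
  interpret inner_form "G q" by (rule form[OF q])
  show ?thesis
    by (rule orthonormal_expansion)
      (use assms in \<open>auto simp: frame_upto_def orthonormal_upto_DIM\<close>)
qed

text \<open>The coefficients of \<open>X\<close> in a local orthonormal frame are pairings with the
  frame fields. Frames exist only locally, hence the quantification over open \<open>V\<close>.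
  Meant for fields known through their pairings: Christoffel terms and adjoints of
  \<open>d\<phi>\<close>.\<close>

lemma csmooth_dual:
  assumes "\<And>(Y :: 'a \<Rightarrow> 'e) V. open V \<Longrightarrow> V \<subseteq> U \<Longrightarrow> csmooth c V Y \<Longrightarrow> csmooth c V (\<lambda>q. G q (X q) (Y q))"
  shows "csmooth c U X"
proof (rule csmooth_local)
  fix p assume "p \<in> U"
  then obtain V e where V: "open V" "V \<subseteq> U" "p \<in> V" and e: "frame_upto V DIM('e) e"
    by (rule local_frame)
  interpret V: chart_open c V using chart_open_subset V by blast
  have se: "csmooth c V (e i)" if "i \<in> {1..DIM('e)}" for i
    using e that by (auto simp: frame_upto_def)
  have "csmooth c V X"
    by (rule V.csmooth_cong[OF frame_expansion[OF e V(2), symmetric]])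
      (assumption, intro V.csmooth_sum V.csmooth_scaleR assms[OF V(1,2)] se)
  then show "\<exists>V. open V \<and> p \<in> V \<and> V \<subseteq> U \<and> csmooth c V X" using V by blast
qed

text \<open>The fields \<open>X v\<close> below are the adjoints of \<open>F q\<close> applied to
  fixed \<open>v\<close>: they are smooth by duality and orthogonal to the kernel, since the pairing
  with \<open>u\<close> is \<open>F q u \<bullet> v\<close>. Gram-Schmidt on them gives the
  horizontal part, any orthonormal completion the vertical part by
  \<open>surj_kernel_frame\<close>.\<close>

lemma local_adapted_frame:
  fixes F :: "'a \<Rightarrow> 'e \<Rightarrow> 'f::euclidean_space"
  assumes p: "p \<in> U" and F: "\<And>q. q \<in> U \<Longrightarrow> linear (F q)" "\<And>q. q \<in> U \<Longrightarrow> surj (F q)"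
    and sF: "\<And>v. csmooth c U (\<lambda>q. F q v)"
  obtains V e where "open V" "V \<subseteq> U" "p \<in> V" "frame_upto V DIM('e) e"
    "\<And>q i w. q \<in> V \<Longrightarrow> i \<in> {1..DIM('f)} \<Longrightarrow> F q w = 0 \<Longrightarrow> G q (e i q) w = 0"
    "\<And>q s. q \<in> V \<Longrightarrow> s \<in> {DIM('f)+1..DIM('e)} \<Longrightarrow> F q (e s q) = 0"
proof -
  have nm: "DIM('f) \<le> DIM('e)"
  proof -
    have "dim (F p ` UNIV) \<le> DIM('e)"
      using dim_image_le[OF F(1)[OF p], of UNIV] by simp
    then show ?thesis using F(2)[OF p] by simp
  qed
  have "\<exists>X. csmooth c U X \<and> (\<forall>q\<in>U. \<forall>u. G q (X q) u = F q u \<bullet> v)" for v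
  proof -
    have "\<exists>x. \<forall>u. G q x u = F q u \<bullet> v" if q: "q \<in> U" for q
    proof -
      have "linear (\<lambda>u. F q u \<bullet> v)"
        using F(1)[OF q] by (auto simp: linear_iff inner_left_distrib)
      from inner_product_representation[OF inner_form.bilinear[OF form[OF q]]
          inner_form.pos[OF form[OF q]] this] show ?thesis by blast
    qed
    then obtain X where X: "\<And>q u. q \<in> U \<Longrightarrow> G q (X q) u = F q u \<bullet> v" by metis
    have "csmooth c U X"
    proof (rule csmooth_dual)
      fix Y :: "'a \<Rightarrow> 'e" and V assume V: "open V" "V \<subseteq> U" "csmooth c V Y"
      interpret V: chart_open c V using chart_open_subset V by blast
      have "csmooth c V (\<lambda>q. F q (Y q))"
        by (rule V.csmooth_linear_family) (use F V csmooth_subset[OF sF] in auto)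
      then have "csmooth c V (\<lambda>q. F q (Y q) \<bullet> v)"
        by (rule V.csmooth_bounded_linear[OF bounded_linear_inner_left])
      then show "csmooth c V (\<lambda>q. G q (X q) (Y q))"
        by (rule V.csmooth_cong[rotated]) (use X V in auto)
    qed
    with X show ?thesis by blast
  qed
  then obtain X where sX: "\<And>v. csmooth c U (X v)"
    and X: "\<And>q v u. q \<in> U \<Longrightarrow> G q (X v q) u = F q u \<bullet> v" by metis
  have "\<exists>V e. open V \<and> V \<subseteq> U \<and> p \<in> V \<and> frame_upto V k e \<and>
     (\<forall>q\<in>V. \<forall>i\<in>{1..k}. \<forall>w. F q w = 0 \<longrightarrow> G q (e i q) w = 0)" if "k \<le> DIM('f)" for k
    using that
  proof (induction k)
    case 0
    have "frame_upto U 0 (\<lambda>_ _. 0)"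
      using form by (auto simp: frame_upto_def inner_form.orthonormal_upto_def)
    then show ?case using p open_U by auto
  next
    case (Suc k)
    from Suc.IH[OF Suc_leD[OF Suc.prems]]
    obtain V e where V: "open V" "V \<subseteq> U" "p \<in> V" "frame_upto V k e"
      and h: "\<And>q i w. q \<in> V \<Longrightarrow> i \<in> {1..k} \<Longrightarrow> F q w = 0 \<Longrightarrow> G q (e i q) w = 0"
      by blast
    interpret inner_form "G p" by (rule form[OF p])
    let ?S = "(\<lambda>i. F p (e i p)) ` {1..k}"
    have "dim ?S \<le> k"
      using dim_le_card'[of ?S] card_image_le[of "{1..k}" "\<lambda>i. F p (e i p)"] by simp
    then have "dim ?S < DIM('f)" using Suc by simp
    \<comment> \<open>With \<open>v\<close> orthogonal to all \<open>F p (e i p)\<close>, the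
      adjoint \<open>X v p\<close> is orthogonal to the frame at \<open>p\<close> and equals its own
      remainder. It is nonzero because \<open>v\<close> has a preimage under the surjective
      \<open>F p\<close>.\<close>
    then obtain v where v: "v \<noteq> 0" "\<And>x. x \<in> span ?S \<Longrightarrow> orthogonal v x"
      using orthogonal_to_subspace_exists by blast
    have z: "G p (X v p) (e i p) = 0" if "i \<in> {1..k}" for i
      using v(2)[OF span_base, OF imageI[OF that]] X[OF p] by (simp add: orthogonal_def inner_commute)
    obtain u where u: "F p u = v" using F(2)[OF p] by (metis surjD)
    have "G p (X v p) u \<noteq> 0" using X[OF p] u v(1) by simp
    then have "X v p \<noteq> 0" using form_simps by auto
    moreover have "(\<Sum>i=1..k. G p (X v p) (e i p) *\<^sub>R e i p) = 0"
      by (rule sum.neutral) (use z in auto)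
    ultimately have "X v p - (\<Sum>i=1..k. G p (X v p) (e i p) *\<^sub>R e i p) \<noteq> 0" by simp
    from gram_schmidt_step[OF V csmooth_subset[OF sX V(2)] this]
    obtain W f where W: "open W" "W \<subseteq> V" "p \<in> W" "frame_upto W (Suc k) (e(Suc k := f))"
      and f: "\<And>q. q \<in> W \<Longrightarrow> \<exists>r. f q = r *\<^sub>R (X v q - (\<Sum>i=1..k. G q (X v q) (e i q) *\<^sub>R e i q))"
      by blast
    have "G q ((e(Suc k := f)) i q) w = 0" if q: "q \<in> W" and i: "i \<in> {1..Suc k}" and w: "F q w = 0" for q i w
    proof (cases "i = Suc k")
      case True
      have qU: "q \<in> U" and qV: "q \<in> V" using q W V by auto
      interpret q: inner_form "G q" by (rule form[OF qU])
      obtain r where r: "f q = r *\<^sub>R (X v q - (\<Sum>i=1..k. G q (X v q) (e i q) *\<^sub>R e i q))"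
        using f[OF q] by auto
      have "G q (X v q) w = 0" using X[OF qU] w by simp
      moreover have "G q (\<Sum>i=1..k. G q (X v q) (e i q) *\<^sub>R e i q) w = 0"
        unfolding q.sum_left by (rule sum.neutral) (use h[OF qV _ w] in \<open>simp add: q.form_simps\<close>)
      ultimately show ?thesis by (simp add: True r q.form_simps)
    next
      case False
      then show ?thesis using h[of q i w] that W by auto
    qed
    then have "\<forall>q\<in>W. \<forall>i\<in>{1..Suc k}. \<forall>w. F q w = 0 \<longrightarrow> G q ((e(Suc k := f)) i q) w = 0"
      by blast
    moreover have "W \<subseteq> U" using W(2) V(2) by blast
    ultimately show ?case using W by blast
  qed
  from this[of "DIM('f)"] obtain V e where V: "open V" "V \<subseteq> U" "p \<in> V" "frame_upto V DIM('f) e"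
      and h: "\<And>q i w. q \<in> V \<Longrightarrow> i \<in> {1..DIM('f)} \<Longrightarrow> F q w = 0 \<Longrightarrow> G q (e i q) w = 0" by blast
  from extend_frame[OF V nm order.refl] obtain W e' where W: "open W" "W \<subseteq> V" "p \<in> W"
    "frame_upto W DIM('e) e'" and e': "\<forall>i\<in>{1..DIM('f)}. e' i = e i" by auto
  have h': "G q (e' i q) w = 0" if "q \<in> W" "i \<in> {1..DIM('f)}" "F q w = 0" for q i w
    using h[of q i w] that e' W by auto
  moreover have "F q (e' s q) = 0" if q: "q \<in> W" and s: "s \<in> {DIM('f)+1..DIM('e)}" for q s
  proof -
    have qU: "q \<in> U" using q W V by auto
    interpret q: inner_form "G q" by (rule form[OF qU])
    have "orthonormal (G q) (\<lambda>i. e' i q)"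
      using W(4) q by (auto simp: frame_upto_def q.orthonormal_upto_DIM)
    from q.surj_kernel_frame[OF F[OF qU] this _ s] h'[OF q] show ?thesis by blast
  qed
  ultimately show ?thesis using that[of W e'] W V by blast
qed

end

section \<open>Christoffel symbols and curvature\<close>

locale riemannian_chart =
  fixes A :: "('a::{t2_space, second_countable_topology}, 'e::euclidean_space) chart set"
    and g :: "('a, 'e) metric" and c :: "('a, 'e) chart" and U :: "'a set"
  assumes manifold: "riemannian_manifold A g" and c: "c \<in> A"
    and region: "open U" "U \<subseteq> cdom c"
begin

lemma in_cdom: "p \<in> U \<Longrightarrow> p \<in> cdom c" using region by auto

sublocale metric_chart c U "\<lambda>q. g q c"
proof (intro metric_chart.intro chart_open.intro metric_chart_axioms.intro)
  show "is_chart c" using manifold c by (auto simp: riemannian_manifold_def smooth_atlas_def)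
  show "open U" "U \<subseteq> cdom c" by (rule region)+
  show "inner_form (g q c)" if "q \<in> U" for q
    using metricD[OF manifold c in_cdom[OF that]] by unfold_locales auto
  show "csmooth c U (\<lambda>q. g q c u v)" for u v
    by (rule csmooth_subset[OF _ region(2)])
      (use manifold c in \<open>auto simp: csmooth_def riemannian_manifold_def riemannian_metric_def\<close>)
qed

abbreviation \<Gamma> :: "'a \<Rightarrow> 'e \<Rightarrow> 'e \<Rightarrow> 'e" where "\<Gamma> p \<equiv> christoffel g p c"

lemma \<Gamma>_sym: "p \<in> U \<Longrightarrow> \<Gamma> p u v = \<Gamma> p v u"
  using christoffel_sym[OF manifold c in_cdom] .

abbreviation koszul_rhs :: "'a \<Rightarrow> 'e \<Rightarrow> 'e \<Rightarrow> 'e \<Rightarrow> real" where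
  "koszul_rhs p u v z \<equiv> dir_deriv c (\<lambda>q. g q c v z) p u
     + dir_deriv c (\<lambda>q. g q c u z) p v - dir_deriv c (\<lambda>q. g q c u v) p z"

lemma linear_koszul_rhs:
  assumes p: "p \<in> U"
  shows "linear (\<lambda>v. koszul_rhs p u v z)" "linear (\<lambda>z. koszul_rhs p u v z)"
proof -
  have r: "linear (\<lambda>z. dir_deriv c (\<lambda>q. g q c v z) p u)" for u v
    by (rule dir_deriv_metric_linear[OF manifold c in_cdom[OF p]])
  have s: "dir_deriv c (\<lambda>q. g q c v z) p = dir_deriv c (\<lambda>q. g q c z v) p" for v z
    by (rule dir_deriv_cong[OF p]) (simp add: inner_form.sym[OF form])
  have l: "linear (\<lambda>v. dir_deriv c (\<lambda>q. g q c v z) p u)" for u z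
    using r[of z u] by (simp add: s[of z])
  have d: "linear (dir_deriv c (\<lambda>q. g q c u v) p)" for u v
    by (rule linear_dir_deriv[OF csmooth_form p])
  show "linear (\<lambda>v. koszul_rhs p u v z)" "linear (\<lambda>z. koszul_rhs p u v z)"
    by (intro linear_compose_sub linear_compose_add r l d)+
qed

text \<open>Nondegeneracy of the metric transfers linearity of the Koszul expression in its second
  argument to \<open>\<Gamma>\<close>; the first argument follows by symmetry.\<close>

lemma bilinear_\<Gamma>:
  assumes p: "p \<in> U" shows "bilinear (\<Gamma> p)"
proof -
  interpret inner_form "g p c" by (rule form[OF p])
  note k = koszul[OF manifold c in_cdom[OF p]]
  have l: "linear (\<Gamma> p u)" for u
  proof (rule linearI)
    fix v w
    show "\<Gamma> p u (v + w) = \<Gamma> p u v + \<Gamma> p u w"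
    proof (rule form_eqI)
      fix z
      have "2 * g p c (\<Gamma> p u (v + w)) z = 2 * g p c (\<Gamma> p u v) z + 2 * g p c (\<Gamma> p u w) z"
        unfolding k using linear_add[OF linear_koszul_rhs(1)[OF p]] .
      then show "g p c (\<Gamma> p u (v + w)) z = g p c (\<Gamma> p u v + \<Gamma> p u w) z"
        by (simp add: form_simps)
    qed
  next
    fix r v
    show "\<Gamma> p u (r *\<^sub>R v) = r *\<^sub>R \<Gamma> p u v"
    proof (rule form_eqI)
      fix z
      have "2 * g p c (\<Gamma> p u (r *\<^sub>R v)) z = r *\<^sub>R (2 * g p c (\<Gamma> p u v) z)"
        unfolding k using linear_scale[OF linear_koszul_rhs(1)[OF p]] .
      then show "g p c (\<Gamma> p u (r *\<^sub>R v)) z = g p c (r *\<^sub>R \<Gamma> p u v) z"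
        by (simp add: form_simps)
    qed
  qed
  moreover have "linear (\<lambda>u. \<Gamma> p u v)" for v
  proof -
    have "(\<lambda>u. \<Gamma> p u v) = \<Gamma> p v" by (rule ext) (rule \<Gamma>_sym[OF p])
    then show ?thesis using l[of v] by simp
  qed
  ultimately show ?thesis by (simp add: bilinear_def)
qed

lemma linear_\<Gamma>:
  assumes "p \<in> U" shows "linear (\<Gamma> p u)" "linear (\<lambda>u. \<Gamma> p u v)"
  using bilinear_\<Gamma>[OF assms] by (auto simp: bilinear_def)

text \<open>The Koszul formula gives \<open>\<Gamma>\<close> through its pairings, which are smooth;
  \<open>csmooth_dual\<close> then replaces inverting the metric.\<close>

lemma csmooth_\<Gamma>: "csmooth c U (\<lambda>q. \<Gamma> q u v)"
proof (rule csmooth_dual)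
  fix Y :: "'a \<Rightarrow> 'e" and V assume V: "open V" "V \<subseteq> U" "csmooth c V Y"
  interpret V: chart_open c V using chart_open_subset V by blast
  have "csmooth c V (\<lambda>q. koszul_rhs q u v (Y q))"
  proof (rule V.csmooth_linear_family[where L = "\<lambda>q. koszul_rhs q u v"])
    show "linear (koszul_rhs q u v)" if "q \<in> V" for q
      using linear_koszul_rhs(2) that V(2) by blast
    show "csmooth c V (\<lambda>q. koszul_rhs q u v z)" for z
      by (intro V.csmooth_diff V.csmooth_add V.csmooth_dir_deriv csmooth_const
          csmooth_subset[OF csmooth_form V(2)])
  qed (rule V)
  then have "csmooth c V (\<lambda>q. (1/2) *\<^sub>R koszul_rhs q u v (Y q))"
    by (rule V.csmooth_bounded_linear[OF bounded_linear_scaleR_right])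
  then show "csmooth c V (\<lambda>q. g q c (\<Gamma> q u v) (Y q))"
  proof (rule V.csmooth_cong[rotated])
    fix q assume "q \<in> V"
    then have "q \<in> cdom c" using V(2) in_cdom by auto
    from koszul[OF manifold c this, of u v "Y q"]
    show "(1/2) *\<^sub>R koszul_rhs q u v (Y q) = g q c (\<Gamma> q u v) (Y q)"
      by simp
  qed
qed

lemma csmooth_\<Gamma>_fields: "csmooth c U X \<Longrightarrow> csmooth c U Y \<Longrightarrow> csmooth c U (\<lambda>q. \<Gamma> q (X q) (Y q))"
  by (rule csmooth_bilinear_family[OF bilinear_\<Gamma> csmooth_\<Gamma>])

lemma dir_deriv_form:
  assumes p: "p \<in> U"
  shows "dir_deriv c (\<lambda>q. g q c v w) p u = g p c (\<Gamma> p u v) w + g p c v (\<Gamma> p u w)"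
  using nabla_metric[OF manifold c in_cdom[OF p], of "const_field v" "const_field w" "const_field u"]
  by (simp add: nabla_def)

text \<open>The direction is a single vector at \<open>p\<close> because the covariant derivative is
  tensorial in it.\<close>

definition covD :: "'a \<Rightarrow> 'e \<Rightarrow> ('a \<Rightarrow> 'e) \<Rightarrow> 'e" where
  "covD p u Y = dir_deriv c Y p u + \<Gamma> p u (Y p)"

lemma nabla_eq_covD: "nabla g X Y p c = covD p (X p c) (\<lambda>q. Y q c)"
  by (simp add: nabla_def covD_def)

lemma csmooth_covD: "csmooth c U X \<Longrightarrow> csmooth c U Y \<Longrightarrow> csmooth c U (\<lambda>q. covD q (X q) Y)"
  unfolding covD_def by (intro csmooth_add csmooth_dir_deriv csmooth_\<Gamma>_fields)

lemma linear_covD: "csmooth c U Y \<Longrightarrow> p \<in> U \<Longrightarrow> linear (\<lambda>u. covD p u Y)"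
  unfolding covD_def by (intro linear_compose_add linear_dir_deriv linear_\<Gamma>)

lemma covD_cong:
  "p \<in> U \<Longrightarrow> (\<And>q. q \<in> U \<Longrightarrow> Y q = Y' q) \<Longrightarrow> covD p u Y = covD p u Y'"
  using dir_deriv_cong[of p Y Y'] by (simp add: covD_def)

lemma dir_deriv_form_fields:
  assumes X: "csmooth c U X" and Y: "csmooth c U Y" and p: "p \<in> U"
  shows "dir_deriv c (\<lambda>q. g q c (X q) (Y q)) p u = g p c (covD p u X) (Y p) + g p c (X p) (covD p u Y)"
proof -
  interpret inner_form "g p c" by (rule form[OF p])
  have "dir_deriv c (\<lambda>q. g q c (X q) (Y q)) p u =
      dir_deriv c (\<lambda>q. g q c (X p) (Y p)) p u + g p c (dir_deriv c X p u) (Y p) + g p c (X p) (dir_deriv c Y p u)"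
    by (rule dir_deriv_bilinear_family[OF inner_form.bilinear[OF form] csmooth_form X Y p])
  then show ?thesis by (simp add: dir_deriv_form[OF p] covD_def form_simps)
qed

text \<open>Constant coordinate fields have zero bracket, which removes the third curvature term,
  and the derivative of one along another is a Christoffel term.\<close>

lemma curvature_at_eq:
  assumes p: "p \<in> U"
  shows "curvature_at g p c u v w = covD p u (\<lambda>q. \<Gamma> q v w) - covD p v (\<lambda>q. \<Gamma> q u w)"
proof -
  have 0: "\<Gamma> p 0 w = 0" using linear_0[OF linear_\<Gamma>(2)[OF p]] .
  have "nabla g (const_field v) (const_field w) q c = \<Gamma> q v w" for v q
    by (simp add: nabla_def)
  moreover have "nabla g (lie_bracket (const_field u) (const_field v)) (const_field w) p c = 0"
    by (simp add: nabla_def lie_bracket_def 0)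
  ultimately show ?thesis
    by (simp add: curvature_at_def curvature_def nabla_eq_covD)
qed

lemma curvature_at_antisym:
  assumes "p \<in> U" shows "curvature_at g p c u v w = - curvature_at g p c v u w"
  by (simp add: curvature_at_eq[OF assms])

lemma linear_covD_\<Gamma>:
  assumes p: "p \<in> U"
  shows "linear (\<lambda>v. covD p u (\<lambda>q. \<Gamma> q v w))" "linear (\<lambda>w. covD p u (\<lambda>q. \<Gamma> q v w))"
proof -
  \<comment> \<open>Stated for any smooth family of linear maps, so that one argument covers both
    slots of \<open>\<Gamma>\<close>.\<close>
  have 1: "linear (\<lambda>x. covD p u (\<lambda>q. L q x))"
    if L: "\<And>q. q \<in> U \<Longrightarrow> linear (L q)" and s: "\<And>x. csmooth c U (\<lambda>q. L q x)" for L :: "'a \<Rightarrow> 'e \<Rightarrow> 'e"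
  proof (rule linearI)
    fix x y
    have "covD p u (\<lambda>q. L q (x + y)) = covD p u (\<lambda>q. L q x + L q y)"
      by (rule covD_cong[OF p]) (rule linear_add[OF L])
    then show "covD p u (\<lambda>q. L q (x + y)) = covD p u (\<lambda>q. L q x) + covD p u (\<lambda>q. L q y)"
      by (simp add: covD_def dir_deriv_add[OF s s p] linear_add[OF linear_\<Gamma>(1)[OF p]])
  next
    fix r x
    have "covD p u (\<lambda>q. L q (r *\<^sub>R x)) = covD p u (\<lambda>q. r *\<^sub>R L q x)"
      by (rule covD_cong[OF p]) (rule linear_scale[OF L])
    then show "covD p u (\<lambda>q. L q (r *\<^sub>R x)) = r *\<^sub>R covD p u (\<lambda>q. L q x)"
      by (simp add: covD_def dir_deriv_scaleR_const[OF s p] linear_scale[OF linear_\<Gamma>(1)[OF p]]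
          scaleR_right_distrib)
  qed
  show "linear (\<lambda>v. covD p u (\<lambda>q. \<Gamma> q v w))" "linear (\<lambda>w. covD p u (\<lambda>q. \<Gamma> q v w))"
    by (rule 1; rule linear_\<Gamma> csmooth_\<Gamma>; assumption?)+
qed

lemma linear_curvature_at:
  assumes p: "p \<in> U"
  shows "linear (\<lambda>u. curvature_at g p c u v w)" "linear (\<lambda>v. curvature_at g p c u v w)"
    "linear (\<lambda>w. curvature_at g p c u v w)"
  unfolding curvature_at_eq[OF p]
  by (intro linear_compose_sub linear_covD_\<Gamma>[OF p] linear_covD[OF csmooth_\<Gamma> p])+

end

section \<open>Submersions in a pair of charts\<close>

locale submersion_chart =
  fixes A :: "('a::{t2_space, second_countable_topology}, 'e::euclidean_space) chart set"
    and g :: "('a, 'e) metric"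
    and B :: "('b::{t2_space, second_countable_topology}, 'f::euclidean_space) chart set"
    and h :: "('b, 'f) metric"
    and \<phi> :: "'a \<Rightarrow> 'b" and c :: "('a, 'e) chart" and d :: "('b, 'f) chart" and U :: "'a set"
  assumes M: "riemannian_manifold A g" and N: "riemannian_manifold B h"
    and submersion: "riemannian_submersion A g B h \<phi>"
    and c: "c \<in> A" and d: "d \<in> B"
    and open_U: "open U" and U: "U \<subseteq> cdom c" "\<phi> ` U \<subseteq> cdom d"
begin

sublocale riemannian_chart A g c U
  using M c open_U U by unfold_locales

sublocale N: riemannian_chart B h d "cdom d"
  using N d by unfold_locales (auto simp: riemannian_manifold_def smooth_atlas_def is_chart_def)

abbreviation d\<phi> :: "'a \<Rightarrow> 'e \<Rightarrow> 'f" where "d\<phi> p \<equiv> dmap \<phi> p c d"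

lemma \<phi>_mem: "p \<in> U \<Longrightarrow> \<phi> p \<in> cdom d" using U by auto

lemma csmooth_\<phi>: "csmooth c U (\<lambda>q. coord d (\<phi> q))"
proof -
  have "smooth_on (coord c ` (cdom c \<inter> \<phi> -` cdom d)) (coord d \<circ> \<phi> \<circ> cinv c)"
    using submersion c d by (auto simp: riemannian_submersion_def smooth_map_def)
  then have "csmooth c (cdom c \<inter> \<phi> -` cdom d) (\<lambda>q. coord d (\<phi> q))"
    by (simp add: csmooth_def o_def)
  then show ?thesis by (rule csmooth_subset) (use U in auto)
qed

lemma linear_d\<phi>: "p \<in> U \<Longrightarrow> linear (d\<phi> p)"
  unfolding dmap_eq_dir_deriv by (rule linear_dir_deriv[OF csmooth_\<phi>])

lemma csmooth_d\<phi>: "csmooth c U X \<Longrightarrow> csmooth c U (\<lambda>q. d\<phi> q (X q))"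
  unfolding dmap_eq_dir_deriv by (rule csmooth_dir_deriv[OF csmooth_\<phi>])

lemma surj_d\<phi>: "p \<in> U \<Longrightarrow> surj (d\<phi> p)"
  using submersion c d U unfolding riemannian_submersion_def by blast

lemmas pullback = csmooth_pullback[OF chart_open_axioms N.chart_open_axioms U(2) csmooth_\<phi>]
  dir_deriv_pullback[OF chart_open_axioms N.chart_open_axioms U(2) csmooth_\<phi>]

text \<open>\<open>vertical\<close> quantifies over all charts of N around the image point. In
  another chart \<open>d'\<close> the differential is the one in \<open>d\<close> followed by the
  differential of the change of charts, so vanishing in \<open>d\<close> suffices.\<close>

lemma vertical_iff:
  assumes p: "p \<in> U" shows "vertical B \<phi> p c w \<longleftrightarrow> d\<phi> p w = 0"
proof -
  have "dmap \<phi> p c d' w = 0" if w: "d\<phi> p w = 0" and d': "d' \<in> B" "\<phi> p \<in> cdom d'" for d'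
  proof -
    let ?V = "cdom d \<inter> cdom d'" and ?W = "U \<inter> \<phi> -` cdom d'"
    have At: "smooth_atlas B" using N by (simp add: riemannian_manifold_def)
    have o': "open (cdom d')" using At d' by (auto simp: smooth_atlas_def is_chart_def)
    have "continuous_on UNIV \<phi>"
      using submersion by (simp add: riemannian_submersion_def smooth_map_def)
    then have "open (\<phi> -` cdom d')" using o' open_vimage by blast
    then have W: "open ?W" "?W \<subseteq> U" using open_U by auto
    have V: "chart_open d ?V"
      by (rule N.chart_open_subset) (use o' N.open_U in auto)
    have "csmooth d ?V (coord d')"
      using At d d' by (auto simp: csmooth_def smooth_atlas_def o_def)
    from dir_deriv_pullback[OF chart_open_subset[OF W] V _ csmooth_subset[OF csmooth_\<phi> W(2)] this]
    have "dmap \<phi> p c d' w = dir_deriv d (coord d') (\<phi> p) (d\<phi> p w)"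
      using p d' U(2) by (auto simp: dmap_eq_dir_deriv)
    moreover have "linear (dir_deriv d (coord d') (\<phi> p))"
      by (rule chart_open.linear_dir_deriv[OF V]) (use \<open>csmooth d ?V _\<close> p d' U in auto)
    ultimately show ?thesis using w by (simp add: linear_0)
  qed
  then show ?thesis using d \<phi>_mem[OF p] unfolding vertical_def by blast
qed

lemma horizontal_iff:
  "p \<in> U \<Longrightarrow> horizontal g B \<phi> p c u \<longleftrightarrow> (\<forall>w. d\<phi> p w = 0 \<longrightarrow> g p c u w = 0)"
  by (simp add: horizontal_def vertical_iff)

lemma isometry:
  assumes "p \<in> U" "horizontal g B \<phi> p c u" "horizontal g B \<phi> p c v"
  shows "h (\<phi> p) d (d\<phi> p u) (d\<phi> p v) = g p c u v"
  using submersion c d U assms unfolding riemannian_submersion_def by blast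

section \<open>Pull-back connection, second fundamental form, second covariant derivative\<close>

definition pbD :: "'a \<Rightarrow> 'e \<Rightarrow> ('a \<Rightarrow> 'f) \<Rightarrow> 'f" where
  "pbD p u s = dir_deriv c s p u + N.\<Gamma> (\<phi> p) (d\<phi> p u) (s p)"

lemma pb_nabla_eq_pbD: "pb_nabla h \<phi> X V p c d = pbD p (X p c) (\<lambda>q. V q c d)"
  by (simp add: pb_nabla_def pbD_def)

lemma csmooth_pbD:
  assumes X: "csmooth c U X" and s: "csmooth c U s"
  shows "csmooth c U (\<lambda>q. pbD q (X q) s)"
  unfolding pbD_def
proof (intro csmooth_add csmooth_dir_deriv X s)
  show "csmooth c U (\<lambda>q. N.\<Gamma> (\<phi> q) (d\<phi> q (X q)) (s q))"
    by (rule csmooth_bilinear_family[where T = "\<lambda>q. N.\<Gamma> (\<phi> q)"])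
      (auto intro: N.bilinear_\<Gamma> \<phi>_mem pullback(1)[OF N.csmooth_\<Gamma>] csmooth_d\<phi> X s)
qed

lemma linear_pbD:
  assumes "csmooth c U s" "p \<in> U" shows "linear (\<lambda>u. pbD p u s)"
  unfolding pbD_def
  by (intro linear_compose_add linear_dir_deriv assms)
    (use linear_compose[OF linear_d\<phi>[OF assms(2)] N.linear_\<Gamma>(2)[OF \<phi>_mem[OF assms(2)]]] in \<open>simp add: o_def\<close>)

lemma pbD_cong:
  "p \<in> U \<Longrightarrow> (\<And>q. q \<in> U \<Longrightarrow> s q = s' q) \<Longrightarrow> pbD p u s = pbD p u s'"
  using dir_deriv_cong[of p s s'] by (simp add: pbD_def)

lemma pbD_add:
  assumes "csmooth c U s" "csmooth c U s'" "p \<in> U"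
  shows "pbD p u (\<lambda>q. s q + s' q) = pbD p u s + pbD p u s'"
  by (simp add: pbD_def dir_deriv_add[OF assms] linear_add[OF N.linear_\<Gamma>(1)[OF \<phi>_mem[OF assms(3)]]])

lemma pbD_scale:
  assumes "csmooth c U s" "p \<in> U"
  shows "pbD p u (\<lambda>q. r *\<^sub>R s q) = r *\<^sub>R pbD p u s"
  by (simp add: pbD_def dir_deriv_scaleR_const[OF assms]
      linear_scale[OF N.linear_\<Gamma>(1)[OF \<phi>_mem[OF assms(2)]]] scaleR_right_distrib)

lemma pbD_0: "p \<in> U \<Longrightarrow> pbD p u (\<lambda>q. 0) = 0"
  using pbD_scale[OF csmooth_const, of p u 0 0] by simp

text \<open>By the chain rule both terms of \<open>pbD\<close> depend on \<open>u\<close> only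
  through \<open>d\<phi> p u\<close>.\<close>

lemma pbD_along_\<phi>:
  assumes Y: "csmooth d (cdom d) Y" and p: "p \<in> U" and u: "d\<phi> p u = 0"
  shows "pbD p u (\<lambda>q. Y (\<phi> q)) = 0"
  using linear_0[OF N.linear_\<Gamma>(2)[OF \<phi>_mem[OF p]]] linear_0[OF N.linear_dir_deriv[OF Y \<phi>_mem[OF p]]]
  by (simp add: pbD_def pullback(2)[OF Y p] u)

lemma pbD_metric:
  assumes s: "csmooth c U s" and t: "csmooth c U t" and p: "p \<in> U"
  shows "dir_deriv c (\<lambda>q. h (\<phi> q) d (s q) (t q)) p u
    = h (\<phi> p) d (pbD p u s) (t p) + h (\<phi> p) d (s p) (pbD p u t)"
proof -
  interpret h: inner_form "h (\<phi> p) d" by (rule N.form[OF \<phi>_mem[OF p]])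
  have "dir_deriv c (\<lambda>q. h (\<phi> q) d (s q) (t q)) p u =
      dir_deriv c (\<lambda>q. h (\<phi> q) d (s p) (t p)) p u
      + h (\<phi> p) d (dir_deriv c s p u) (t p) + h (\<phi> p) d (s p) (dir_deriv c t p u)"
    by (rule dir_deriv_bilinear_family[OF inner_form.bilinear[OF N.form[OF \<phi>_mem]] pullback(1)[OF N.csmooth_form] s t p])
  also have "dir_deriv c (\<lambda>q. h (\<phi> q) d (s p) (t p)) p u =
      dir_deriv d (\<lambda>x. h x d (s p) (t p)) (\<phi> p) (d\<phi> p u)"
    by (rule pullback(2)[OF N.csmooth_form p])
  finally show ?thesis
    by (simp add: N.dir_deriv_form[OF \<phi>_mem[OF p]] pbD_def h.form_simps)
qed

definition sff :: "'a \<Rightarrow> 'e \<Rightarrow> 'e \<Rightarrow> 'f" where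
  "sff p u v = pbD p u (\<lambda>q. d\<phi> q v) - d\<phi> p (\<Gamma> p u v)"

lemma second_fundamental_form_eq: "second_fundamental_form g h \<phi> p c d = sff p"
  by (intro ext) (simp add: second_fundamental_form_def sff_def pb_nabla_eq_pbD nabla_def)

text \<open>Second derivatives of the coordinate expression of \<phi> commute, and neither
  connection has torsion.\<close>

lemma sff_sym: assumes p: "p \<in> U" shows "sff p u v = sff p v u"
proof -
  have "dir_deriv c (\<lambda>q. d\<phi> q v) p u = dir_deriv c (\<lambda>q. d\<phi> q u) p v"
    unfolding dmap_eq_dir_deriv by (rule dir_deriv_commute[OF csmooth_\<phi> p])
  then show ?thesis
    by (simp add: sff_def pbD_def \<Gamma>_sym[OF p, of u v] N.\<Gamma>_sym[OF \<phi>_mem[OF p], of "d\<phi> p u" "d\<phi> p v"])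
qed

lemma bilinear_sff: assumes p: "p \<in> U" shows "bilinear (sff p)"
proof -
  have l: "linear (\<lambda>u. sff p u v)" for v
    unfolding sff_def
    by (intro linear_compose_sub linear_pbD csmooth_d\<phi> csmooth_const p
        linear_compose[OF linear_\<Gamma>(2)[OF p] linear_d\<phi>[OF p], unfolded o_def])
  moreover have "linear (sff p v)" for v
  proof -
    have eq: "sff p v = (\<lambda>u. sff p u v)" by (rule ext) (rule sff_sym[OF p])
    show ?thesis unfolding eq by (rule l)
  qed
  ultimately show ?thesis by (simp add: bilinear_def)
qed

text \<open>\<open>sff\<close> is defined with a constant second field; the Leibniz rule for
  \<open>d\<phi>\<close> admits an arbitrary \<open>Y\<close>, the difference being absorbed by
  \<open>covD\<close>.\<close>

lemma pbD_d\<phi>: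
  assumes Y: "csmooth c U Y" and p: "p \<in> U"
  shows "pbD p u (\<lambda>q. d\<phi> q (Y q)) = d\<phi> p (covD p u Y) + sff p u (Y p)"
proof -
  have "dir_deriv c (\<lambda>q. d\<phi> q (Y q)) p u =
      dir_deriv c (\<lambda>q. d\<phi> q (Y p)) p u + d\<phi> p (dir_deriv c Y p u)"
    by (rule dir_deriv_linear_family[OF linear_d\<phi> csmooth_d\<phi>[OF csmooth_const] Y p])
  then show ?thesis
    by (simp add: pbD_def sff_def covD_def linear_add[OF linear_d\<phi>[OF p]])
qed

text \<open>The second covariant derivative of a section: \<open>v\<close> is extended by a constant
  field, whose covariant derivative along \<open>u\<close> is \<open>\<Gamma> p u v\<close>. Its
  metric trace is minus \<open>pb_laplacian\<close>.\<close>

definition hess :: "'a \<Rightarrow> ('a \<Rightarrow> 'f) \<Rightarrow> 'e \<Rightarrow> 'e \<Rightarrow> 'f" where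
  "hess p s u v = pbD p u (\<lambda>q. pbD q v s) - pbD p (\<Gamma> p u v) s"

lemma hess_cong:
  assumes p: "p \<in> U" and s: "\<And>q. q \<in> U \<Longrightarrow> s q = s' q"
  shows "hess p s u v = hess p s' u v"
proof -
  have "pbD p u (\<lambda>q. pbD q v s) = pbD p u (\<lambda>q. pbD q v s')"
    by (rule pbD_cong[OF p]) (rule pbD_cong[OF _ s])
  then show ?thesis using pbD_cong[OF p s] by (simp add: hess_def)
qed

lemma hess_scale:
  assumes s: "csmooth c U s" and p: "p \<in> U"
  shows "hess p (\<lambda>q. r *\<^sub>R s q) u v = r *\<^sub>R hess p s u v"
proof -
  have "pbD p u (\<lambda>q. pbD q v (\<lambda>q. r *\<^sub>R s q)) = pbD p u (\<lambda>q. r *\<^sub>R pbD q v s)"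
    by (rule pbD_cong[OF p]) (rule pbD_scale[OF s])
  also have "\<dots> = r *\<^sub>R pbD p u (\<lambda>q. pbD q v s)"
    by (rule pbD_scale[OF csmooth_pbD[OF csmooth_const s] p])
  finally show ?thesis
    by (simp add: hess_def pbD_scale[OF s p] scaleR_right_diff_distrib)
qed

text \<open>Replacing the constant extension of \<open>X p\<close> by the field \<open>X\<close>
  changes both terms by \<open>pbD p (dir_deriv c X p u) s\<close>, which cancels. This permits
  evaluation on frame fields.\<close>

lemma hess_fields:
  assumes X: "csmooth c U X" and s: "csmooth c U s" and p: "p \<in> U"
  shows "hess p s u (X p) = pbD p u (\<lambda>q. pbD q (X q) s) - pbD p (covD p u X) s"
proof -
  have "dir_deriv c (\<lambda>q. pbD q (X q) s) p u =
      dir_deriv c (\<lambda>q. pbD q (X p) s) p u + pbD p (dir_deriv c X p u) s"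
    by (rule dir_deriv_linear_family[OF linear_pbD[OF s] csmooth_pbD[OF csmooth_const s] X p])
  then have "pbD p u (\<lambda>q. pbD q (X q) s) = pbD p u (\<lambda>q. pbD q (X p) s) + pbD p (dir_deriv c X p u) s"
    by (simp add: pbD_def[of p u])
  then show ?thesis
    by (simp add: hess_def covD_def linear_add[OF linear_pbD[OF s p]])
qed

lemma bilinear_hess:
  assumes s: "csmooth c U s" and p: "p \<in> U" shows "bilinear (hess p s)"
proof -
  note pl = linear_pbD[OF s]
  note sm = csmooth_pbD[OF csmooth_const s]
  have "linear (\<lambda>u. hess p s u v)" for v
    unfolding hess_def
    by (intro linear_compose_sub linear_pbD[OF sm p]
        linear_compose[OF linear_\<Gamma>(2)[OF p] pl[OF p], unfolded o_def])
  moreover have "linear (hess p s u)" for u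
  proof (rule linearI)
    fix v w
    have "pbD p u (\<lambda>q. pbD q (v + w) s) = pbD p u (\<lambda>q. pbD q v s + pbD q w s)"
      by (rule pbD_cong[OF p]) (rule linear_add[OF pl])
    then show "hess p s u (v + w) = hess p s u v + hess p s u w"
      by (simp add: hess_def pbD_add[OF sm sm p] linear_add[OF linear_\<Gamma>(1)[OF p]] linear_add[OF pl[OF p]])
  next
    fix r v
    have "pbD p u (\<lambda>q. pbD q (r *\<^sub>R v) s) = pbD p u (\<lambda>q. r *\<^sub>R pbD q v s)"
      by (rule pbD_cong[OF p]) (rule linear_scale[OF pl])
    then show "hess p s u (r *\<^sub>R v) = r *\<^sub>R hess p s u v"
      by (simp add: hess_def pbD_scale[OF sm p] linear_scale[OF linear_\<Gamma>(1)[OF p]]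
          linear_scale[OF pl[OF p]] scaleR_right_diff_distrib)
  qed
  ultimately show ?thesis by (simp add: bilinear_def)
qed

lemma pb_laplacian_eq:
  "pb_laplacian g h \<phi> V p c d = - metric_trace (g p c) (hess p (\<lambda>q. V q c d))"
  by (simp add: pb_laplacian_def pb_nabla_eq_pbD hess_def[abs_def] nabla_def)

lemma tension_eq: "tension g h \<phi> p c d = metric_trace (g p c) (sff p)"
  by (simp add: tension_def second_fundamental_form_eq)

end

section \<open>Adapted frames and the bitension field\<close>

locale adapted_chart = submersion_chart A g B h \<phi> c d U
  for A :: "('a::{t2_space, second_countable_topology}, 'e::euclidean_space) chart set"
    and g :: "('a, 'e) metric"
    and B :: "('b::{t2_space, second_countable_topology}, 'f::euclidean_space) chart set"
    and h :: "('b, 'f) metric"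
    and \<phi> :: "'a \<Rightarrow> 'b" and c :: "('a, 'e) chart" and d :: "('b, 'f) chart" and U :: "'a set" +
  fixes e :: "nat \<Rightarrow> 'a \<Rightarrow> 'e"
  assumes less: "DIM('f) < DIM('e)"
    and csmooth_e: "i \<in> {1..DIM('e)} \<Longrightarrow> csmooth c U (e i)"
    and orthonormal_e: "q \<in> U \<Longrightarrow> orthonormal (g q c) (\<lambda>i. e i q)"
    and horizontal_e: "q \<in> U \<Longrightarrow> i \<in> {1..DIM('f)} \<Longrightarrow> horizontal g B \<phi> q c (e i q)"
    and vertical_e: "q \<in> U \<Longrightarrow> s \<in> {DIM('f)+1..DIM('e)} \<Longrightarrow> d\<phi> q (e s q) = 0"
begin

lemma H_mem: "i \<in> {1..DIM('f)} \<Longrightarrow> i \<in> {1..DIM('e)}" using less by auto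
lemma V_mem: "i \<in> {DIM('f)+1..DIM('e)} \<Longrightarrow> i \<in> {1..DIM('e)}" by auto

lemma sum_H_V: "(\<Sum>i=1..DIM('e). f i) = (\<Sum>i\<in>{1..DIM('f)}. f i) + (\<Sum>i\<in>{DIM('f)+1..DIM('e)}. f i)"
proof -
  have u: "{1..DIM('e)} = {1..DIM('f)} \<union> {DIM('f)+1..DIM('e)}" using less by auto
  show ?thesis unfolding u by (rule sum.union_disjoint) auto
qed

text \<open>A frame formula for \<open>hor\<close>: it shows smoothness in \<open>q\<close>, which
  the definite description hides.\<close>

definition hproj :: "'a \<Rightarrow> 'e \<Rightarrow> 'e" where
  "hproj q x = (\<Sum>i\<in>{1..DIM('f)}. g q c x (e i q) *\<^sub>R e i q)"

lemma horizontal_hproj: assumes q: "q \<in> U" shows "horizontal g B \<phi> q c (hproj q x)"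
proof -
  interpret inner_form "g q c" by (rule form[OF q])
  have "g q c (hproj q x) w = 0" if "d\<phi> q w = 0" for w
    unfolding hproj_def sum_left
    by (rule sum.neutral) (use horizontal_e[OF q] that in \<open>auto simp: horizontal_iff[OF q] form_simps\<close>)
  then show ?thesis by (simp add: horizontal_iff[OF q])
qed

lemma d\<phi>_sum: "q \<in> U \<Longrightarrow> d\<phi> q (\<Sum>i\<in>I. a i *\<^sub>R x i) = (\<Sum>i\<in>I. a i *\<^sub>R d\<phi> q (x i))"
  by (simp add: linear_sum[OF linear_d\<phi>] linear_scale[OF linear_d\<phi>])

lemma d\<phi>_hproj: assumes q: "q \<in> U" shows "d\<phi> q (hproj q x) = d\<phi> q x"
proof -
  interpret inner_form "g q c" by (rule form[OF q])
  have "x = hproj q x + (\<Sum>i\<in>{DIM('f)+1..DIM('e)}. g q c x (e i q) *\<^sub>R e i q)"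
    using orthonormal_expansion[OF orthonormal_e[OF q], of x] unfolding sum_H_V hproj_def .
  then have "d\<phi> q x = d\<phi> q (hproj q x) + d\<phi> q (\<Sum>i\<in>{DIM('f)+1..DIM('e)}. g q c x (e i q) *\<^sub>R e i q)"
    using linear_add[OF linear_d\<phi>[OF q]] by metis
  moreover have "d\<phi> q (\<Sum>i\<in>{DIM('f)+1..DIM('e)}. g q c x (e i q) *\<^sub>R e i q) = 0"
    unfolding d\<phi>_sum[OF q] by (rule sum.neutral) (use vertical_e[OF q] in auto)
  ultimately show ?thesis by simp
qed

lemma horizontal_unique:
  assumes q: "q \<in> U" and "horizontal g B \<phi> q c x" "horizontal g B \<phi> q c y" "d\<phi> q x = d\<phi> q y"
  shows "x = y"
proof -
  interpret inner_form "g q c" by (rule form[OF q])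
  have "d\<phi> q (x - y) = 0" using assms linear_diff[OF linear_d\<phi>[OF q]] by simp
  then have "g q c x (x - y) = 0" "g q c y (x - y) = 0"
    using assms by (simp_all add: horizontal_iff)
  then have "g q c (x - y) (x - y) = 0" by (simp add: bilinear_lsub[OF bilinear])
  then show ?thesis using form_eq_0 by simp
qed

lemma hproj_horizontal: "q \<in> U \<Longrightarrow> horizontal g B \<phi> q c x \<Longrightarrow> hproj q x = x"
  by (rule horizontal_unique) (auto simp: horizontal_hproj d\<phi>_hproj)

lemma hor_eq: assumes q: "q \<in> U" shows "hor g B \<phi> X q c = hproj q (X q c)"
  unfolding hor_def
proof (rule the_equality)
  have "d\<phi> q (X q c - w) = 0 \<longleftrightarrow> d\<phi> q (X q c) = d\<phi> q w" for w
    using linear_diff[OF linear_d\<phi>[OF q]] by simp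
  note v = vertical_iff[OF q, of "X q c - _", unfolded this]
  show "horizontal g B \<phi> q c (hproj q (X q c)) \<and> vertical B \<phi> q c (X q c - hproj q (X q c))"
    by (simp add: horizontal_hproj[OF q] v d\<phi>_hproj[OF q])
  show "w = hproj q (X q c)" if "horizontal g B \<phi> q c w \<and> vertical B \<phi> q c (X q c - w)" for w
    by (rule horizontal_unique[OF q]) (use that in \<open>auto simp: horizontal_hproj[OF q] v d\<phi>_hproj[OF q]\<close>)
qed

lemma csmooth_hproj: "csmooth c U X \<Longrightarrow> csmooth c U (\<lambda>q. hproj q (X q))"
  unfolding hproj_def
  by (intro csmooth_sum csmooth_scaleR csmooth_form_fields[OF open_U order.refl] csmooth_e H_mem)

text \<open>The isometry property speaks of two horizontal vectors. One is enough: the vertical part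
  of the other is killed by \<open>d\<phi>\<close> on one side and orthogonal to \<open>z\<close> on
  the other.\<close>

lemma form_d\<phi>_horizontal:
  assumes q: "q \<in> U" and z: "horizontal g B \<phi> q c z"
  shows "h (\<phi> q) d (d\<phi> q a) (d\<phi> q z) = g q c a z" "h (\<phi> q) d (d\<phi> q z) (d\<phi> q a) = g q c z a"
proof -
  interpret inner_form "g q c" by (rule form[OF q])
  interpret h: inner_form "h (\<phi> q) d" by (rule N.form[OF \<phi>_mem[OF q]])
  have "d\<phi> q (a - hproj q a) = 0" using linear_diff[OF linear_d\<phi>[OF q]] d\<phi>_hproj[OF q] by simp
  then have "g q c z (a - hproj q a) = 0" using z by (simp add: horizontal_iff[OF q])
  then have "g q c a z = g q c (hproj q a) z" by (simp add: sym[of _ z] form_simps)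
  then show "h (\<phi> q) d (d\<phi> q a) (d\<phi> q z) = g q c a z"
    using isometry[OF q horizontal_hproj[OF q] z, of a] d\<phi>_hproj[OF q] by simp
  then show "h (\<phi> q) d (d\<phi> q z) (d\<phi> q a) = g q c z a"
    by (simp add: sym[of z] h.sym[of "d\<phi> q z"])
qed

lemma orthonormal_d\<phi>_e:
  assumes q: "q \<in> U" shows "orthonormal (h (\<phi> q) d) (\<lambda>i. d\<phi> q (e i q))"
  using orthonormal_e[OF q] H_mem
  by (auto simp: orthonormal_def form_d\<phi>_horizontal[OF q horizontal_e[OF q]])

text \<open>
  The trilinear form \<open>S\<close> below is symmetric in its first two arguments, and skew in the last two
  because \<open>d\<phi>\<close> is isometric on horizontal vectors; such a form vanishes.
\<close>

lemma sff_frame: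
  assumes p: "p \<in> U" and ij: "i \<in> {1..DIM('f)}" "j \<in> {1..DIM('f)}"
  shows "sff p (e i p) (e j p) = 0"
proof -
  interpret h: inner_form "h (\<phi> p) d" by (rule N.form[OF \<phi>_mem[OF p]])
  define S where "S = (\<lambda>i j k. h (\<phi> p) d (sff p (e i p) (e j p)) (d\<phi> p (e k p)))"
  have sym: "S i j k = S j i k" for i j k
    using sff_sym[OF p, of "e i p" "e j p"] by (simp add: S_def)
  have skew: "S i j k = - S i k j" if i: "i \<in> {1..DIM('f)}" and j: "j \<in> {1..DIM('f)}" and k: "k \<in> {1..DIM('f)}" for i j k
  proof -
    let ?x = "e i p"
    note sj = csmooth_e[OF H_mem[OF j]] and sk = csmooth_e[OF H_mem[OF k]]
    have "dir_deriv c (\<lambda>q. h (\<phi> q) d (d\<phi> q (e j q)) (d\<phi> q (e k q))) p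
        = dir_deriv c (\<lambda>q. g q c (e j q) (e k q)) p"
      by (rule dir_deriv_cong[OF p]) (simp add: form_d\<phi>_horizontal horizontal_e[OF _ k])
    then have "h (\<phi> p) d (pbD p ?x (\<lambda>q. d\<phi> q (e j q))) (d\<phi> p (e k p))
        + h (\<phi> p) d (d\<phi> p (e j p)) (pbD p ?x (\<lambda>q. d\<phi> q (e k q)))
        = g p c (covD p ?x (e j)) (e k p) + g p c (e j p) (covD p ?x (e k))"
      using pbD_metric[OF csmooth_d\<phi>[OF sj] csmooth_d\<phi>[OF sk] p, of ?x]
        dir_deriv_form_fields[OF sj sk p, of ?x] by simp
    then have "S i j k + h (\<phi> p) d (d\<phi> p (e j p)) (sff p ?x (e k p)) = 0"
      by (simp add: pbD_d\<phi>[OF sj p] pbD_d\<phi>[OF sk p] h.form_simps S_def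
          form_d\<phi>_horizontal[OF p horizontal_e[OF p j]] form_d\<phi>_horizontal[OF p horizontal_e[OF p k]])
    then show ?thesis by (simp add: S_def h.sym[of "d\<phi> p (e j p)"])
  qed
  \<comment> \<open>Six alternating moves return to the start with three sign changes: ijk = jik =
    -jki = -kji = kij = ikj = -ijk.\<close>
  have "S i j k = 0" if "k \<in> {1..DIM('f)}" for k
    using sym[of i j k] skew[OF ij(2,1) that] sym[of j k i] skew[OF that ij(2,1)] sym[of k i j]
      skew[OF ij(1) that ij(2)] by simp
  moreover have "sff p (e i p) (e j p) = (\<Sum>k=1..DIM('f). S i j k *\<^sub>R d\<phi> p (e k p))"
    unfolding S_def by (rule h.orthonormal_expansion[OF orthonormal_d\<phi>_e[OF p]])
  ultimately show ?thesis by simp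
qed

lemma sff_horizontal:
  assumes p: "p \<in> U" and x: "horizontal g B \<phi> p c x" and y: "horizontal g B \<phi> p c y"
  shows "sff p x y = 0"
proof -
  have l: "linear (sff p u)" "linear (\<lambda>u. sff p u v)" for u v
    using bilinear_sff[OF p] by (auto simp: bilinear_def)
  have "sff p (e i p) (hproj p y) = 0" if "i \<in> {1..DIM('f)}" for i
    unfolding hproj_def linear_sum[OF l(1)] linear_scale[OF l(1)]
    by (rule sum.neutral) (use sff_frame[OF p that] in auto)
  then have "sff p (hproj p x) (hproj p y) = 0"
    by (subst (1) hproj_def, simp add: linear_sum[OF l(2)] linear_scale[OF l(2)])
  then show ?thesis using hproj_horizontal[OF p] x y by simp
qed

text \<open>Differentiate the identity \<open>d\<phi> q (e s q) = 0\<close> along \<open>e s\<close>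
  itself; by \<open>pbD_d\<phi>\<close> exactly these two terms remain.\<close>

lemma sff_vertical_frame:
  assumes p: "p \<in> U" and s: "s \<in> {DIM('f)+1..DIM('e)}"
  shows "sff p (e s p) (e s p) = - d\<phi> p (covD p (e s p) (e s))"
proof -
  have "pbD p (e s p) (\<lambda>q. d\<phi> q (e s q)) = pbD p (e s p) (\<lambda>q. 0)"
    by (rule pbD_cong[OF p]) (rule vertical_e[OF _ s])
  then have "d\<phi> p (covD p (e s p) (e s)) + sff p (e s p) (e s p) = 0"
    using pbD_d\<phi>[OF csmooth_e[OF V_mem[OF s]] p, of "e s p"] by (simp add: pbD_0[OF p])
  then show ?thesis by (simp add: add_eq_0_iff)
qed

lemma trace_eq:
  fixes T :: "'e \<Rightarrow> 'e \<Rightarrow> 'x::real_vector"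
  assumes "p \<in> U" "bilinear T"
  shows "metric_trace (g p c) T = (\<Sum>i\<in>{1..DIM('f)}. T (e i p) (e i p)) + (\<Sum>s\<in>{DIM('f)+1..DIM('e)}. T (e s p) (e s p))"
  using inner_form.metric_trace_eq[OF form[OF assms(1)] assms(2) orthonormal_e[OF assms(1)]]
  by (simp only: sum_H_V)

text \<open>This is to become \<open>m - n\<close> times the mean curvature; at this stage it still
  refers to the chosen frame.\<close>

definition fibre_trace :: "'a \<Rightarrow> 'e" where
  "fibre_trace p = (\<Sum>s\<in>{DIM('f)+1..DIM('e)}. hproj p (covD p (e s p) (e s)))"

lemma tension_fibre_trace:
  assumes p: "p \<in> U" shows "tension g h \<phi> p c d = - d\<phi> p (fibre_trace p)"
proof -
  have "(\<Sum>i\<in>{1..DIM('f)}. sff p (e i p) (e i p)) = 0"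
    by (rule sum.neutral) (use sff_frame[OF p] in auto)
  moreover have "(\<Sum>s\<in>{DIM('f)+1..DIM('e)}. sff p (e s p) (e s p)) = - d\<phi> p (fibre_trace p)"
    unfolding fibre_trace_def linear_sum[OF linear_d\<phi>[OF p]] sum_negf[symmetric]
    by (rule sum.cong) (auto simp: sff_vertical_frame[OF p] d\<phi>_hproj[OF p])
  ultimately show ?thesis
    unfolding tension_eq trace_eq[OF p bilinear_sff[OF p]] by simp
qed

lemma horizontal_fibre_trace:
  assumes p: "p \<in> U" shows "horizontal g B \<phi> p c (fibre_trace p)"
proof -
  interpret inner_form "g p c" by (rule form[OF p])
  have "g p c (fibre_trace p) w = 0" if "d\<phi> p w = 0" for w
    unfolding fibre_trace_def sum_left
    by (rule sum.neutral) (use horizontal_hproj[OF p] that in \<open>auto simp: horizontal_iff[OF p]\<close>)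
  then show ?thesis by (simp add: horizontal_iff[OF p])
qed

lemma ricci_eq:
  assumes p: "p \<in> U"
  shows "ricci h (\<phi> p) d w = (\<Sum>i\<in>{1..DIM('f)}. curvature_at h (\<phi> p) d w (d\<phi> p (e i p)) (d\<phi> p (e i p)))"
  unfolding ricci_def
  by (rule inner_form.metric_trace_eq[OF N.form[OF \<phi>_mem[OF p]] _ orthonormal_d\<phi>_e[OF p]])
    (simp add: bilinear_def N.linear_curvature_at[OF \<phi>_mem[OF p]])

text \<open>Vertical vectors contribute zero through the last slot of the curvature. In the
  horizontal terms \<open>w\<close> stands second, while \<open>ricci\<close> has it first; the
  exchange produces the sign.\<close>

lemma curvature_trace_eq:
  assumes p: "p \<in> U"
  shows "metric_trace (g p c) (\<lambda>u v. curvature_at h (\<phi> p) d (d\<phi> p u) w (d\<phi> p v)) = - ricci h (\<phi> p) d w"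
proof -
  note R = N.linear_curvature_at[OF \<phi>_mem[OF p]]
  have "bilinear (\<lambda>u v. curvature_at h (\<phi> p) d (d\<phi> p u) w (d\<phi> p v))"
    unfolding bilinear_def
    using linear_compose[OF linear_d\<phi>[OF p] R(1)] linear_compose[OF linear_d\<phi>[OF p] R(3)]
    by (simp add: o_def)
  moreover have "(\<Sum>s\<in>{DIM('f)+1..DIM('e)}. curvature_at h (\<phi> p) d (d\<phi> p (e s p)) w (d\<phi> p (e s p))) = 0"
    by (rule sum.neutral) (use vertical_e[OF p] linear_0[OF R(3)] in auto)
  moreover have "(\<Sum>i\<in>{1..DIM('f)}. curvature_at h (\<phi> p) d (d\<phi> p (e i p)) w (d\<phi> p (e i p))) = - ricci h (\<phi> p) d w"
    unfolding ricci_eq[OF p] sum_negf[symmetric]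
    by (rule sum.cong) (auto intro: N.curvature_at_antisym[OF \<phi>_mem[OF p]])
  ultimately show ?thesis by (simp add: trace_eq[OF p])
qed

end

text \<open>Collects what the computation uses of \<mu>: smoothness, a related field on N, and the
  multiple of it that \<open>fibre_trace\<close> is. Horizontality follows, since
  \<open>m - n\<close> is nonzero.\<close>

locale basic_curvature_chart = adapted_chart A g B h \<phi> c d U e
  for A :: "('a::{t2_space, second_countable_topology}, 'e::euclidean_space) chart set"
    and g :: "('a, 'e) metric"
    and B :: "('b::{t2_space, second_countable_topology}, 'f::euclidean_space) chart set"
    and h :: "('b, 'f) metric"
    and \<phi> :: "'a \<Rightarrow> 'b" and c :: "('a, 'e) chart" and d :: "('b, 'f) chart" and U :: "'a set"
    and e :: "nat \<Rightarrow> 'a \<Rightarrow> 'e" +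
  fixes \<mu> :: "'a \<Rightarrow> 'e" and Y :: "'b \<Rightarrow> 'f"
  assumes csmooth_\<mu>: "csmooth c U \<mu>" and csmooth_Y: "csmooth d (cdom d) Y"
    and related: "q \<in> U \<Longrightarrow> d\<phi> q (\<mu> q) = Y (\<phi> q)"
    and fibre_trace_\<mu>: "q \<in> U \<Longrightarrow> fibre_trace q = (real DIM('e) - real DIM('f)) *\<^sub>R \<mu> q"
begin

lemma horizontal_\<mu>: assumes q: "q \<in> U" shows "horizontal g B \<phi> q c (\<mu> q)"
proof -
  interpret inner_form "g q c" by (rule form[OF q])
  show ?thesis
    using horizontal_fibre_trace[OF q] less by (simp add: horizontal_iff[OF q] fibre_trace_\<mu>[OF q] form_simps)
qed

abbreviation s :: "'a \<Rightarrow> 'f" where "s q \<equiv> d\<phi> q (\<mu> q)"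

lemma csmooth_s: "csmooth c U s" by (rule csmooth_d\<phi>[OF csmooth_\<mu>])

lemma pbD_s: assumes p: "p \<in> U" shows "pbD p v s = d\<phi> p (covD p (hproj p v) \<mu>)"
proof -
  have z: "d\<phi> p (v - hproj p v) = 0" using linear_diff[OF linear_d\<phi>[OF p]] d\<phi>_hproj[OF p] by simp
  have "pbD p (v - hproj p v) s = pbD p (v - hproj p v) (\<lambda>q. Y (\<phi> q))"
    by (rule pbD_cong[OF p related])
  also have "\<dots> = 0" by (rule pbD_along_\<phi>[OF csmooth_Y p z])
  finally have "pbD p v s = pbD p (hproj p v) s"
    using linear_diff[OF linear_pbD[OF csmooth_s p], of v "hproj p v"] by simp
  then show ?thesis
    by (simp add: pbD_d\<phi>[OF csmooth_\<mu> p] sff_horizontal[OF p horizontal_hproj[OF p] horizontal_\<mu>[OF p]])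
qed

text \<open>The derivative of \<open>s\<close> along \<open>e i\<close> is \<open>d\<phi>\<close> of
  \<open>covD q (e i q) \<mu>\<close>, and projecting this field horizontally does not change its
  image. Only after projection does the second differentiation meet two horizontal vectors, so that
  \<open>sff\<close> vanishes; this is the origin of the projection in the equation.\<close>

lemma hess_horizontal:
  assumes p: "p \<in> U" and i: "i \<in> {1..DIM('f)}"
  shows "hess p s (e i p) (e i p) = d\<phi> p (covD p (e i p) (\<lambda>q. hproj q (covD q (e i q) \<mu>)))
    - d\<phi> p (covD p (hproj p (covD p (e i p) (e i))) \<mu>)"
proof -
  note si = csmooth_e[OF H_mem[OF i]]
  let ?Z = "\<lambda>q. hproj q (covD q (e i q) \<mu>)"
  have sZ: "csmooth c U ?Z" by (rule csmooth_hproj[OF csmooth_covD[OF si csmooth_\<mu>]])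
  have "pbD p (e i p) (\<lambda>q. pbD q (e i q) s) = pbD p (e i p) (\<lambda>q. d\<phi> q (?Z q))"
    by (rule pbD_cong[OF p]) (simp add: pbD_s hproj_horizontal horizontal_e[OF _ i] d\<phi>_hproj)
  also have "\<dots> = d\<phi> p (covD p (e i p) ?Z)"
    by (simp add: pbD_d\<phi>[OF sZ p] sff_horizontal[OF p horizontal_e[OF p i] horizontal_hproj[OF p]])
  finally show ?thesis
    by (simp add: hess_fields[OF si csmooth_s p] pbD_s[OF p])
qed

text \<open>The first derivative vanishes on all of \<open>U\<close>, not just at \<open>p\<close>,
  so its derivative vanishes too and only the correction term in \<open>hess_fields\<close>
  survives.\<close>

lemma hess_vertical:
  assumes p: "p \<in> U" and i: "i \<in> {DIM('f)+1..DIM('e)}"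
  shows "hess p s (e i p) (e i p) = - d\<phi> p (covD p (hproj p (covD p (e i p) (e i))) \<mu>)"
proof -
  note si = csmooth_e[OF V_mem[OF i]]
  have "pbD q (e i q) s = 0" if q: "q \<in> U" for q
    using pbD_along_\<phi>[OF csmooth_Y q vertical_e[OF q i]] pbD_cong[OF q related] by simp
  then have "pbD p (e i p) (\<lambda>q. pbD q (e i q) s) = pbD p (e i p) (\<lambda>q. 0)"
    by (rule pbD_cong[OF p])
  then show ?thesis
    by (simp add: hess_fields[OF si csmooth_s p] pbD_s[OF p] pbD_0[OF p])
qed

text \<open>The corrections of the vertical directions are linear in the direction, so their sum is
  the derivative of \<mu> along \<open>fibre_trace\<close>; this is where the coefficient
  \<open>m - n\<close> of the last term comes from.\<close>

lemma trace_hess: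
  assumes p: "p \<in> U"
  shows "metric_trace (g p c) (hess p s) =
    d\<phi> p ((\<Sum>i\<in>{1..DIM('f)}. covD p (e i p) (\<lambda>q. hproj q (covD q (e i q) \<mu>))
       - covD p (hproj p (covD p (e i p) (e i))) \<mu>) - (real DIM('e) - real DIM('f)) *\<^sub>R covD p (\<mu> p) \<mu>)"
proof -
  note F = linear_d\<phi>[OF p] and C = linear_covD[OF csmooth_\<mu> p]
  have "(\<Sum>i\<in>{DIM('f)+1..DIM('e)}. hess p s (e i p) (e i p)) = - d\<phi> p (covD p (fibre_trace p) \<mu>)"
    by (simp add: hess_vertical[OF p] fibre_trace_def linear_sum[OF C] linear_sum[OF F] sum_negf)
  also have "\<dots> = - d\<phi> p ((real DIM('e) - real DIM('f)) *\<^sub>R covD p (\<mu> p) \<mu>)"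
    by (simp add: fibre_trace_\<mu>[OF p] linear_scale[OF C])
  finally show ?thesis
    by (simp add: trace_eq[OF p bilinear_hess[OF csmooth_s p]] hess_horizontal[OF p]
        linear_diff[OF F] linear_sum[OF F])
qed

lemma tension_\<mu>: "q \<in> U \<Longrightarrow> tension g h \<phi> q c d = (- (real DIM('e) - real DIM('f))) *\<^sub>R s q"
  by (simp only: tension_fibre_trace fibre_trace_\<mu> linear_scale[OF linear_d\<phi>] scaleR_minus_left)

text \<open>The minus signs in front of the Laplacian and inside it cancel, as do those of the
  curvature trace and of \<open>curvature_trace_eq\<close>. The common factor left over is the one
  of the tension field.\<close>

lemma bitension_eq:
  assumes p: "p \<in> U"
  shows "bitension g h \<phi> p c d = (- (real DIM('e) - real DIM('f))) *\<^sub>R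
   (d\<phi> p ((\<Sum>i\<in>{1..DIM('f)}. covD p (e i p) (\<lambda>q. hproj q (covD q (e i q) \<mu>))
       - covD p (hproj p (covD p (e i p) (e i))) \<mu>) - (real DIM('e) - real DIM('f)) *\<^sub>R covD p (\<mu> p) \<mu>)
    + ricci h (\<phi> p) d (s p))"
proof -
  let ?k = "- (real DIM('e) - real DIM('f))"
  have hs: "hess p (\<lambda>q. tension g h \<phi> q c d) u v = ?k *\<^sub>R hess p s u v" for u v
    using hess_cong[OF p tension_\<mu>] hess_scale[OF csmooth_s p] by (rule trans)
  have hb: "hess p (\<lambda>q. tension g h \<phi> q c d) = (\<lambda>u v. ?k *\<^sub>R hess p s u v)"
    by (intro ext) (rule hs)
  note b = bilinear_hess[OF csmooth_s p]
  have "bilinear (\<lambda>u v. ?k *\<^sub>R hess p s u v)"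
    using b unfolding bilinear_def by (auto intro: linear_compose_scale_right)
  then have "metric_trace (g p c) (\<lambda>u v. ?k *\<^sub>R hess p s u v) = ?k *\<^sub>R metric_trace (g p c) (hess p s)"
    by (simp only: trace_eq[OF p] b scaleR_right_distrib scaleR_sum_right)
  then have 1: "- pb_laplacian g h \<phi> (tension g h \<phi>) p c d = ?k *\<^sub>R metric_trace (g p c) (hess p s)"
    unfolding pb_laplacian_eq hb by simp
  have "linear (ricci h (\<phi> p) d)"
    unfolding ricci_eq[OF p, abs_def]
    by (intro linear_compose_sum ballI N.linear_curvature_at[OF \<phi>_mem[OF p]])
  then have 2: "ricci h (\<phi> p) d (?k *\<^sub>R s p) = ?k *\<^sub>R ricci h (\<phi> p) d (s p)"
    by (rule linear_scale)
  show ?thesis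
    unfolding bitension_def 1 curvature_trace_eq[OF p] trace_hess[OF p] tension_\<mu>[OF p] 2
    by (simp only: scaleR_right_distrib diff_minus_eq_add)
qed

end

section \<open>Global statement\<close>

lemma chart_change_eq_dir_deriv: "chart_change c c' p = dir_deriv c (coord c') p"
  by (intro ext) (simp add: chart_change_def dir_deriv_def o_def)

context
  fixes A :: "('a::{t2_space, second_countable_topology}, 'e::euclidean_space) chart set"
  assumes atlas: "smooth_atlas A"
begin

lemma atlas_open_cdom: "c \<in> A \<Longrightarrow> open (cdom c)"
  using atlas by (auto simp: smooth_atlas_def is_chart_def)

lemma atlas_chart_open: "c \<in> A \<Longrightarrow> open V \<Longrightarrow> V \<subseteq> cdom c \<Longrightarrow> chart_open c V"
  using atlas by unfold_locales (auto simp: smooth_atlas_def)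

lemma atlas_cover: obtains c where "c \<in> A" "p \<in> cdom c"
proof -
  have "p \<in> (\<Union>c\<in>A. cdom c)" using atlas by (simp add: smooth_atlas_def)
  then show ?thesis using that by blast
qed

lemma csmooth_coord:
  assumes "c \<in> A" "c' \<in> A" "V \<subseteq> cdom c \<inter> cdom c'" shows "csmooth c V (coord c')"
proof -
  have "csmooth c (cdom c \<inter> cdom c') (coord c')"
    using atlas assms by (auto simp: csmooth_def smooth_atlas_def o_def)
  then show ?thesis using assms(3) by (rule csmooth_subset)
qed

text \<open>The chain rule of \<open>dir_deriv_pullback\<close> along the identity map, read from
  \<open>c\<close> to \<open>c'\<close>.\<close>

lemma
  assumes c: "c \<in> A" and c': "c' \<in> A" and V: "open V" "V \<subseteq> cdom c \<inter> cdom c'" and f: "csmooth c' V f"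
  shows csmooth_chart_change: "csmooth c V f"
    and dir_deriv_chart_change: "p \<in> V \<Longrightarrow> dir_deriv c f p u = dir_deriv c' f p (chart_change c c' p u)"
proof -
  have o: "chart_open c V" "chart_open c' V" using atlas_chart_open c c' V by auto
  have i: "(\<lambda>q. q) ` V \<subseteq> V" by simp
  note s = csmooth_coord[OF c c' V(2)]
  show "csmooth c V f" by (rule csmooth_pullback[OF o i s f])
  show "dir_deriv c f p u = dir_deriv c' f p (chart_change c c' p u)" if "p \<in> V"
    using dir_deriv_pullback[OF o i s f that, of u]
    by (simp add: dmap_eq_dir_deriv chart_change_eq_dir_deriv)
qed

lemma chart_change_cocycle:
  assumes "c \<in> A" "c' \<in> A" "c'' \<in> A" "p \<in> cdom c \<inter> cdom c' \<inter> cdom c''"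
  shows "chart_change c' c'' p (chart_change c c' p u) = chart_change c c'' p u"
proof -
  let ?V = "cdom c \<inter> cdom c' \<inter> cdom c''"
  have "dir_deriv c (coord c'') p u = dir_deriv c' (coord c'') p (chart_change c c' p u)"
    by (rule dir_deriv_chart_change[of c c' ?V])
      (use assms in \<open>auto intro!: csmooth_coord atlas_open_cdom\<close>)
  then show ?thesis by (simp add: chart_change_eq_dir_deriv)
qed

lemma chart_change_same:
  assumes "c \<in> A" "p \<in> cdom c" shows "chart_change c c p u = u"
proof -
  interpret chart_open c "cdom c" using atlas_chart_open atlas_open_cdom assms by auto
  have "((\<lambda>y. coord c (cinv c y)) has_derivative (\<lambda>u. u)) (at (coord c p))"
    by (rule has_derivative_transform_within_open[OF has_derivative_ident open_coord])
      (use assms coord_cinv in auto)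
  from dir_deriv_eqI[OF this] show ?thesis by (simp add: chart_change_eq_dir_deriv)
qed

end

context
  fixes A :: "('a::{t2_space, second_countable_topology}, 'e::euclidean_space) chart set"
    and g :: "('a, 'e) metric"
    and B :: "('b::{t2_space, second_countable_topology}, 'f::euclidean_space) chart set"
    and h :: "('b, 'f) metric"
    and \<phi> :: "'a \<Rightarrow> 'b"
  assumes M: "riemannian_manifold A g" and N: "riemannian_manifold B h"
    and sub: "riemannian_submersion A g B h \<phi>"
begin

lemma atlases: "smooth_atlas A" "smooth_atlas B"
  using M N by (auto simp: riemannian_manifold_def)

lemma open_preimage: "d \<in> B \<Longrightarrow> open (\<phi> -` cdom d)"
  using sub atlas_open_cdom[OF atlases(2)] open_vimage
  by (auto simp: riemannian_submersion_def smooth_map_def)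

lemma submersion_chart_region:
  assumes "c \<in> A" "d \<in> B" "open U" "U \<subseteq> cdom c \<inter> \<phi> -` cdom d"
  shows "submersion_chart A g B h \<phi> c d U"
  using M N sub assms by unfold_locales auto

lemma dmap_chart_change:
  assumes "c \<in> A" "c' \<in> A" "d \<in> B" "p \<in> cdom c \<inter> cdom c' \<inter> \<phi> -` cdom d"
  shows "dmap \<phi> p c' d (chart_change c c' p u) = dmap \<phi> p c d u"
proof -
  let ?V = "cdom c \<inter> cdom c' \<inter> \<phi> -` cdom d"
  have V: "open ?V" using atlas_open_cdom[OF atlases(1)] open_preimage assms by auto
  interpret submersion_chart A g B h \<phi> c' d ?V
    by (rule submersion_chart_region) (use V assms in auto)
  have "dir_deriv c (\<lambda>q. coord d (\<phi> q)) p u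
      = dir_deriv c' (\<lambda>q. coord d (\<phi> q)) p (chart_change c c' p u)"
    by (rule dir_deriv_chart_change[OF atlases(1) assms(1,2) V _ csmooth_\<phi> assms(4)]) auto
  then show ?thesis by (simp add: dmap_eq_dir_deriv)
qed

lemma vertical_chart_change:
  assumes "c \<in> A" "c' \<in> A" "p \<in> cdom c \<inter> cdom c'"
  shows "vertical B \<phi> p c' (chart_change c c' p u) \<longleftrightarrow> vertical B \<phi> p c u"
  using dmap_chart_change[OF assms(1,2)] assms(3) unfolding vertical_def by auto

text \<open>A vertical test vector in \<open>c'\<close> is the image of a vertical vector in
  \<open>c\<close>, where orthogonality is known, and the metric respects the
  transformation.\<close>

lemma horizontal_chart_change:
  assumes c: "c \<in> A" and c': "c' \<in> A" and p: "p \<in> cdom c \<inter> cdom c'" and u: "horizontal g B \<phi> p c u"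
  shows "horizontal g B \<phi> p c' (chart_change c c' p u)"
  unfolding horizontal_def
proof (intro allI impI)
  fix w assume w: "vertical B \<phi> p c' w"
  have e: "chart_change c c' p (chart_change c' c p w) = w"
    using chart_change_cocycle[OF atlases(1) c' c c', of p w] chart_change_same[OF atlases(1) c', of p w] p
    by simp
  have "vertical B \<phi> p c (chart_change c' c p w)"
    using vertical_chart_change[OF c' c, of p w] w p by simp
  then have "g p c u (chart_change c' c p w) = 0" using u by (simp add: horizontal_def)
  moreover have "g p c u (chart_change c' c p w)
      = g p c' (chart_change c c' p u) (chart_change c c' p (chart_change c' c p w))"
    using M c c' p unfolding riemannian_manifold_def riemannian_metric_def by blast
  ultimately show "g p c' (chart_change c c' p u) w = 0" by (simp add: e)
qed

lemma adapted_frame_exists: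
  obtains W e where "p \<in> W" "adapted_frame A g B \<phi> W e"
proof -
  obtain c where cA: "c \<in> A" "p \<in> cdom c" using atlas_cover[OF atlases(1)] by blast
  obtain d where dB: "d \<in> B" "\<phi> p \<in> cdom d" using atlas_cover[OF atlases(2)] by blast
  let ?U = "cdom c \<inter> \<phi> -` cdom d"
  have U: "open ?U" using atlas_open_cdom[OF atlases(1)] open_preimage cA dB by auto
  interpret submersion_chart A g B h \<phi> c d ?U
    by (rule submersion_chart_region) (use U cA dB in auto)
  obtain W e where W: "open W" "W \<subseteq> ?U" "p \<in> W" and e: "frame_upto W DIM('e) e"
    and eh: "\<And>q i w. q \<in> W \<Longrightarrow> i \<in> {1..DIM('f)} \<Longrightarrow> d\<phi> q w = 0 \<Longrightarrow> g q c (e i q) w = 0"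
    and ev: "\<And>q s. q \<in> W \<Longrightarrow> s \<in> {DIM('f)+1..DIM('e)} \<Longrightarrow> d\<phi> q (e s q) = 0"
    by (rule local_adapted_frame[OF _ linear_d\<phi> surj_d\<phi> csmooth_d\<phi>[OF csmooth_const], of p])
      (use cA dB in auto)
  have Wc: "W \<subseteq> cdom c" using W(2) by auto
  \<comment> \<open>The frame was built in the single chart \<open>c\<close>. Its components in
    every other chart are set by the transformation law, and the cocycle identity gives the law
    between any two charts.\<close>
  define E where "E = (\<lambda>i p c'. chart_change c c' p (e i p))"
  have vf: "vector_field_on A W (E i)" if i: "i \<in> {1..DIM('e)}" for i
    unfolding vector_field_on_def
  proof (intro conjI ballI)
    fix c1 c2 q assume q: "c1 \<in> A" "c2 \<in> A" "q \<in> W \<inter> cdom c1 \<inter> cdom c2"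
    show "E i q c2 = chart_change c1 c2 q (E i q c1)"
      unfolding E_def
      by (rule chart_change_cocycle[OF atlases(1) cA(1) q(1,2), symmetric]) (use q Wc in auto)
  next
    fix c1 assume c1: "c1 \<in> A"
    let ?V = "W \<inter> cdom c1"
    have V: "open ?V" "?V \<subseteq> cdom c" "?V \<subseteq> cdom c1 \<inter> cdom c" "?V \<subseteq> cdom c \<inter> cdom c1"
      using W Wc atlas_open_cdom[OF atlases(1) c1] by auto
    interpret V: chart_open c ?V by (rule atlas_chart_open[OF atlases(1) cA(1) V(1,2)])
    have "csmooth c ?V (e i)"
      using e i csmooth_subset[of c W "e i" ?V] by (simp add: frame_upto_def)
    then have "csmooth c ?V (\<lambda>q. E i q c1)"
      unfolding E_def chart_change_eq_dir_deriv
      by (rule V.csmooth_dir_deriv[OF csmooth_coord[OF atlases(1) cA(1) c1 V(4)]])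
    then have "csmooth c1 ?V (\<lambda>q. E i q c1)"
      by (rule csmooth_chart_change[OF atlases(1) c1 cA(1) V(1,3)])
    then show "smooth_on (coord c1 ` (W \<inter> cdom c1)) (\<lambda>y. E i (cinv c1 y) c1)"
      by (simp add: csmooth_def)
  qed
  have "adapted_frame A g B \<phi> W E"
    unfolding adapted_frame_def
  proof (intro conjI ballI W(1) vf)
    fix c1 q assume c1: "c1 \<in> A" and q: "q \<in> W \<inter> cdom c1"
    then have qW: "q \<in> W" and qU: "q \<in> ?U" and qc: "q \<in> cdom c \<inter> cdom c1" using W by auto
    have o: "orthonormal (g q c) (\<lambda>i. e i q)"
      using e qW unfolding frame_upto_def inner_form.orthonormal_upto_DIM[OF form[OF qU], symmetric]
      by blast
    have "g q c u v = g q c1 (chart_change c c1 q u) (chart_change c c1 q v)" for u v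
      using M cA(1) c1 qc unfolding riemannian_manifold_def riemannian_metric_def by blast
    then show "orthonormal (g q c1) (\<lambda>i. E i q c1)"
      using o by (simp add: orthonormal_def E_def)
    show "horizontal g B \<phi> q c1 (E i q c1)" if "i \<in> {1..DIM('f)}" for i
      unfolding E_def
      by (rule horizontal_chart_change[OF cA(1) c1 qc]) (use eh[OF qW that] in \<open>simp add: horizontal_iff[OF qU]\<close>)
    show "vertical B \<phi> q c1 (E s q c1)" if "s \<in> {DIM('f)+1..DIM('e)}" for s
      unfolding E_def vertical_chart_change[OF cA(1) c1 qc] vertical_iff[OF qU] by (rule ev[OF qW that])
  qed
  then show ?thesis by (rule that[OF W(3)])
qed

lemma adapted_frame_chart:
  assumes "DIM('f) < DIM('e)" "adapted_frame A g B \<phi> W e" and c: "c \<in> A" and d: "d \<in> B"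
  shows "adapted_chart A g B h \<phi> c d (W \<inter> cdom c \<inter> \<phi> -` cdom d) (\<lambda>i q. e i q c)"
proof -
  let ?U = "W \<inter> cdom c \<inter> \<phi> -` cdom d"
  have W: "open W" and vf: "\<And>i. i \<in> {1..DIM('e)} \<Longrightarrow> vector_field_on A W (e i)"
    and fr: "\<And>p. p \<in> W \<inter> cdom c \<Longrightarrow> orthonormal (g p c) (\<lambda>i. e i p c) \<and>
        (\<forall>i\<in>{1..DIM('f)}. horizontal g B \<phi> p c (e i p c)) \<and>
        (\<forall>s\<in>{DIM('f)+1..DIM('e)}. vertical B \<phi> p c (e s p c))"
    using assms(2) c unfolding adapted_frame_def by blast+
  have U: "open ?U" using W atlas_open_cdom[OF atlases(1) c] open_preimage[OF d] by auto
  interpret submersion_chart A g B h \<phi> c d ?U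
    by (rule submersion_chart_region) (use U c d in auto)
  show ?thesis
  proof
    show "DIM('f) < DIM('e)" by fact
    show "csmooth c ?U (\<lambda>q. e i q c)" if i: "i \<in> {1..DIM('e)}" for i
    proof (rule csmooth_subset)
      show "csmooth c (W \<inter> cdom c) (\<lambda>q. e i q c)"
        using vf[OF i] c unfolding csmooth_def vector_field_on_def by blast
    qed auto
    fix q assume q: "q \<in> ?U"
    then have f: "q \<in> W \<inter> cdom c" by auto
    show "orthonormal (g q c) (\<lambda>i. e i q c)" using fr[OF f] by blast
    show "horizontal g B \<phi> q c (e i q c)" if "i \<in> {1..DIM('f)}" for i using fr[OF f] that by blast
    show "d\<phi> q (e s q c) = 0" if "s \<in> {DIM('f)+1..DIM('e)}" for s
      using fr[OF f] that vertical_iff[OF q] by blast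
  qed
qed

text \<open>For two adapted frames both values of \<open>fibre_trace\<close> are horizontal, and
  \<open>d\<phi>\<close> sends both to minus the tension field, which involves no frame. As
  \<open>d\<phi>\<close> is injective on horizontal vectors, they coincide.\<close>

lemma mean_curvature_eq:
  assumes less: "DIM('f) < DIM('e)" and e: "adapted_frame A g B \<phi> W e" and c: "c \<in> A" "p \<in> cdom c" and p: "p \<in> W"
  shows "mean_curvature A g B \<phi> p c = (1 / (real DIM('e) - real DIM('f))) *\<^sub>R
    (\<Sum>s=DIM('f)+1..DIM('e). hor g B \<phi> (nabla g (e s) (e s)) p c)"
  unfolding mean_curvature_def
proof (rule the_equality)
  obtain d where d: "d \<in> B" "\<phi> p \<in> cdom d" using atlas_cover[OF atlases(2)] by blast
  interpret e: adapted_chart A g B h \<phi> c d "W \<inter> cdom c \<inter> \<phi> -` cdom d" "\<lambda>i q. e i q c"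
    by (rule adapted_frame_chart[OF less e c(1) d(1)])
  have pU: "p \<in> W \<inter> cdom c \<inter> \<phi> -` cdom d" using p c d by auto
  have eq: "(\<Sum>s=DIM('f)+1..DIM('e). hor g B \<phi> (nabla g (e' s) (e' s)) p c)
      = (\<Sum>s=DIM('f)+1..DIM('e). hor g B \<phi> (nabla g (e s) (e s)) p c)"
    if e': "adapted_frame A g B \<phi> W' e'" and p': "p \<in> W'" for W' e'
  proof -
    interpret e': adapted_chart A g B h \<phi> c d "W' \<inter> cdom c \<inter> \<phi> -` cdom d" "\<lambda>i q. e' i q c"
      by (rule adapted_frame_chart[OF less e' c(1) d(1)])
    have pU': "p \<in> W' \<inter> cdom c \<inter> \<phi> -` cdom d" using p' c d by auto
    have "e'.fibre_trace p = e.fibre_trace p"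
      by (rule e.horizontal_unique[OF pU e'.horizontal_fibre_trace[OF pU'] e.horizontal_fibre_trace[OF pU]])
        (use e.tension_fibre_trace[OF pU] e'.tension_fibre_trace[OF pU'] in simp)
    moreover have "(\<Sum>s=DIM('f)+1..DIM('e). hor g B \<phi> (nabla g (e' s) (e' s)) p c) = e'.fibre_trace p"
      by (simp only: e'.fibre_trace_def e'.hor_eq[OF pU'] e'.nabla_eq_covD)
    moreover have "(\<Sum>s=DIM('f)+1..DIM('e). hor g B \<phi> (nabla g (e s) (e s)) p c) = e.fibre_trace p"
      by (simp only: e.fibre_trace_def e.hor_eq[OF pU] e.nabla_eq_covD)
    ultimately show ?thesis by (simp only:)
  qed
  let ?w = "(1 / (real DIM('e) - real DIM('f))) *\<^sub>R
    (\<Sum>s=DIM('f)+1..DIM('e). hor g B \<phi> (nabla g (e s) (e s)) p c)"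
  show "\<forall>W e. adapted_frame A g B \<phi> W e \<and> p \<in> W \<longrightarrow>
     ?w = (1 / (real DIM('e) - real DIM('f))) *\<^sub>R
           (\<Sum>s=DIM('f)+1..DIM('e). hor g B \<phi> (nabla g (e s) (e s)) p c)"
    by (intro allI impI) (elim conjE, simp only: eq)
  show "w = ?w" if "\<forall>W e. adapted_frame A g B \<phi> W e \<and> p \<in> W \<longrightarrow>
     w = (1 / (real DIM('e) - real DIM('f))) *\<^sub>R
           (\<Sum>s=DIM('f)+1..DIM('e). hor g B \<phi> (nabla g (e s) (e s)) p c)" for w
    using that e p by blast
qed

text \<open>Translates \<open>bitension_eq\<close> back to the global operators and cancels the
  nonzero factor. The point and both charts stay fixed, so it applies to every adapted frame
  separately.\<close>

lemma bitension_eq_0_iff: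
  assumes less: "DIM('f) < DIM('e)" and mu: "\<mu> = mean_curvature A g B \<phi>" and bas: "basic A g B \<phi> \<mu>"
    and e: "adapted_frame A g B \<phi> W e" and c: "c \<in> A" and d: "d \<in> B"
    and p: "p \<in> W \<inter> cdom c \<inter> \<phi> -` cdom d"
  shows "bitension g h \<phi> p c d = 0 \<longleftrightarrow>
    dmap \<phi> p c d
       ((\<Sum>i=1..DIM('f). nabla g (e i) (hor g B \<phi> (nabla g (e i) \<mu>)) p c
                 - nabla g (hor g B \<phi> (nabla g (e i) (e i))) \<mu> p c)
        - (real DIM('e) - real DIM('f)) *\<^sub>R nabla g \<mu> \<mu> p c)
     + ricci h (\<phi> p) d (dmap \<phi> p c d (\<mu> p c)) = 0"
proof -
  let ?U = "W \<inter> cdom c \<inter> \<phi> -` cdom d"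
  interpret adapted_chart A g B h \<phi> c d ?U "\<lambda>i q. e i q c"
    by (rule adapted_frame_chart[OF less e c d])
  from bas obtain Y where vf: "vector_field_on A UNIV \<mu>" and Y: "vector_field_on B UNIV Y"
    and rel: "\<And>q. q \<in> ?U \<Longrightarrow> dmap \<phi> q c d (\<mu> q c) = Y (\<phi> q) d"
    using c d unfolding basic_def by blast
  interpret basic_curvature_chart A g B h \<phi> c d ?U "\<lambda>i q. e i q c" "\<lambda>q. \<mu> q c" "\<lambda>x. Y x d"
  proof
    show "csmooth c ?U (\<lambda>q. \<mu> q c)"
    proof (rule csmooth_subset)
      show "csmooth c (UNIV \<inter> cdom c) (\<lambda>q. \<mu> q c)"
        using vf c unfolding csmooth_def vector_field_on_def by blast
    qed auto
    have "csmooth d (UNIV \<inter> cdom d) (\<lambda>x. Y x d)"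
      using Y d unfolding csmooth_def vector_field_on_def by blast
    then show "csmooth d (cdom d) (\<lambda>x. Y x d)" by simp
    show "dmap \<phi> q c d (\<mu> q c) = Y (\<phi> q) d" if "q \<in> ?U" for q by (rule rel[OF that])
    show "fibre_trace q = (real DIM('e) - real DIM('f)) *\<^sub>R \<mu> q c" if q: "q \<in> ?U" for q
    proof -
      have "fibre_trace q = (\<Sum>s=DIM('f)+1..DIM('e). hor g B \<phi> (nabla g (e s) (e s)) q c)"
        by (simp only: fibre_trace_def hor_eq[OF q] nabla_eq_covD)
      then have "\<mu> q c = (1 / (real DIM('e) - real DIM('f))) *\<^sub>R fibre_trace q"
        using mean_curvature_eq[OF less e c, of q] q by (simp only: mu Int_iff)
      then show ?thesis using less by simp
    qed
  qed
  have 1: "nabla g (e i) (hor g B \<phi> (nabla g (e i) \<mu>)) p c =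
      covD p (e i p c) (\<lambda>q. hproj q (covD q (e i q c) (\<lambda>q. \<mu> q c)))" for i
    unfolding nabla_eq_covD
    by (rule covD_cong[OF p]) (simp only: hor_eq nabla_eq_covD)
  have 2: "nabla g (hor g B \<phi> (nabla g (e i) (e i))) \<mu> p c =
      covD p (hproj p (covD p (e i p c) (\<lambda>q. e i q c))) (\<lambda>q. \<mu> q c)" for i
    by (simp only: hor_eq[OF p] nabla_eq_covD)
  have "- (real DIM('e) - real DIM('f)) \<noteq> 0" using less by simp
  then show ?thesis
    unfolding bitension_eq[OF p] 1 2 nabla_eq_covD[of \<mu> \<mu>] scaleR_eq_0_iff by blast
qed

end

text \<open>For each adapted frame the equation is equivalent, point by point, to vanishing of the
  bitension field. As such frames exist around every point, asking it for some frame near each point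
  or for all frames amounts to the same.\<close>

theorem corollary2p2:
  fixes A :: "('a::{t2_space, second_countable_topology}, 'e::euclidean_space) chart set"
    and g :: "('a, 'e) metric"
    and B :: "('b::{t2_space, second_countable_topology}, 'f::euclidean_space) chart set"
    and h :: "('b, 'f) metric"
    and \<phi> :: "'a \<Rightarrow> 'b"
    and \<mu> :: "('a, 'e) field"
    and m n :: nat
  assumes m: "m = DIM('e)" and n: "n = DIM('f)" and mn: "m > n"
    and M: "riemannian_manifold A g"
    and N: "riemannian_manifold B h"
    and sub: "riemannian_submersion A g B h \<phi>"
    and mu: "\<mu> = mean_curvature A g B \<phi>"
    and bas: "basic A g B \<phi> \<mu>"
  shows
    "let equation_on = (\<lambda>W e. \<forall>c\<in>A. \<forall>d\<in>B. \<forall>p \<in> W \<inter> cdom c \<inter> \<phi> -` cdom d.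
           dmap \<phi> p c d
             ((\<Sum>i=1..n. nabla g (e i) (hor g B \<phi> (nabla g (e i) \<mu>)) p c
                       - nabla g (hor g B \<phi> (nabla g (e i) (e i))) \<mu> p c)
              - (real m - real n) *\<^sub>R nabla g \<mu> \<mu> p c)
           + ricci h (\<phi> p) d (dmap \<phi> p c d (\<mu> p c)) = 0)
     in (biharmonic A g B h \<phi> \<longleftrightarrow>
           (\<forall>p. \<exists>W e. p \<in> W \<and> adapted_frame A g B \<phi> W e \<and> equation_on W e))
        \<and> (biharmonic A g B h \<phi> \<longleftrightarrow>
           (\<forall>W e. adapted_frame A g B \<phi> W e \<longrightarrow> equation_on W e))"
proof -
  define equation_on where "equation_on = (\<lambda>W (e :: nat \<Rightarrow> ('a, 'e) field). \<forall>c\<in>A. \<forall>d\<in>B. \<forall>p \<in> W \<inter> cdom c \<inter> \<phi> -` cdom d.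
           dmap \<phi> p c d
             ((\<Sum>i=1..n. nabla g (e i) (hor g B \<phi> (nabla g (e i) \<mu>)) p c
                       - nabla g (hor g B \<phi> (nabla g (e i) (e i))) \<mu> p c)
              - (real m - real n) *\<^sub>R nabla g \<mu> \<mu> p c)
           + ricci h (\<phi> p) d (dmap \<phi> p c d (\<mu> p c)) = 0)"
  have iff: "equation_on W e \<longleftrightarrow>
      (\<forall>c\<in>A. \<forall>d\<in>B. \<forall>p \<in> W \<inter> cdom c \<inter> \<phi> -` cdom d. bitension g h \<phi> p c d = 0)"
    if "adapted_frame A g B \<phi> W e" for W e
    using bitension_eq_0_iff[OF M N sub mn[unfolded m n] mu bas that]
    by (simp add: equation_on_def m n)
  have ex: "\<exists>W e. p \<in> W \<and> adapted_frame A g B \<phi> W e" for p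
    using adapted_frame_exists[OF M N sub] by blast
  have 1: "equation_on W e" if "biharmonic A g B h \<phi>" "adapted_frame A g B \<phi> W e" for W e
    using that(1) unfolding iff[OF that(2)] biharmonic_def by blast
  have 2: "biharmonic A g B h \<phi>"
    if local: "\<And>p. \<exists>W e. p \<in> W \<and> adapted_frame A g B \<phi> W e \<and> equation_on W e"
    unfolding biharmonic_def
  proof (intro ballI)
    fix c d p assume p: "c \<in> A" "d \<in> B" "p \<in> cdom c \<inter> \<phi> -` cdom d"
    obtain W e where "p \<in> W" "adapted_frame A g B \<phi> W e" "equation_on W e"
      using local[of p] by blast
    then show "bitension g h \<phi> p c d = 0" using iff[of W e] p by blast
  qed
  show ?thesis
    unfolding Let_def equation_on_def[symmetric]
  proof (intro conjI iffI allI impI)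
    show "\<exists>W e. p \<in> W \<and> adapted_frame A g B \<phi> W e \<and> equation_on W e" if "biharmonic A g B h \<phi>" for p
      using ex[of p] 1[OF that] by blast
    show "biharmonic A g B h \<phi>" if "\<forall>p. \<exists>W e. p \<in> W \<and> adapted_frame A g B \<phi> W e \<and> equation_on W e"
      by (rule 2) (rule spec[OF that])
    show "equation_on W e" if "biharmonic A g B h \<phi>" "adapted_frame A g B \<phi> W e" for W e
      using 1 that by blast
    show "biharmonic A g B h \<phi>" if "\<forall>W e. adapted_frame A g B \<phi> W e \<longrightarrow> equation_on W e"
    proof (rule 2)
      fix p
      \<comment> \<open>Existence of a frame around \<open>p\<close> keeps the universal condition
        from holding vacuously there.\<close>
      obtain W e where "p \<in> W" "adapted_frame A g B \<phi> W e" using ex by blast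
      with that show "\<exists>W e. p \<in> W \<and> adapted_frame A g B \<phi> W e \<and> equation_on W e" by blast
    qed
  qed
qed

end
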